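(* Let $G$ be a connected finite graph of genus $g$ (as in the context). Then: (a) There exists a unique $\theta\in\mathcal X$ such that for all $\omega,\omega'\in\Omega(G)$ with $\underline{\omega}+\underline{\omega'}=\theta$ we have (i) $A_{\omega'}$ is similar to $-A_\omega$, and $\operatorname{spec}A_{\omega'}=-\operatorname{spec}A_\omega$; and (ii) $\operatorname{spec}W_{1,\omega'}=-\operatorname{spec}W_{1,\omega}$. Moreover, for each $\omega\in\Omega(G)$, we have $\underline{\omega}=\theta$ if $\operatorname{spec}W_{1,\omega}=-\operatorname{spec}W_1$. (b) $\theta$ is a $2$-torsion element of $\mathcal X$. (c) $\theta=0$ if and only if $G$ is bipartite. In this case, for each $\omega\in\Omega(G)$, both $\operatorname{spec}A_\omega$ and $\operatorname{spec}W_{1,\omega}$ are invariant under negation. (d) $\rho(A_\omega)\le\rho(A)$ and $\rho(W_{1,\omega})\le\rho(W_1)$ for all $\omega\in\Omega(G)$. (e) $\rho(A_\omega)<\rho(A)$ for all $\omega\in\Omega(G)$ with $\underline{\omega}\notin\{0,\theta\}$. (f) If $g=1$, then $\rho(W_{1,\omega})=1$ for all $\omega\in\Omega(G)$. (g) If $G$ is non-bipartite and $g\ge 2$, then $\rho(W_{1,\omega})<\rho(W_1)$ for all $\omega\in\Omega(G)$ with $\underline{\omega}\notin\{0,\theta\}$. (h) If $G$ is bipartite and $g\ge 2$, then $\rho(W_{1,\omega})<\rho(W_1)$ for all $\omega\in\Omega(G)$ such that $\underline{\omega}$ is not a $2$-torsion element of $\mathcal X$.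
   Context: $G$ is a connected finite graph (multiple edges and loops allowed) with vertex set $V(G)=\{v_1,\dots,v_n\}$ and $m$ edges; its genus is $g=m-n+1$. Each edge gives two mutually inverse oriented edges; $\mathbf E(G)$ is the set of $2m$ oriented edges; for $\mathbf a\in\mathbf E(G)$, $\mathbf a(0)$ and $\mathbf a(1)$ are its initial and terminal vertices and $\mathbf a^{-1}$ its inverse. Fix an orientation, with positively oriented edges $\mathbf e_1,\dots,\mathbf e_m$. $\mathcal T(G)$ is the real vector space with basis $\mathbf e_1,\dots,\mathbf e_m$, where $\mathbf e_i^{-1}$ is identified with $-\mathbf e_i$; $\Omega(G)$ is its dual (the $1$-forms), with dual basis $d\mathbf e_1,\dots,d\mathbf e_m$, and carries the inner product for which the $d\mathbf e_i$ are orthonormal. $H_1(G,\mathbb Z)$ is the set of $\sum_i c_i\mathbf e_i$ with $c_i\in\mathbb Z$ and $\sum_i c_i(\mathbf e_i(1)-\mathbf e_i(0))=0$ (formal sum of vertices). A $1$-form $\omega=\sum_i\omega_i\,d\mathbf e_i$ is harmonic if $\sum_{i:\mathbf e_i(1)=v}\omega_i=\sum_{i:\mathbf e_i(0)=v}\omega_i$ for every vertex $v$, and exact if $\omega=\sum_i(f(\mathbf e_i(1))-f(\mathbf e_i(0)))\,d\mathbf e_i$ for some $f:V(G)\to\mathbb R$. $\Omega(G)$ is the orthogonal direct sum of the space $\mathcal H^1(G)$ of harmonic forms and the space of exact forms; $\phi_1(\omega)$ denotes the harmonic component of $\omega$. Let $H_1(G,\mathbb Z)^\vee=\{\eta\in\mathcal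 H^1(G):\eta(\alpha)\in\mathbb Z\ \forall\alpha\in H_1(G,\mathbb Z)\}$ and $\mathcal X=\mathcal H^1(G)/H_1(G,\mathbb Z)^\vee$ (the character group, a real $g$-dimensional torus); for $\omega\in\Omega(G)$, $\underline{\omega}=\phi_1(\omega)+H_1(G,\mathbb Z)^\vee\in\mathcal X$. Write $e(x)=\exp(2\pi\sqrt{-1}x)$ and $\chi_\omega(\alpha)=e(\omega(\alpha))$ for $\alpha\in\mathcal T(G)$. Twisted adjacency matrix: $A_\omega$ is the $n\times n$ matrix with $(A_\omega)_{vw}=\sum_{\mathbf e\in\mathbf E(G),\,\mathbf e(0)=v,\,\mathbf e(1)=w}\chi_\omega(\mathbf e)$. Say $\mathbf a$ feeds into $\mathbf b$ if $\mathbf a(1)=\mathbf b(0)$ and $\mathbf b\ne\mathbf a^{-1}$. Twisted edge adjacency matrix: $W_{1,\omega}$ is the $2m\times 2m$ matrix indexed by $\mathbf E(G)$ with $(W_{1,\omega})_{\mathbf a\mathbf b}=\chi_\omega(\mathbf b)$ if $\mathbf a$ feeds into $\mathbf b$ and $0$ otherwise. $A=A_0$, $W_1=W_{1,0}$. $\operatorname{spec}M$ is the multiset of eigenvalues of $M$; $\operatorname{spec}M=-\operatorname{spec}N$ means $\lambda$ has multiplicity $k$ in $\operatorname{spec}M$ iff $-\lambda$ has multiplicity $k$ in $\operatorname{spec}N$; $\rho(M)$ is the spectral radius. *)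

theory Defs
  imports
    "Graph_Theory.Digraph_Component"
    "Jordan_Normal_Form.Spectral_Radius"
    "HOL-Algebra.Coset"
    "HOL-Library.Multiset"
begin

text \<open>
  A finite graph (loops and multiple edges allowed) together with a fixed orientation is a finite
  multi-digraph \<^term>\<open>G\<close>: its arcs are the positively oriented edges, with initial vertex
  \<^term>\<open>tail G e\<close> and terminal vertex \<^term>\<open>head G e\<close>. An oriented edge is a pair of an arc and a
  sign: \<open>(e, True)\<close> is the positively oriented edge \<open>e\<close>, and \<open>(e, False)\<close> is its inverse; thus a
  loop also gives two oriented edges.
\<close>

definition genus :: "('a, 'b) pre_digraph \<Rightarrow> int" where
  "genus G = int (card (arcs G)) - int (card (verts G)) + 1"

definition bipartite :: "('a, 'b) pre_digraph \<Rightarrow> bool" where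
  "bipartite G \<longleftrightarrow> (\<exists>X Y. X \<union> Y = verts G \<and> X \<inter> Y = {} \<and>
     (\<forall>e \<in> arcs G. (tail G e \<in> X \<and> head G e \<in> Y) \<or> (tail G e \<in> Y \<and> head G e \<in> X)))"

definition oriented_edges :: "('a, 'b) pre_digraph \<Rightarrow> ('b \<times> bool) set" where
  "oriented_edges G = arcs G \<times> UNIV"

definition edge_init :: "('a, 'b) pre_digraph \<Rightarrow> 'b \<times> bool \<Rightarrow> 'a" where
  "edge_init G a = (if snd a then tail G (fst a) else head G (fst a))"

definition edge_term :: "('a, 'b) pre_digraph \<Rightarrow> 'b \<times> bool \<Rightarrow> 'a" where
  "edge_term G a = (if snd a then head G (fst a) else tail G (fst a))"

definition edge_inv :: "'b \<times> bool \<Rightarrow> 'b \<times> bool" where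
  "edge_inv a = (fst a, \<not> snd a)"

definition feeds_into :: "('a, 'b) pre_digraph \<Rightarrow> 'b \<times> bool \<Rightarrow> 'b \<times> bool \<Rightarrow> bool" where
  "feeds_into G a b \<longleftrightarrow> edge_term G a = edge_init G b \<and> b \<noteq> edge_inv a"


text \<open>
  Elements of the space spanned by the arcs, and 1-forms, are given by their coordinates in the
  basis of arcs and in its dual basis; coordinates outside \<^term>\<open>arcs G\<close> are 0.
\<close>

definition chains :: "('a, 'b) pre_digraph \<Rightarrow> ('b \<Rightarrow> real) set" where
  "chains G = {\<alpha>. \<forall>e. e \<notin> arcs G \<longrightarrow> \<alpha> e = 0}"

definition edge_chain :: "'b \<times> bool \<Rightarrow> ('b \<Rightarrow> real)" where
  "edge_chain a = (\<lambda>e. if e = fst a then (if snd a then 1 else - 1) else 0)"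

definition boundary :: "('a, 'b) pre_digraph \<Rightarrow> ('b \<Rightarrow> real) \<Rightarrow> ('a \<Rightarrow> real)" where
  "boundary G \<alpha> = (\<lambda>v. \<Sum>e\<in>arcs G. \<alpha> e * (of_bool (head G e = v) - of_bool (tail G e = v)))"

definition integral_homology :: "('a, 'b) pre_digraph \<Rightarrow> ('b \<Rightarrow> real) set" where
  "integral_homology G = {\<alpha> \<in> chains G. (\<forall>e. \<alpha> e \<in> \<int>) \<and> (\<forall>v. boundary G \<alpha> v = 0)}"

definition one_forms :: "('a, 'b) pre_digraph \<Rightarrow> ('b \<Rightarrow> real) set" where
  "one_forms G = {\<omega>. \<forall>e. e \<notin> arcs G \<longrightarrow> \<omega> e = 0}"

definition pairing :: "('a, 'b) pre_digraph \<Rightarrow> ('b \<Rightarrow> real) \<Rightarrow> ('b \<Rightarrow> real) \<Rightarrow> real" where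
  "pairing G \<omega> \<alpha> = (\<Sum>e\<in>arcs G. \<omega> e * \<alpha> e)"

definition harmonic_forms :: "('a, 'b) pre_digraph \<Rightarrow> ('b \<Rightarrow> real) set" where
  "harmonic_forms G = {\<omega> \<in> one_forms G. \<forall>v \<in> verts G.
     (\<Sum>e | e \<in> arcs G \<and> head G e = v. \<omega> e) = (\<Sum>e | e \<in> arcs G \<and> tail G e = v. \<omega> e)}"

definition exact_forms :: "('a, 'b) pre_digraph \<Rightarrow> ('b \<Rightarrow> real) set" where
  "exact_forms G = {\<omega> \<in> one_forms G. \<exists>f. \<forall>e \<in> arcs G. \<omega> e = f (head G e) - f (tail G e)}"

text \<open>
  The 1-forms are the direct sum of the harmonic and the exact ones, so the component is
  determined by the following description; uniqueness is the lemma \<open>harmonic_exact_zero\<close> below.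
\<close>

definition harmonic_part :: "('a, 'b) pre_digraph \<Rightarrow> ('b \<Rightarrow> real) \<Rightarrow> ('b \<Rightarrow> real)" where
  "harmonic_part G \<omega> = (THE \<eta>. \<eta> \<in> harmonic_forms G \<and> (\<lambda>e. \<omega> e - \<eta> e) \<in> exact_forms G)"

definition dual_lattice :: "('a, 'b) pre_digraph \<Rightarrow> ('b \<Rightarrow> real) set" where
  "dual_lattice G = {\<eta> \<in> harmonic_forms G. \<forall>\<alpha> \<in> integral_homology G. pairing G \<eta> \<alpha> \<in> \<int>}"

text \<open>
  The character group is the quotient of the additive group of harmonic forms by the dual
  lattice. HOL-Algebra writes groups multiplicatively: the sum in the character group is
  \<open>\<otimes>\<close> and its zero is \<open>\<one>\<close>.
\<close>

definition harmonic_group :: "('a, 'b) pre_digraph \<Rightarrow> ('b \<Rightarrow> real) monoid" where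
  "harmonic_group G =
     \<lparr>carrier = harmonic_forms G, mult = (\<lambda>\<eta> \<eta>' e. \<eta> e + \<eta>' e), one = (\<lambda>e. 0)\<rparr>"

definition character_group :: "('a, 'b) pre_digraph \<Rightarrow> ('b \<Rightarrow> real) set monoid" where
  "character_group G = harmonic_group G Mod dual_lattice G"

definition form_class :: "('a, 'b) pre_digraph \<Rightarrow> ('b \<Rightarrow> real) \<Rightarrow> ('b \<Rightarrow> real) set" where
  "form_class G \<omega> = dual_lattice G #>\<^bsub>harmonic_group G\<^esub> harmonic_part G \<omega>"

definition two_torsion :: "'c monoid \<Rightarrow> 'c \<Rightarrow> bool" where
  "two_torsion X x \<longleftrightarrow> x \<in> carrier X \<and> x \<otimes>\<^bsub>X\<^esub> x = \<one>\<^bsub>X\<^esub>"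

definition chi :: "('a, 'b) pre_digraph \<Rightarrow> ('b \<Rightarrow> real) \<Rightarrow> ('b \<Rightarrow> real) \<Rightarrow> complex" where
  "chi G \<omega> \<alpha> = exp (2 * of_real pi * \<i> * of_real (pairing G \<omega> \<alpha>))"


text \<open>
  The matrices depend on an enumeration \<open>vs\<close> of the vertices, respectively \<open>es\<close> of all (positively
  and negatively) oriented edges.
\<close>

definition twisted_adj ::
    "('a, 'b) pre_digraph \<Rightarrow> 'a list \<Rightarrow> ('b \<Rightarrow> real) \<Rightarrow> complex mat" where
  "twisted_adj G vs \<omega> = mat (length vs) (length vs) (\<lambda>(i, j).
     \<Sum>a | a \<in> oriented_edges G \<and> edge_init G a = vs ! i \<and> edge_term G a = vs ! j.
       chi G \<omega> (edge_chain a))"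

definition twisted_edge_adj ::
    "('a, 'b) pre_digraph \<Rightarrow> ('b \<times> bool) list \<Rightarrow> ('b \<Rightarrow> real) \<Rightarrow> complex mat" where
  "twisted_edge_adj G es \<omega> = mat (length es) (length es) (\<lambda>(i, j).
     if feeds_into G (es ! i) (es ! j) then chi G \<omega> (edge_chain (es ! j)) else 0)"

text \<open>Eigenvalues are counted with algebraic multiplicity.\<close>

definition spec :: "complex mat \<Rightarrow> complex multiset" where
  "spec M = proots (char_poly M)"

definition spec_negated :: "complex mat \<Rightarrow> complex mat \<Rightarrow> bool" where
  "spec_negated M N \<longleftrightarrow> (\<forall>z. count (spec M) z = count (spec N) (- z))"

text \<open>
  The defining property of \<open>\<theta>\<close>: it applies to all pairs of 1-forms whose classes add up to \<open>\<theta>\<close>.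
\<close>

definition negating_class ::
    "('a, 'b) pre_digraph \<Rightarrow> 'a list \<Rightarrow> ('b \<times> bool) list \<Rightarrow> ('b \<Rightarrow> real) set \<Rightarrow> bool" where
  "negating_class G vs es \<theta> \<longleftrightarrow> (\<forall>\<omega> \<in> one_forms G. \<forall>\<omega>' \<in> one_forms G.
     form_class G \<omega> \<otimes>\<^bsub>character_group G\<^esub> form_class G \<omega>' = \<theta> \<longrightarrow>
       similar_mat (twisted_adj G vs \<omega>') (- twisted_adj G vs \<omega>) \<and>
       spec_negated (twisted_adj G vs \<omega>') (twisted_adj G vs \<omega>) \<and>
       spec_negated (twisted_edge_adj G es \<omega>') (twisted_edge_adj G es \<omega>))"

lemma pairing_add: "pairing G (\<lambda>e. \<eta> e + \<eta>' e) \<alpha> = pairing G \<eta> \<alpha> + pairing G \<eta>' \<alpha>"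
  by (simp add: pairing_def distrib_right sum.distrib)

lemma comm_group_harmonic_group: "comm_group (harmonic_group G)"
proof (rule comm_groupI)
  fix x assume "x \<in> carrier (harmonic_group G)"
  then show "\<exists>y\<in>carrier (harmonic_group G). y \<otimes>\<^bsub>harmonic_group G\<^esub> x = \<one>\<^bsub>harmonic_group G\<^esub>"
    by (intro bexI[of _ "\<lambda>e. - x e"])
      (auto simp: harmonic_group_def harmonic_forms_def one_forms_def sum_negf)
qed (auto simp: harmonic_group_def harmonic_forms_def one_forms_def sum.distrib add_ac)

lemma normal_dual_lattice: "dual_lattice G \<lhd> harmonic_group G"
proof -
  interpret comm_group "harmonic_group G" by (rule comm_group_harmonic_group)
  have "subgroup (dual_lattice G) (harmonic_group G)"
  proof (rule subgroupI)
    show "dual_lattice G \<subseteq> carrier (harmonic_group G)"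
      by (auto simp: dual_lattice_def harmonic_group_def)
    have "(\<lambda>e. 0) \<in> dual_lattice G"
      by (auto simp: dual_lattice_def harmonic_forms_def one_forms_def pairing_def)
    then show "dual_lattice G \<noteq> {}" by blast
  next
    fix a assume a: "a \<in> dual_lattice G"
    have inv: "inv\<^bsub>harmonic_group G\<^esub> a = (\<lambda>e. - a e)"
      using a by (intro inv_equality)
        (auto simp: dual_lattice_def harmonic_group_def harmonic_forms_def one_forms_def sum_negf)
    show "inv\<^bsub>harmonic_group G\<^esub> a \<in> dual_lattice G"
      using a unfolding inv
      by (auto simp: dual_lattice_def harmonic_forms_def one_forms_def sum_negf pairing_def)
  next
    fix a b assume "a \<in> dual_lattice G" "b \<in> dual_lattice G"
    then show "a \<otimes>\<^bsub>harmonic_group G\<^esub> b \<in> dual_lattice G"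
      by (auto simp: dual_lattice_def harmonic_group_def harmonic_forms_def one_forms_def
          sum.distrib pairing_add)
  qed
  then show ?thesis by (rule subgroup_imp_normal)
qed

lemma group_character_group: "group (character_group G)"
  unfolding character_group_def by (rule normal.factorgroup_is_group[OF normal_dual_lattice])

lemma harmonic_exact_zero:
  assumes "fin_digraph G" and h: "\<eta> \<in> harmonic_forms G" and x: "\<eta> \<in> exact_forms G"
  shows "\<eta> = (\<lambda>e. 0)"
proof -
  interpret fin_digraph G by fact
  obtain f where f: "\<And>e. e \<in> arcs G \<Longrightarrow> \<eta> e = f (head G e) - f (tail G e)"
    using x by (auto simp: exact_forms_def)
  have sums: "(\<Sum>e\<in>arcs G. f (k e) * \<eta> e) =
      (\<Sum>v\<in>verts G. f v * (\<Sum>e | e \<in> arcs G \<and> k e = v. \<eta> e))"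
    if k: "\<And>e. e \<in> arcs G \<Longrightarrow> k e \<in> verts G" for k
  proof -
    have "(\<Sum>e\<in>arcs G. f (k e) * \<eta> e) =
        (\<Sum>v\<in>verts G. \<Sum>e | e \<in> arcs G \<and> k e = v. f (k e) * \<eta> e)"
      using k by (intro sum.group[symmetric]) auto
    then show ?thesis by (simp add: sum_distrib_left)
  qed
  have "(\<Sum>e\<in>arcs G. \<eta> e * \<eta> e) =
      (\<Sum>e\<in>arcs G. f (head G e) * \<eta> e) - (\<Sum>e\<in>arcs G. f (tail G e) * \<eta> e)"
    by (simp add: sum_subtractf[symmetric] f algebra_simps cong: sum.cong)
  also have "\<dots> = 0"
    using h by (subst (1 2) sums) (auto simp: harmonic_forms_def)
  finally have "\<forall>e\<in>arcs G. \<eta> e = 0"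
    by (subst (asm) sum_nonneg_eq_0_iff) auto
  then show ?thesis using h by (auto simp: harmonic_forms_def one_forms_def)
qed

end

theory Submission
  imports Defs
begin

text \<open>
  The class \<open>\<theta>\<close> is represented by the form equal to \<open>1/2\<close> on every edge, whose character takes the value
  \<open>(-1)^k\<close> on closed walks of length \<open>k\<close>. A form is integral on cycles iff its edge weights are a
  coboundary \<open>u(a(1)) / u(a(0))\<close>; conjugating by \<open>u\<close>, and using that \<open>-\<omega>\<close> transposes the matrices up
  to similarity, gives the negation of spectra. Conversely, if the spectra of \<open>W\<^sub>\<omega>\<close> and \<open>W\<close> are
  negatives of each other, the traces of powers force the weight of every closed non-backtracking walk
  of length \<open>k\<close> to be \<open>(-1)^k\<close>, and such walks generate the integral homology.

  The strict inequalities come from the equality case of Wielandt's theorem. For \<open>W\<^sub>\<omega>\<close> it applies to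
  the edges lying on closed non-backtracking walks, where the relation of feeding into is strongly
  connected unless the genus is 1: if \<open>a\<close> did not reach \<open>a\<inverse>\<close>, the edges reachable from \<open>a\<close> would orient
  the graph with in-degree 1 everywhere. Equality yields \<open>\<chi>(s) = c^k\<close> for all closed walks \<open>s\<close> of length
  \<open>k\<close>; inverting \<open>s\<close> gives \<open>\<chi>(s) = \<plusminus>1\<close>, and an odd closed walk determines the sign.
\<close>

section \<open>Kernel matrices and spectral radius\<close>

text \<open>An edge ending at a vertex of degree 1 feeds into nothing, so W is in general reducible
  and the irreducible case of Perron-Frobenius theory applies only to a part of it. The bridge
  between the part and the whole is the growth of powers: the spectral radius of the whole matrix
  bounds the growth of all entries, this bound passes to subsets of the labels, and on an
  irreducible subset it forces a nonnegative subinvariant vector to be positive and invariant.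
  Kernels on sets of labels make the passage to a subset painless. For A the phases of an extremal
  eigenvector form a function on vertices, hence a potential, and inverting a single edge yields c^2
  = 1. For W they form a function on oriented edges, which is not a potential. They cancel only
  around closed walks, and c^k is seen to be a sign only for lengths k of such walks. In a bipartite
  graph all these lengths are even, so the sign of c^k cannot be tied to the parity of k; this is
  why the bipartite case concludes with 2-torsion.\<close>

definition kernel_mat :: "'c list \<Rightarrow> ('c \<Rightarrow> 'c \<Rightarrow> complex) \<Rightarrow> complex mat" where
  "kernel_mat xs K = mat (length xs) (length xs) (\<lambda>(i, j). K (xs ! i) (xs ! j))"

text \<open>Weighted count of the walks of length k whose labels before the last lie in
  \<open>S\<close>. The ring is left open because complex kernels are compared with real ones
  dominating them.\<close>

fun kernel_pow :: "'c set \<Rightarrow> ('c \<Rightarrow> 'c \<Rightarrow> 'k) \<Rightarrow> nat \<Rightarrow> 'c \<Rightarrow> 'c \<Rightarrow> 'k::comm_ring_1" where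
  "kernel_pow S K 0 a b = of_bool (a = b)"
| "kernel_pow S K (Suc k) a b = (\<Sum>c\<in>S. kernel_pow S K k a c * K c b)"

lemma kernel_mat_dim [simp]:
  "kernel_mat xs K \<in> carrier_mat (length xs) (length xs)"
  "dim_row (kernel_mat xs K) = length xs" "dim_col (kernel_mat xs K) = length xs"
  by (auto simp: kernel_mat_def)

lemma kernel_mat_index [simp]:
  "i < length xs \<Longrightarrow> j < length xs \<Longrightarrow> kernel_mat xs K $$ (i, j) = K (xs ! i) (xs ! j)"
  by (simp add: kernel_mat_def)

lemma kernel_mat_cong:
  "(\<And>a b. a \<in> set xs \<Longrightarrow> b \<in> set xs \<Longrightarrow> K a b = L a b) \<Longrightarrow> kernel_mat xs K = kernel_mat xs L"
  by (rule eq_matI) auto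

lemma kernel_mat_uminus: "- kernel_mat xs K = kernel_mat xs (\<lambda>a b. - K a b)"
  by (rule eq_matI) auto

lemma kernel_mat_transpose: "transpose_mat (kernel_mat xs K) = kernel_mat xs (\<lambda>a b. K b a)"
  by (rule eq_matI) auto

lemma sum_nth: "distinct xs \<Longrightarrow> (\<Sum>i<length xs. f (xs ! i)) = sum f (set xs)"
  by (rule sum.reindex_bij_betw[OF bij_betw_nth]) auto

lemma kernel_mat_mult:
  assumes "distinct xs"
  shows "kernel_mat xs K * kernel_mat xs L = kernel_mat xs (\<lambda>a b. \<Sum>c\<in>set xs. K a c * L c b)"
  by (rule eq_matI)
    (auto simp: scalar_prod_def sum_nth[OF assms, symmetric] atLeast0LessThan)

lemma kernel_mat_one: "distinct xs \<Longrightarrow> kernel_mat xs (\<lambda>a b. of_bool (a = b)) = 1\<^sub>m (length xs)"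
  by (rule eq_matI) (auto simp: nth_eq_iff_index_eq)

lemma kernel_mat_pow:
  "distinct xs \<Longrightarrow> kernel_mat xs K ^\<^sub>m k = kernel_mat xs (kernel_pow (set xs) K k)"
proof (induction k)
  case 0
  then show ?case by (simp add: kernel_mat_one[symmetric])
next
  case (Suc k)
  then show ?case by (simp add: kernel_mat_mult)
qed

text \<open>Walks inside the smaller set are among those inside the larger, and no weight is
  negative. Growth bounds for all edges thereby serve for the recurrent ones.\<close>

lemma kernel_pow_mono_set:
  fixes K :: "'c \<Rightarrow> 'c \<Rightarrow> real"
  assumes "finite S" "T \<subseteq> S" "\<And>a b. 0 \<le> K a b"
  shows "0 \<le> kernel_pow T K k a b \<and> kernel_pow T K k a b \<le> kernel_pow S K k a b"
proof (induction k arbitrary: b)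
  case (Suc k)
  have "kernel_pow T K (Suc k) a b \<le> (\<Sum>c\<in>T. kernel_pow S K k a c * K c b)"
    using Suc assms by (auto intro!: sum_mono mult_right_mono)
  also have "\<dots> \<le> (\<Sum>c\<in>S. kernel_pow S K k a c * K c b)"
    using Suc assms by (intro sum_mono2) (auto intro!: mult_nonneg_nonneg intro: order.trans)
  finally show ?case using Suc assms by (auto intro!: sum_nonneg mult_nonneg_nonneg)
qed auto

lemma kernel_pow_eigen:
  assumes "finite S" "\<And>a. a \<in> S \<Longrightarrow> (\<Sum>b\<in>S. K a b * x b) = l * x a" "a \<in> S"
  shows "(\<Sum>b\<in>S. kernel_pow S K k a b * x b) = l ^ k * x a"
proof (induction k)
  case 0
  then show ?case using assms by (simp add: of_bool_def if_distrib[of "\<lambda>t. t * _"] cong: if_cong)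
next
  case (Suc k)
  have "(\<Sum>b\<in>S. kernel_pow S K (Suc k) a b * x b) =
      (\<Sum>c\<in>S. kernel_pow S K k a c * (\<Sum>b\<in>S. K c b * x b))"
    by (simp add: sum_distrib_left sum_distrib_right mult.assoc) (rule sum.swap)
  also have "\<dots> = l * (\<Sum>c\<in>S. kernel_pow S K k a c * x c)"
    using assms(2) by (simp add: sum_distrib_left mult_ac)
  finally show ?case using Suc by (simp add: mult_ac)
qed

lemma kernel_pow_scale: "kernel_pow S (\<lambda>a b. t * K a b) k a b = t ^ k * kernel_pow S K k a b"
  by (induction k arbitrary: b) (auto simp: sum_distrib_left mult_ac intro!: sum.cong)

lemma kernel_pow_of_real:
  "kernel_pow S (\<lambda>a b. of_real (K a b)) k a b = (of_real (kernel_pow S K k a b) :: complex)"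
  by (induction k arbitrary: b) auto

lemma kernel_pow_norm_le:
  assumes "finite S" "\<And>a b. a \<in> S \<Longrightarrow> b \<in> S \<Longrightarrow> cmod (K a b) \<le> L a b" "b \<in> S"
  shows "cmod (kernel_pow S K k a b) \<le> kernel_pow S L k a b"
  using assms(3)
proof (induction k arbitrary: b)
  case (Suc k)
  have "cmod (kernel_pow S K (Suc k) a b) \<le> (\<Sum>c\<in>S. cmod (kernel_pow S K k a c) * cmod (K c b))"
    by (auto intro!: order.trans[OF norm_sum] simp: norm_mult)
  also have "\<dots> \<le> (\<Sum>c\<in>S. kernel_pow S L k a c * L c b)"
    using Suc assms by (intro sum_mono mult_mono) (auto intro: order.trans[OF norm_ge_zero])
  finally show ?case by simp
qed auto

lemma eigenvalue_kernel_matD: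
  assumes "distinct xs" "eigenvalue (kernel_mat xs K) l"
  obtains x where "\<exists>a\<in>set xs. x a \<noteq> 0" "\<And>a. a \<in> set xs \<Longrightarrow> (\<Sum>b\<in>set xs. K a b * x b) = l * x a"
proof -
  obtain v where v: "v \<in> carrier_vec (length xs)" "v \<noteq> 0\<^sub>v (length xs)"
      "kernel_mat xs K *\<^sub>v v = l \<cdot>\<^sub>v v"
    using assms(2) by (auto simp: eigenvalue_def eigenvector_def)
  obtain idx where idx: "\<And>i. i < length xs \<Longrightarrow> idx (xs ! i) = i"
    using assms(1) that by (metis inv_into_f_f inj_on_nth lessThan_iff)
  define x where "x a = v $ idx a" for a
  show ?thesis
  proof (rule that[of x])
    have "\<exists>i<length xs. v $ i \<noteq> 0"
      using v by (metis carrier_vecD eq_vecI index_zero_vec(1) index_zero_vec(2))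
    then show "\<exists>a\<in>set xs. x a \<noteq> 0" unfolding x_def using idx by (metis nth_mem)
  next
    fix a assume "a \<in> set xs"
    then obtain i where i: "i < length xs" "a = xs ! i" by (metis in_set_conv_nth)
    have "(kernel_mat xs K *\<^sub>v v) $ i = (l \<cdot>\<^sub>v v) $ i" by (simp add: v)
    then show "(\<Sum>b\<in>set xs. K a b * x b) = l * x a"
      using i v(1) idx
      by (simp add: sum_nth[OF assms(1), symmetric] x_def scalar_prod_def atLeast0LessThan)
  qed
qed

lemma kernel_mat_spectral_radius_attained:
  assumes "distinct xs" "xs \<noteq> []"
  obtains l x where "cmod l = spectral_radius (kernel_mat xs K)" "\<exists>a\<in>set xs. x a \<noteq> 0"
    "\<And>a. a \<in> set xs \<Longrightarrow> (\<Sum>b\<in>set xs. K a b * x b) = l * x a"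
proof -
  have "spectral_radius (kernel_mat xs K) \<in> norm ` spectrum (kernel_mat xs K)"
    using assms by (intro spectral_radius_mem_max(1)[of _ "length xs"]) auto
  then obtain l where l: "cmod l = spectral_radius (kernel_mat xs K)" "eigenvalue (kernel_mat xs K) l"
    by (auto simp: spectrum_def)
  from eigenvalue_kernel_matD[OF assms(1) l(2)] l(1) that show ?thesis by metis
qed

section \<open>Growth of powers and the spectral radius\<close>

lemma exponential_compare:
  fixes q r c D :: real
  assumes "0 < c" "0 < r" "0 \<le> q" "\<And>k::nat. c * q ^ k \<le> D * r ^ k"
  shows "q \<le> r"
proof (rule ccontr)
  assume "\<not> q \<le> r"
  then have "1 < q / r" using assms by simp
  then obtain k where k: "D / c < (q / r) ^ k" using real_arch_pow by blast
  then show False using assms(1,2) assms(4)[of k] by (simp add: field_simps power_divide)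
qed

lemma kernel_mat_spectral_radius_nonneg:
  "distinct xs \<Longrightarrow> xs \<noteq> [] \<Longrightarrow> 0 \<le> spectral_radius (kernel_mat xs K)"
  by (metis kernel_mat_spectral_radius_attained norm_ge_zero)

text \<open>One half of Gelfand's formula: after division by \<open>r\<close> the spectral radius is
  below 1, and the powers of such a matrix are bounded. The strict inequality leaves room for the
  polynomial growth caused by Jordan blocks.\<close>

lemma kernel_pow_growth:
  assumes xs: "distinct xs" "xs \<noteq> []" and r: "spectral_radius (kernel_mat xs K) < r"
  obtains D where "\<And>k a b. a \<in> set xs \<Longrightarrow> b \<in> set xs \<Longrightarrow> cmod (kernel_pow (set xs) K k a b) \<le> D * r ^ k"
proof -
  let ?n = "length xs"
  define L where "L = (\<lambda>a b. of_real (1 / r) * K a b)"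
  have r0: "0 < r" using r kernel_mat_spectral_radius_nonneg[OF xs, of K] by linarith
  obtain l x where l: "cmod l = spectral_radius (kernel_mat xs L)" "\<exists>a\<in>set xs. x a \<noteq> 0"
    "\<And>a. a \<in> set xs \<Longrightarrow> (\<Sum>b\<in>set xs. L a b * x b) = l * x a"
    using kernel_mat_spectral_radius_attained[OF xs] by blast
  \<comment> \<open>An extremal eigenvector of the scaled kernel is one of \<open>K\<close> with
    eigenvalue multiplied by \<open>r\<close>; so the radius of \<open>L\<close> is below 1.\<close>
  have "eigenvalue (kernel_mat xs K) (of_real r * l)"
    unfolding eigenvalue_def eigenvector_def
  proof (intro exI[of _ "vec ?n (\<lambda>i. x (xs ! i))"] conjI)
    obtain i where "i < ?n" "x (xs ! i) \<noteq> 0" using l(2) by (metis in_set_conv_nth)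
    then show "vec ?n (\<lambda>i. x (xs ! i)) \<noteq> 0\<^sub>v (dim_row (kernel_mat xs K))"
      by (metis index_vec index_zero_vec(1) kernel_mat_dim(2))
    have "(\<Sum>b\<in>set xs. K a b * x b) = of_real r * l * x a" if "a \<in> set xs" for a
    proof -
      have "of_real (1 / r) * (\<Sum>b\<in>set xs. K a b * x b) = l * x a"
        using l(3)[OF that] by (simp add: L_def sum_distrib_left mult.assoc)
      then show ?thesis using r0 by (simp add: field_simps)
    qed
    then show "kernel_mat xs K *\<^sub>v vec ?n (\<lambda>i. x (xs ! i)) = (of_real r * l) \<cdot>\<^sub>v vec ?n (\<lambda>i. x (xs ! i))"
      by (intro eq_vecI)
        (auto simp: scalar_prod_def sum_nth[OF xs(1), symmetric] atLeast0LessThan)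
  qed simp
  then have "cmod (of_real r * l) \<le> spectral_radius (kernel_mat xs K)"
    using xs by (intro spectral_radius_mem_max(2)[of _ ?n]) (auto simp: spectrum_def)
  then have "r * cmod l \<le> spectral_radius (kernel_mat xs K)" using r0 by (simp add: norm_mult)
  then have "r * cmod l < r * 1" using r by linarith
  then have "cmod l < 1" using r0 by (subst (asm) mult_less_cancel_left_pos)
  then have "spectral_radius (kernel_mat xs L) < 1" using r0 l(1) by simp
  then obtain D where D: "\<And>k. norm_bound (kernel_mat xs L ^\<^sub>m k) D"
    using spectral_radius_jnf_norm_bound_less_1_upper_triangular[of "kernel_mat xs L" ?n] by auto
  show ?thesis
  proof (rule that[of D])
    fix k a b assume "a \<in> set xs" "b \<in> set xs"
    then have "cmod (kernel_pow (set xs) L k a b) \<le> D"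
      using D[of k] by (auto simp: norm_bound_def kernel_mat_pow[OF xs(1)] in_set_conv_nth)
    then show "cmod (kernel_pow (set xs) K k a b) \<le> D * r ^ k"
      using r0 unfolding L_def kernel_pow_scale
      by (simp add: norm_mult norm_power norm_divide field_simps)
  qed
qed

text \<open>The other half: the k-th power acts on an eigenvector by l^k, so |l|^k is at most a
  constant times r^k.\<close>

lemma eigenvalue_le_growth:
  fixes K :: "'c \<Rightarrow> 'c \<Rightarrow> complex"
  assumes S: "finite S" and r: "0 < r"
    and K: "\<And>k a b. a \<in> S \<Longrightarrow> b \<in> S \<Longrightarrow> cmod (kernel_pow S K k a b) \<le> D * r ^ k"
    and x: "a \<in> S" "x a \<noteq> 0" "\<And>a. a \<in> S \<Longrightarrow> (\<Sum>b\<in>S. K a b * x b) = l * x a"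
  shows "cmod l \<le> r"
proof (rule exponential_compare)
  show "0 < cmod (x a)" using x by simp
  fix k
  have "cmod (x a) * cmod l ^ k = cmod (\<Sum>b\<in>S. kernel_pow S K k a b * x b)"
    using kernel_pow_eigen[of S K x l a k] S x by (simp add: norm_mult norm_power)
  also have "\<dots> \<le> (\<Sum>b\<in>S. (D * r ^ k) * cmod (x b))"
    using K x(1) by (auto simp: norm_mult intro!: order.trans[OF norm_sum] sum_mono mult_right_mono)
  also have "\<dots> = (D * (\<Sum>b\<in>S. cmod (x b))) * r ^ k"
    by (simp add: sum_distrib_left sum_distrib_right mult_ac)
  finally show "cmod (x a) * cmod l ^ k \<le> (D * (\<Sum>b\<in>S. cmod (x b))) * r ^ k" .
qed (use r in auto)

text \<open>Walk sums of the dominating kernel bound those of \<open>K\<close>, so the growth of the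
  former limits every eigenvalue of the latter.\<close>

lemma kernel_mat_spectral_radius_mono:
  assumes xs: "distinct xs"
    and le: "\<And>a b. a \<in> set xs \<Longrightarrow> b \<in> set xs \<Longrightarrow> cmod (K a b) \<le> L a b"
  shows "spectral_radius (kernel_mat xs K) \<le> spectral_radius (kernel_mat xs (\<lambda>a b. of_real (L a b)))"
proof (cases "xs = []")
  case True
  then have "kernel_mat xs K = kernel_mat xs (\<lambda>a b. of_real (L a b))"
    by (intro kernel_mat_cong) auto
  then show ?thesis by simp
next
  case False
  let ?L = "\<lambda>a b. of_real (L a b)"
  obtain l x where l: "cmod l = spectral_radius (kernel_mat xs K)" "\<exists>a\<in>set xs. x a \<noteq> 0"
    "\<And>a. a \<in> set xs \<Longrightarrow> (\<Sum>b\<in>set xs. K a b * x b) = l * x a"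
    using kernel_mat_spectral_radius_attained[OF xs False] by blast
  \<comment> \<open>Growth bounds are available only at rates strictly above the radius of
    \<open>L\<close>; hence the comparison with every \<open>r\<close> below the radius of
    \<open>K\<close>.\<close>
  show ?thesis
  proof (rule dense_le, rule ccontr)
    fix r assume r: "r < spectral_radius (kernel_mat xs K)"
      "\<not> r \<le> spectral_radius (kernel_mat xs ?L)"
    then have "spectral_radius (kernel_mat xs ?L) < r" by simp
    then obtain D where D: "\<And>k a b. a \<in> set xs \<Longrightarrow> b \<in> set xs \<Longrightarrow>
        cmod (kernel_pow (set xs) ?L k a b) \<le> D * r ^ k"
      using kernel_pow_growth[OF xs False] by blast
    have "cmod (kernel_pow (set xs) K k a b) \<le> D * r ^ k" if "a \<in> set xs" "b \<in> set xs" for k a b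
      using order.trans[OF kernel_pow_norm_le[of "set xs" K L b k a]] D[OF that, of k] le that
      by (fastforce simp: kernel_pow_of_real)
    moreover have "0 < r"
      using r kernel_mat_spectral_radius_nonneg[OF xs False, of ?L] by linarith
    moreover obtain a where "a \<in> set xs" "x a \<noteq> 0" using l(2) by blast
    ultimately have "cmod l \<le> r" using l(3) by (intro eigenvalue_le_growth[of "set xs" r K D a x l]) auto
    then show False using r l(1) by linarith
  qed
qed

text \<open>A radius below 1 makes all entries of the powers decay. A closed walk of length
  \<open>p\<close> provides a diagonal entry that does not decay along the multiples of
  \<open>p\<close>.\<close>

lemma spectral_radius_ge_1:
  assumes xs: "distinct xs" and a: "a \<in> set xs" and p: "0 < p"
    and K: "\<And>j. 1 \<le> cmod (kernel_pow (set xs) K (j * p) a a)"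
  shows "1 \<le> spectral_radius (kernel_mat xs K)"
proof (rule ccontr)
  have ne: "xs \<noteq> []" using a by auto
  assume "\<not> 1 \<le> spectral_radius (kernel_mat xs K)"
  then obtain r where r: "spectral_radius (kernel_mat xs K) < r" "r < 1" using dense not_le by metis
  have r0: "0 < r" using r kernel_mat_spectral_radius_nonneg[OF xs ne, of K] by linarith
  obtain D where D: "\<And>k a b. a \<in> set xs \<Longrightarrow> b \<in> set xs \<Longrightarrow>
      cmod (kernel_pow (set xs) K k a b) \<le> D * r ^ k"
    using kernel_pow_growth[OF xs ne r(1)] by blast
  have "1 \<le> r ^ p"
  proof (rule exponential_compare)
    fix k
    have "1 \<le> D * r ^ (k * p)" using K[of k] D[OF a a, of "k * p"] by linarith
    then show "1 * 1 ^ k \<le> D * (r ^ p) ^ k" by (simp add: power_mult[symmetric] mult.commute)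
  qed (use r0 in auto)
  then show False using r r0 p by (meson not_le power_less_one_iff less_imp_le)
qed

section \<open>Similarity and traces\<close>

lemma sum_of_bool_mult:
  assumes "finite S"
  shows "(\<Sum>c\<in>S. of_bool (c = a) * f c) = (if a \<in> S then f a else (0::'k::comm_ring_1))"
    and "(\<Sum>c\<in>S. of_bool (a = c) * f c) = (if a \<in> S then f a else (0::'k::comm_ring_1))"
    and "(\<Sum>c\<in>S. f c * of_bool (c = a)) = (if a \<in> S then f a else (0::'k::comm_ring_1))"
    and "(\<Sum>c\<in>S. f c * of_bool (a = c)) = (if a \<in> S then f a else (0::'k::comm_ring_1))"
  using assms by (simp_all add: of_bool_def if_distrib[of "\<lambda>t. t * _"] if_distrib[of "\<lambda>t. _ * t"] cong: if_cong)

lemma similar_kernel_matI: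
  assumes xs: "distinct xs"
    and UV: "\<And>a b. a \<in> set xs \<Longrightarrow> b \<in> set xs \<Longrightarrow> (\<Sum>c\<in>set xs. U a c * V c b) = of_bool (a = b)"
    and VU: "\<And>a b. a \<in> set xs \<Longrightarrow> b \<in> set xs \<Longrightarrow> (\<Sum>c\<in>set xs. V a c * U c b) = of_bool (a = b)"
    and K: "\<And>a b. a \<in> set xs \<Longrightarrow> b \<in> set xs \<Longrightarrow>
      K a b = (\<Sum>d\<in>set xs. (\<Sum>c\<in>set xs. U a c * L c d) * V d b)"
  shows "similar_mat (kernel_mat xs K) (kernel_mat xs L)"
proof (rule similar_matI)
  show "{kernel_mat xs K, kernel_mat xs L, kernel_mat xs U, kernel_mat xs V}
      \<subseteq> carrier_mat (length xs) (length xs)"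
    by simp
  show "kernel_mat xs U * kernel_mat xs V = 1\<^sub>m (length xs)"
    unfolding kernel_mat_mult[OF xs] kernel_mat_one[OF xs, symmetric]
    by (rule kernel_mat_cong) (rule UV)
  show "kernel_mat xs V * kernel_mat xs U = 1\<^sub>m (length xs)"
    unfolding kernel_mat_mult[OF xs] kernel_mat_one[OF xs, symmetric]
    by (rule kernel_mat_cong) (rule VU)
  show "kernel_mat xs K = kernel_mat xs U * kernel_mat xs L * kernel_mat xs V"
    unfolding kernel_mat_mult[OF xs] by (rule kernel_mat_cong) (rule K)
qed

text \<open>Conjugation by the permutation matrix of \<open>p\<close>, which is its own inverse. It
  serves both for reversing the basis of a Jordan block and for inverting edges.\<close>

lemma similar_kernel_mat_involution:
  assumes "distinct xs" and p: "\<And>a. a \<in> set xs \<Longrightarrow> p a \<in> set xs" "\<And>a. a \<in> set xs \<Longrightarrow> p (p a) = a"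
  shows "similar_mat (kernel_mat xs (\<lambda>a b. K (p a) (p b))) (kernel_mat xs K)"
proof (rule similar_kernel_matI[OF assms(1), where U = "\<lambda>a b. of_bool (b = p a)"
      and V = "\<lambda>a b. of_bool (b = p a)"])
  fix a b assume ab: "a \<in> set xs" "b \<in> set xs"
  have eq: "b = p d \<longleftrightarrow> p b = d" if "d \<in> set xs" for d
    using that ab p by metis
  show "(\<Sum>c\<in>set xs. of_bool (c = p a) * of_bool (b = p c)) = (of_bool (a = b) :: complex)"
    using ab p by (simp add: sum_of_bool_mult)
  then show "(\<Sum>c\<in>set xs. of_bool (c = p a) * of_bool (b = p c)) = (of_bool (a = b) :: complex)" .
  show "K (p a) (p b) = (\<Sum>d\<in>set xs. (\<Sum>c\<in>set xs. of_bool (c = p a) * K c d) * of_bool (b = p d))"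
    using ab p by (simp add: sum_of_bool_mult eq cong: sum.cong)
qed

text \<open>Conjugation by a diagonal matrix. With a potential as \<open>u\<close> this is a gauge
  transformation of the twisted matrices.\<close>

lemma similar_kernel_mat_scale:
  assumes "distinct xs" "\<And>a. a \<in> set xs \<Longrightarrow> u a \<noteq> 0"
    and K: "\<And>a b. a \<in> set xs \<Longrightarrow> b \<in> set xs \<Longrightarrow> K a b = L a b * u b / u a"
  shows "similar_mat (kernel_mat xs K) (kernel_mat xs L)"
proof (rule similar_kernel_matI[OF assms(1), where U = "\<lambda>a b. of_bool (a = b) * (1 / u b)"
      and V = "\<lambda>a b. of_bool (a = b) * u b"])
  fix a b assume ab: "a \<in> set xs" "b \<in> set xs"
  have delta: "(\<Sum>c\<in>set xs. of_bool (a = c) * f c * g c) = f a * g a" for f g :: "_ \<Rightarrow> complex"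
    using ab sum_of_bool_mult(2)[of "set xs" a "\<lambda>c. f c * g c"] by (simp add: mult.assoc)
  show "(\<Sum>c\<in>set xs. of_bool (a = c) * (1 / u c) * (of_bool (c = b) * u b)) = of_bool (a = b)"
    "(\<Sum>c\<in>set xs. of_bool (a = c) * u c * (of_bool (c = b) * (1 / u b))) = of_bool (a = b)"
    unfolding delta using ab assms(2) by auto
  have "(\<Sum>d\<in>set xs. 1 / u a * L a d * (of_bool (d = b) * u b)) =
      (\<Sum>d\<in>set xs. of_bool (d = b) * (1 / u a * L a d * u b))"
    by (simp add: mult_ac)
  then show "K a b = (\<Sum>d\<in>set xs. (\<Sum>c\<in>set xs. of_bool (a = c) * (1 / u c) * L c d) * (of_bool (d = b) * u b))"
    unfolding delta using ab K by (simp add: sum_of_bool_mult del: times_divide_eq_left times_divide_eq_right) simp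
qed

lemma similar_transpose_cong:
  assumes "similar_mat A (B :: complex mat)"
  shows "similar_mat (transpose_mat A) (transpose_mat B)"
proof -
  obtain n P Q where carr: "{A, B, P, Q} \<subseteq> carrier_mat n n" and PQ: "P * Q = 1\<^sub>m n" "Q * P = 1\<^sub>m n"
      and A: "A = P * B * Q"
    using similar_matD[OF assms] by blast
  have [simp]: "B \<in> carrier_mat n n" "P \<in> carrier_mat n n" "Q \<in> carrier_mat n n" using carr by auto
  show ?thesis
  proof (rule similar_matI)
    show "{transpose_mat A, transpose_mat B, transpose_mat Q, transpose_mat P} \<subseteq> carrier_mat n n"
      using carr by auto
    show "transpose_mat Q * transpose_mat P = 1\<^sub>m n" "transpose_mat P * transpose_mat Q = 1\<^sub>m n"
      using PQ by (simp_all flip: transpose_mult[of P n n Q n] transpose_mult[of Q n n P n])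
    have "transpose_mat A = transpose_mat Q * transpose_mat (P * B)"
      unfolding A by (rule transpose_mult[of _ n n _ n], rule mult_carrier_mat[of _ n n], simp_all)
    also have "transpose_mat (P * B) = transpose_mat B * transpose_mat P"
      by (rule transpose_mult[of _ n n _ n]) auto
    finally show "transpose_mat A = transpose_mat Q * transpose_mat B * transpose_mat P"
      by (simp add: assoc_mult_mat[of _ n n _ n _ n])
  qed
qed

text \<open>Listing the basis in reverse order moves the ones from above the diagonal to below
  it.\<close>

lemma similar_jordan_block_transpose:
  "similar_mat (transpose_mat (jordan_block n a)) (jordan_block n (a::complex))"
proof -
  define K where "K = (\<lambda>i j::nat. if i = j then a else if Suc i = j then 1 else 0)"
  have J: "jordan_block n a = kernel_mat [0..<n] K"
    by (rule eq_matI) (auto simp: K_def)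
  have "transpose_mat (jordan_block n a) = kernel_mat [0..<n] (\<lambda>i j. K (n - 1 - i) (n - 1 - j))"
    unfolding J kernel_mat_transpose by (rule kernel_mat_cong) (auto simp: K_def)
  then show ?thesis
    unfolding J using similar_kernel_mat_involution[of "[0..<n]" "\<lambda>i. n - 1 - i" K] by auto
qed

lemma transpose_diag_block_mat:
  "\<forall>A\<in>set As. square_mat A \<Longrightarrow> transpose_mat (diag_block_mat As) = diag_block_mat (map transpose_mat As)"
proof (induction As)
  case (Cons A As)
  let ?B = "diag_block_mat As"
  have sq: "dim_row ?B = dim_col ?B" "dim_row A = dim_col A"
    using Cons.prems by (auto simp: dim_diag_block_mat intro!: arg_cong[of _ _ sum_list])
  have "transpose_mat (four_block_mat A (0\<^sub>m (dim_row A) (dim_col ?B)) (0\<^sub>m (dim_row ?B) (dim_col A)) ?B) =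
      four_block_mat (transpose_mat A) (0\<^sub>m (dim_col A) (dim_row ?B)) (0\<^sub>m (dim_col ?B) (dim_row A)) (transpose_mat ?B)"
    by (subst transpose_four_block_mat[of _ "dim_row A" "dim_col A" _ "dim_col ?B" _ "dim_row ?B"]) auto
  then show ?case using Cons sq by (auto simp: Let_def simp del: index_transpose_mat(2,3)) (metis index_transpose_mat(2,3))
qed auto

text \<open>The Jordan normal form reduces this to single blocks. Negating a form transposes the
  adjacency matrix, and the theorem asks for similarity, not just for negated spectra.\<close>

lemma similar_transpose:
  assumes A: "A \<in> carrier_mat n n"
  shows "similar_mat (transpose_mat A) (A :: complex mat)"
proof -
  obtain as where "char_poly A = (\<Prod>a\<leftarrow>as. [:- a, 1:])" using char_poly_factorized[OF A] by blast
  then obtain ns where "jordan_nf A ns" using jordan_nf_exists[OF A] by blast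
  then have J: "similar_mat A (jordan_matrix ns)" by (auto simp: jordan_nf_def)
  let ?Js = "map (\<lambda>(n, a). (transpose_mat (jordan_block n a), jordan_block n a)) ns"
  have "transpose_mat (jordan_matrix ns) = diag_block_mat (map fst ?Js)"
    unfolding jordan_matrix_def
    by (subst transpose_diag_block_mat) (auto intro!: arg_cong[of _ _ diag_block_mat])
  moreover have "jordan_matrix ns = diag_block_mat (map snd ?Js)"
    unfolding jordan_matrix_def by (auto intro!: arg_cong[of _ _ diag_block_mat])
  moreover have "similar_mat (diag_block_mat (map fst ?Js)) (diag_block_mat (map snd ?Js))"
    by (rule similar_diag_mat_block_mat) (auto simp: similar_jordan_block_transpose)
  ultimately show ?thesis
    using similar_transpose_cong[OF J] J by (metis similar_mat_trans similar_mat_sym)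
qed

lemma similar_uminus:
  assumes "similar_mat A (B :: complex mat)"
  shows "similar_mat (- A) (- B)"
proof -
  have "- M = (- 1) \<cdot>\<^sub>m M" for M :: "complex mat" by (rule eq_matI) auto
  then show ?thesis using similar_mat_smult[OF assms, of "- 1"] by simp
qed

lemma spec_negatedI:
  assumes "M \<in> carrier_mat n n" "N \<in> carrier_mat n n" "char_poly M = char_poly (- N)"
  shows "spec_negated M N"
  unfolding spec_negated_def spec_def
proof
  fix z
  have "char_poly M \<noteq> 0" "char_poly N \<noteq> 0"
    using degree_monic_char_poly[OF assms(1)] degree_monic_char_poly[OF assms(2)] by auto
  moreover have "- N = (- 1) \<cdot>\<^sub>m N" by (rule eq_matI) auto
  ultimately show "count (proots (char_poly M)) z = count (proots (char_poly N)) (- z)"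
    using order_char_poly_smult[OF assms(2), of "- 1" z] assms(3) by simp
qed

section \<open>Traces of powers as power sums of the spectrum\<close>

definition mat_trace :: "complex mat \<Rightarrow> complex" where
  "mat_trace M = (\<Sum>i<dim_row M. M $$ (i, i))"

lemma mat_trace_mult_commute:
  assumes "A \<in> carrier_mat n n" "B \<in> carrier_mat n n"
  shows "mat_trace (A * B) = mat_trace (B * A)"
proof -
  have "mat_trace (A * B) = (\<Sum>i<n. \<Sum>j<n. A $$ (i, j) * B $$ (j, i))"
    using assms by (auto simp: mat_trace_def scalar_prod_def atLeast0LessThan)
  also have "\<dots> = (\<Sum>j<n. \<Sum>i<n. A $$ (i, j) * B $$ (j, i))" by (rule sum.swap)
  also have "\<dots> = mat_trace (B * A)"
    using assms by (auto simp: mat_trace_def scalar_prod_def atLeast0LessThan mult.commute)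
  finally show ?thesis .
qed

lemma upper_triangular_pow:
  assumes B: "B \<in> carrier_mat n n" and ut: "upper_triangular B"
  shows "(\<forall>i<n. \<forall>j<i. (B ^\<^sub>m k) $$ (i, j) = 0) \<and> (\<forall>i<n. (B ^\<^sub>m k) $$ (i, i) = (B $$ (i, i)) ^ k)"
proof (induction k)
  case (Suc k)
  have entry: "(B ^\<^sub>m Suc k) $$ (i, j) = (\<Sum>l<n. (B ^\<^sub>m k) $$ (i, l) * B $$ (l, j))"
    if "i < n" "j < n" for i j
    using that B by (auto simp: scalar_prod_def atLeast0LessThan)
  have z: "(B ^\<^sub>m k) $$ (i, l) * B $$ (l, j) = 0" if "i < n" "l < n" "j \<le> i" "l \<noteq> i \<or> j \<noteq> i" for i j l
    using that Suc upper_triangularD[OF ut, of j l] B by (cases "l < i") auto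
  have "(\<Sum>l<n. (B ^\<^sub>m k) $$ (i, l) * B $$ (l, i)) = (\<Sum>l\<in>{i}. (B ^\<^sub>m k) $$ (i, l) * B $$ (l, i))"
    if "i < n" for i
    using that z by (intro sum.mono_neutral_right) auto
  then show ?case using Suc entry z by (auto simp: sum.neutral power_commutes simp del: pow_mat.simps)
qed (use B in auto)

lemma sum_list_mset_singleton: "(\<Sum>x\<leftarrow>xs. {#x#}) = mset xs"
  by (induction xs) auto

text \<open>A Schur decomposition puts the eigenvalues, with multiplicity, on the diagonal of an
  upper triangular matrix; powers of it stay triangular and act on the diagonal entrywise.\<close>

lemma mat_trace_pow:
  assumes M: "M \<in> carrier_mat n n"
  shows "mat_trace (M ^\<^sub>m k) = (\<Sum>z\<in>#spec M. z ^ k)"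
proof -
  obtain es where es: "char_poly M = (\<Prod>a\<leftarrow>es. [:- a, 1:])" using char_poly_factorized[OF M] by blast
  have spec: "spec M = mset es"
    unfolding spec_def es using proots_prod_list[of "map (\<lambda>a. [:- a, 1:]) es"]
    by (force simp: comp_def sum_list_mset_singleton)
  obtain B P Q where "schur_decomposition M es = (B, P, Q)" by (metis prod_cases3)
  from schur_decomposition[OF M es this]
  have B: "similar_mat_wit M B P Q" "upper_triangular B" "diag_mat B = es" by auto
  note wit = similar_mat_witD2[OF M B(1)]
  have "mat_trace (M ^\<^sub>m k) = mat_trace (P * (B ^\<^sub>m k * Q))"
    using wit similar_mat_wit_pow_id[OF B(1), of k] by (simp add: assoc_mult_mat[of _ n n _ n _ n])
  also have "\<dots> = mat_trace (B ^\<^sub>m k * Q * P)"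
    using wit by (intro mat_trace_mult_commute) auto
  also have "B ^\<^sub>m k * Q * P = B ^\<^sub>m k"
    using wit by (simp add: assoc_mult_mat[of _ n n _ n _ n])
  also have "mat_trace (B ^\<^sub>m k) = (\<Sum>i<n. (B $$ (i, i)) ^ k)"
    using upper_triangular_pow[OF _ B(2), of n k] wit by (auto simp: mat_trace_def)
  also have "\<dots> = (\<Sum>z\<in>#mset (diag_mat B). z ^ k)"
    using wit sum_mset_sum_list[of "map (\<lambda>i. (B $$ (i, i)) ^ k) [0..<n]"]
    by (simp add: diag_mat_def comp_def atLeast0LessThan interv_sum_list_conv_sum_set_nat multiset.map_comp)
  finally show ?thesis using spec B(3) by simp
qed

text \<open>Here a relation between multisets of eigenvalues becomes one between weighted counts of
  closed walks.\<close>

lemma spec_negated_trace_pow: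
  assumes "M \<in> carrier_mat n n" "N \<in> carrier_mat n n" "spec_negated M N"
  shows "mat_trace (M ^\<^sub>m k) = (- 1) ^ k * mat_trace (N ^\<^sub>m k)"
proof -
  have "count (image_mset uminus (spec N)) z = count (spec N) (- z)" for z
  proof -
    have "uminus -` {z} = {- z}" by (auto simp: minus_equation_iff)
    then show ?thesis by (cases "- z \<in># spec N") (auto simp: count_image_mset not_in_iff)
  qed
  then have "spec M = image_mset uminus (spec N)"
    using assms(3) by (intro multiset_eqI) (simp add: spec_negated_def)
  then have "(\<Sum>z\<in>#spec M. z ^ k) = (\<Sum>z\<in>#spec N. (- z) ^ k)"
    by (simp add: multiset.map_comp comp_def)
  also have "\<dots> = (\<Sum>z\<in>#spec N. (- 1) ^ k * z ^ k)"
    by (subst power_minus) (rule refl)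
  also have "\<dots> = (- 1) ^ k * (\<Sum>z\<in>#spec N. z ^ k)"
    by (rule sum_mset_distrib_left[symmetric])
  finally show ?thesis by (simp only: mat_trace_pow[OF assms(1)] mat_trace_pow[OF assms(2)])
qed

section \<open>Irreducible kernels\<close>

text \<open>Equality in the triangle inequality. With s the sum, the defects |t_j| |s| - Re (t_j cnj
  s) are nonnegative and add up to 0, so each t_j cnj s is a nonnegative real number. The form
  without division covers s = 0.\<close>

lemma norm_sum_eq_imp_aligned:
  fixes t :: "'i \<Rightarrow> complex"
  assumes I: "finite I" and eq: "cmod (sum t I) = (\<Sum>i\<in>I. cmod (t i))" and i: "i \<in> I"
  shows "t i * cmod (sum t I) = cmod (t i) * sum t I"
proof (cases "sum t I = 0")
  case True
  then have "cmod (t i) = 0" using eq I i by (simp add: sum_nonneg_eq_0_iff)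
  then show ?thesis by simp
next
  case False
  define s where "s = sum t I"
  have s: "s \<noteq> 0" using False by (simp add: s_def)
  have le: "Re (t j * cnj s) \<le> cmod (t j) * cmod s" for j
    using complex_Re_le_cmod[of "t j * cnj s"] by (simp add: norm_mult)
  have "(\<Sum>j\<in>I. cmod (t j) * cmod s - Re (t j * cnj s)) = cmod s * cmod s - Re (s * cnj s)"
    using eq by (simp add: sum_subtractf sum_distrib_right[symmetric] s_def Re_sum[symmetric] del: Re_sum)
  also have "\<dots> = 0" using complex_norm_square[of s] by (simp add: power2_eq_square complex_eq_iff)
  finally have "\<forall>j\<in>I. cmod (t j) * cmod s - Re (t j * cnj s) = 0"
    using I le by (subst (asm) sum_nonneg_eq_0_iff) auto
  then have re: "Re (t i * cnj s) = cmod (t i * cnj s)" using i by (simp add: norm_mult)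
  have "Im (t i * cnj s) = 0" using re cmod_power2[of "t i * cnj s"] by simp
  with re have "t i * cnj s = of_real (cmod (t i) * cmod s)"
    by (simp add: complex_eq_iff norm_mult)
  then have "t i * (cnj s * s) = of_real (cmod (t i) * cmod s) * s" by (simp only: mult.assoc[symmetric])
  also have "cnj s * s = of_real (cmod s) * of_real (cmod s)"
    using complex_norm_square[of s] by (simp add: power2_eq_square mult.commute)
  finally have "of_real (cmod s) * (t i * of_real (cmod s)) = of_real (cmod s) * (of_real (cmod (t i)) * s)"
    by (simp add: mult_ac)
  then show ?thesis using s by (simp add: s_def)
qed

lemma kernel_pow_Suc_left:
  assumes "finite S" "a \<in> S" "b \<in> S"
  shows "(\<Sum>c\<in>S. K a c * kernel_pow S K k c b) = kernel_pow S K (Suc k) a b"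
  using assms(3)
proof (induction k arbitrary: b)
  case 0
  then show ?case using assms by (simp add: of_bool_def if_distrib[of "\<lambda>t. t * _"] if_distrib[of "\<lambda>t. _ * t"] cong: if_cong)
next
  case (Suc k)
  have "(\<Sum>c\<in>S. K a c * kernel_pow S K (Suc k) c b) =
      (\<Sum>d\<in>S. (\<Sum>c\<in>S. K a c * kernel_pow S K k c d) * K d b)"
    by (simp add: sum_distrib_left sum_distrib_right mult.assoc) (rule sum.swap)
  also have "\<dots> = (\<Sum>d\<in>S. kernel_pow S K (Suc k) a d * K d b)"
    using Suc.IH by (intro sum.cong) auto
  finally show ?case by simp
qed

lemma kernel_pow_pos_of_reachable:
  fixes B :: "'c \<Rightarrow> 'c \<Rightarrow> real"
  assumes "finite C" "\<And>a b. 0 \<le> B a b" "(a, b) \<in> {(a, b). a \<in> C \<and> b \<in> C \<and> 0 < B a b}\<^sup>*" "a \<in> C"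
  shows "\<exists>k. 0 < kernel_pow C B k a b"
  using assms(3)
proof (induction rule: rtrancl_induct)
  case base
  show ?case by (intro exI[of _ 0]) simp
next
  case (step b c)
  then obtain k where "0 < kernel_pow C B k a b" by blast
  then have "0 < kernel_pow C B (Suc k) a c"
    using step.hyps(2) assms(1,2) kernel_pow_mono_set[of C C B k a]
    by (auto intro!: sum_pos2[of _ b] mult_pos_pos mult_nonneg_nonneg)
  then show ?case by blast
qed

text \<open>The number \<rho> is tied to \<open>B\<close> only by a growth bound on
  \<open>C\<close>, because it will be the radius of a larger matrix. A sum \<open>Q\<close> of
  powers with positive entries commutes with \<open>B\<close>. It would spread a strict inequality
  at one label to all labels, and then powers of \<open>B\<close> would grow faster than
  allowed.\<close>

lemma irreducible_subinvariant:
  fixes B :: "'c \<Rightarrow> 'c \<Rightarrow> real"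
  assumes C: "finite C" and B: "\<And>a b. 0 \<le> B a b"
    and irr: "\<And>a b. a \<in> C \<Longrightarrow> b \<in> C \<Longrightarrow> (a, b) \<in> {(a, b). a \<in> C \<and> b \<in> C \<and> 0 < B a b}\<^sup>*"
    and growth: "\<And>r. \<rho> < r \<Longrightarrow> \<exists>D. \<forall>k. \<forall>a\<in>C. \<forall>b\<in>C. kernel_pow C B k a b \<le> D * r ^ k"
    and \<rho>: "0 \<le> \<rho>"
    and z: "\<And>a. 0 \<le> z a" "a0 \<in> C" "0 < z a0"
    and sub: "\<And>a. a \<in> C \<Longrightarrow> \<rho> * z a \<le> (\<Sum>b\<in>C. B a b * z b)"
    and a: "a \<in> C"
  shows "0 < z a \<and> (\<Sum>b\<in>C. B a b * z b) = \<rho> * z a"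
proof -
  obtain kk where kk: "\<And>a b. a \<in> C \<Longrightarrow> b \<in> C \<Longrightarrow> 0 < kernel_pow C B (kk a b) a b"
    using kernel_pow_pos_of_reachable[OF C B irr] by metis
  \<comment> \<open>The walk lengths vary with the pair of labels, and a periodic kernel may have no
    power that is positive everywhere; hence a sum of powers.\<close>
  define N where "N = Max ((\<lambda>(a, b). kk a b) ` (C \<times> C))"
  have N: "kk a b \<le> N" if "a \<in> C" "b \<in> C" for a b
    unfolding N_def using that C by (intro Max_ge) (auto intro!: image_eqI[of _ _ "(a, b)"])
  define Q where "Q a b = (\<Sum>k\<le>N. kernel_pow C B k a b)" for a b
  have pow_nonneg: "0 \<le> kernel_pow C B k a b" for k a b
    using kernel_pow_mono_set[of C C B] C B by auto
  have Q_pos: "0 < Q a b" if "a \<in> C" "b \<in> C" for a b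
    unfolding Q_def using that N kk pow_nonneg by (intro sum_pos2[of _ "kk a b"]) auto
  have Q_comm: "(\<Sum>c\<in>C. Q a c * B c b) = (\<Sum>c\<in>C. B a c * Q c b)" if "a \<in> C" "b \<in> C" for a b
  proof -
    have "(\<Sum>c\<in>C. Q a c * B c b) = (\<Sum>k\<le>N. kernel_pow C B (Suc k) a b)"
      unfolding Q_def by (simp add: sum_distrib_right) (rule sum.swap)
    also have "\<dots> = (\<Sum>k\<le>N. \<Sum>c\<in>C. B a c * kernel_pow C B k c b)"
      using kernel_pow_Suc_left[of C _ _ B] C that by simp
    also have "\<dots> = (\<Sum>c\<in>C. B a c * Q c b)"
      unfolding Q_def sum_distrib_left by (rule sum.swap)
    finally show ?thesis .
  qed
  define w where "w a = (\<Sum>b\<in>C. Q a b * z b)" for a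
  have w_pos: "0 < w a" if "a \<in> C" for a
    unfolding w_def using that z C Q_pos[OF that]
    by (intro sum_pos2[of _ a0]) (auto simp: less_imp_le)
  have Bw: "(\<Sum>c\<in>C. B a c * w c) = (\<Sum>c\<in>C. Q a c * (\<Sum>b\<in>C. B c b * z b))" if "a \<in> C" for a
  proof -
    have "(\<Sum>c\<in>C. B a c * w c) = (\<Sum>b\<in>C. (\<Sum>c\<in>C. B a c * Q c b) * z b)"
      unfolding w_def by (simp add: sum_distrib_left sum_distrib_right mult.assoc) (rule sum.swap)
    also have "\<dots> = (\<Sum>b\<in>C. (\<Sum>c\<in>C. Q a c * B c b) * z b)" using Q_comm that by simp
    also have "\<dots> = (\<Sum>c\<in>C. Q a c * (\<Sum>b\<in>C. B c b * z b))"
      by (simp add: sum_distrib_left sum_distrib_right mult.assoc) (rule sum.swap)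
    finally show ?thesis .
  qed
  have eq: "(\<Sum>b\<in>C. B a1 b * z b) = \<rho> * z a1" if a1: "a1 \<in> C" for a1
  proof (rule ccontr)
    assume "(\<Sum>b\<in>C. B a1 b * z b) \<noteq> \<rho> * z a1"
    then have strict: "\<rho> * z a1 < (\<Sum>b\<in>C. B a1 b * z b)" using sub[OF a1] by linarith
    have gt: "\<rho> * w a < (\<Sum>c\<in>C. B a c * w c)" if "a \<in> C" for a
    proof -
      have "\<rho> * w a = (\<Sum>c\<in>C. Q a c * (\<rho> * z c))" by (simp add: w_def sum_distrib_left mult_ac)
      also have "\<dots> < (\<Sum>c\<in>C. Q a c * (\<Sum>b\<in>C. B c b * z b))"
        using a1 strict sub Q_pos[OF that] C
        by (intro sum_strict_mono_ex1) (auto intro!: mult_left_mono less_imp_le bexI[of _ a1])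
      finally show ?thesis using Bw[OF that] by simp
    qed
    \<comment> \<open>As \<open>C\<close> is finite, the strict inequalities at all labels hold with
      a common factor \<open>r1\<close> above \<rho>.\<close>
    define r1 where "r1 = Min ((\<lambda>a. (\<Sum>c\<in>C. B a c * w c) / w a) ` C)"
    have r1_gt: "\<rho> < r1"
      unfolding r1_def using C a1 gt w_pos by (subst Min_gr_iff) (auto simp: pos_less_divide_eq)
    have r1: "r1 * w a \<le> (\<Sum>c\<in>C. B a c * w c)" if "a \<in> C" for a
    proof -
      have "r1 \<le> (\<Sum>c\<in>C. B a c * w c) / w a" unfolding r1_def using C that by (intro Min_le) auto
      then show ?thesis using w_pos[OF that] by (simp add: pos_le_divide_eq)
    qed
    have pow: "r1 ^ k * w a \<le> (\<Sum>b\<in>C. kernel_pow C B k a b * w b)" if "a \<in> C" for k a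
    proof (induction k)
      case 0
      then show ?case using C that by (simp add: of_bool_def if_distrib[of "\<lambda>t. t * _"] cong: if_cong)
    next
      case (Suc k)
      have "r1 ^ Suc k * w a \<le> r1 * (\<Sum>b\<in>C. kernel_pow C B k a b * w b)"
        using Suc r1_gt \<rho> by (simp add: mult.assoc mult_left_mono)
      also have "\<dots> = (\<Sum>c\<in>C. kernel_pow C B k a c * (r1 * w c))"
        by (simp add: sum_distrib_left mult_ac)
      also have "\<dots> \<le> (\<Sum>c\<in>C. kernel_pow C B k a c * (\<Sum>b\<in>C. B c b * w b))"
        using r1 pow_nonneg by (intro sum_mono mult_left_mono) auto
      also have "\<dots> = (\<Sum>b\<in>C. kernel_pow C B (Suc k) a b * w b)"
        by (simp add: sum_distrib_left sum_distrib_right mult.assoc) (rule sum.swap)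
      finally show ?case .
    qed
    obtain r where r: "\<rho> < r" "r < r1" using r1_gt dense by blast
    obtain D where D: "\<And>k a b. a \<in> C \<Longrightarrow> b \<in> C \<Longrightarrow> kernel_pow C B k a b \<le> D * r ^ k"
      using growth[OF r(1)] by blast
    have "r1 \<le> r"
    proof (rule exponential_compare)
      show "0 < w a1" using w_pos a1 by simp
      fix k
      have "r1 ^ k * w a1 \<le> (\<Sum>b\<in>C. D * r ^ k * w b)"
        using pow[OF a1, of k] D[OF a1] w_pos
        by (intro order.trans[OF pow[OF a1]] sum_mono mult_right_mono) (auto intro: less_imp_le)
      then show "w a1 * r1 ^ k \<le> (D * (\<Sum>b\<in>C. w b)) * r ^ k"
        by (simp add: sum_distrib_left sum_distrib_right mult_ac)
    qed (use r \<rho> in auto)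
    then show False using r by simp
  qed
  \<comment> \<open>On the eigenvector z, \<open>Q\<close> acts by a scalar, so the positivity of w
    passes to z.\<close>
  have "w a = (\<Sum>k\<le>N. \<rho> ^ k * z a)"
  proof -
    have "w a = (\<Sum>k\<le>N. \<Sum>b\<in>C. kernel_pow C B k a b * z b)"
      unfolding w_def Q_def sum_distrib_right by (rule sum.swap)
    then show ?thesis using kernel_pow_eigen[of C B z \<rho> a] C eq a by simp
  qed
  then have "z a \<noteq> 0" using w_pos[OF a] by auto
  then show ?thesis using z(1)[of a] eq[OF a] by simp
qed

section \<open>Harmonic forms and the character group\<close>

text \<open>Gram-Schmidt by induction on the spanning family: \<open>b'\<close> is the part of the
  new vector orthogonal to the old ones, and the residual of x is corrected along it.\<close>

lemma orthogonal_projection_exists: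
  fixes b :: "'v \<Rightarrow> 'e \<Rightarrow> real"
  assumes "finite E" "finite F"
  shows "\<exists>f. \<forall>w\<in>F. (\<Sum>e\<in>E. (x e - (\<Sum>v\<in>F. f v * b v e)) * b w e) = 0"
  using assms(2)
proof (induction F arbitrary: x rule: finite_induct)
  case (insert u F)
  obtain g where g: "\<And>w. w \<in> F \<Longrightarrow> (\<Sum>e\<in>E. (b u e - (\<Sum>v\<in>F. g v * b v e)) * b w e) = 0"
    using insert.IH[of "b u"] by blast
  obtain f where f: "\<And>w. w \<in> F \<Longrightarrow> (\<Sum>e\<in>E. (x e - (\<Sum>v\<in>F. f v * b v e)) * b w e) = 0"
    using insert.IH[of x] by blast
  define b' where "b' e = b u e - (\<Sum>v\<in>F. g v * b v e)" for e
  define r where "r e = x e - (\<Sum>v\<in>F. f v * b v e)" for e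
  \<comment> \<open>If the new vector depends on the old ones, \<open>b'\<close> vanishes on
    \<open>E\<close> and the quotient is 0 by the convention for division by zero.\<close>
  define t where "t = (\<Sum>e\<in>E. r e * b' e) / (\<Sum>e\<in>E. b' e * b' e)"
  define h where "h v = (if v = u then t else f v - t * g v)" for v
  have res: "x e - (\<Sum>v\<in>insert u F. h v * b v e) = r e - t * b' e" for e
  proof -
    have "(\<Sum>v\<in>F. h v * b v e) = (\<Sum>v\<in>F. f v * b v e - t * (g v * b v e))"
      using insert.hyps by (intro sum.cong) (auto simp: h_def algebra_simps)
    then show ?thesis
      using insert.hyps
      by (simp add: h_def[of u] r_def b'_def sum_subtractf sum_distrib_left[symmetric] algebra_simps)
  qed
  have orthF: "(\<Sum>e\<in>E. (r e - t * b' e) * b w e) = 0" if "w \<in> F" for w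
  proof -
    have "(\<Sum>e\<in>E. (r e - t * b' e) * b w e) = (\<Sum>e\<in>E. r e * b w e) - t * (\<Sum>e\<in>E. b' e * b w e)"
      by (simp add: algebra_simps sum_subtractf sum_distrib_left)
    then show ?thesis using f[OF that] g[OF that] by (simp add: r_def b'_def)
  qed
  have orthb': "(\<Sum>e\<in>E. (r e - t * b' e) * b' e) = 0"
  proof (cases "(\<Sum>e\<in>E. b' e * b' e) = 0")
    case True
    then have "\<forall>e\<in>E. b' e = 0" using assms(1) by (subst (asm) sum_nonneg_eq_0_iff) auto
    then show ?thesis by simp
  next
    case False
    have "(\<Sum>e\<in>E. (r e - t * b' e) * b' e) = (\<Sum>e\<in>E. r e * b' e) - t * (\<Sum>e\<in>E. b' e * b' e)"
      by (simp add: algebra_simps sum_subtractf sum_distrib_left)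
    then show ?thesis using False by (simp add: t_def)
  qed
  have "(\<Sum>e\<in>E. (r e - t * b' e) * b u e) =
      (\<Sum>e\<in>E. (r e - t * b' e) * b' e + (\<Sum>v\<in>F. g v * ((r e - t * b' e) * b v e)))"
  proof (intro sum.cong refl)
    fix e
    have "b u e = b' e + (\<Sum>v\<in>F. g v * b v e)" by (simp add: b'_def)
    then show "(r e - t * b' e) * b u e =
        (r e - t * b' e) * b' e + (\<Sum>v\<in>F. g v * ((r e - t * b' e) * b v e))"
      by (simp only: distrib_left sum_distrib_left mult.left_commute)
  qed
  also have "\<dots> = (\<Sum>v\<in>F. g v * (\<Sum>e\<in>E. (r e - t * b' e) * b v e))"
    by (simp add: sum.distrib orthb' sum_distrib_left) (rule sum.swap)
  also have "\<dots> = 0" using orthF by simp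
  finally show ?case using orthF by (intro exI[of _ h]) (simp only: res, auto)
qed auto

text \<open>Equivalent to the class being zero, but phrased for an arbitrary representative; later
  arguments about classes thus work without harmonic parts.\<close>

definition integral_on_cycles :: "('a, 'b) pre_digraph \<Rightarrow> ('b \<Rightarrow> real) \<Rightarrow> bool" where
  "integral_on_cycles G \<omega> \<longleftrightarrow> (\<forall>\<alpha>\<in>integral_homology G. pairing G \<omega> \<alpha> \<in> \<int>)"

definition half_form :: "('a, 'b) pre_digraph \<Rightarrow> 'b \<Rightarrow> real" where
  "half_form G = (\<lambda>e. if e \<in> arcs G then 1 / 2 else 0)"

lemma pairing_minus: "pairing G (\<lambda>e. \<omega> e - \<omega>' e) \<alpha> = pairing G \<omega> \<alpha> - pairing G \<omega>' \<alpha>"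
  by (simp add: pairing_def left_diff_distrib sum_subtractf)

lemma pairing_add_right: "pairing G \<omega> (\<lambda>e. \<alpha> e + \<beta> e) = pairing G \<omega> \<alpha> + pairing G \<omega> \<beta>"
  by (simp add: pairing_def distrib_left sum.distrib)

lemma pairing_minus_right: "pairing G \<omega> (\<lambda>e. \<alpha> e - \<beta> e) = pairing G \<omega> \<alpha> - pairing G \<omega> \<beta>"
  by (simp add: pairing_def right_diff_distrib sum_subtractf)

lemma one_forms_add: "\<omega> \<in> one_forms G \<Longrightarrow> \<omega>' \<in> one_forms G \<Longrightarrow> (\<lambda>e. \<omega> e + \<omega>' e) \<in> one_forms G"
  and one_forms_zero: "(\<lambda>e. 0) \<in> one_forms G"
  and one_forms_half: "half_form G \<in> one_forms G"
  by (auto simp: one_forms_def half_form_def)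

lemma exact_forms_add: "\<omega> \<in> exact_forms G \<Longrightarrow> \<omega>' \<in> exact_forms G \<Longrightarrow> (\<lambda>e. \<omega> e + \<omega>' e) \<in> exact_forms G"
  unfolding exact_forms_def one_forms_def
  by clarsimp (rule_tac x = "\<lambda>v. f v + fa v" in exI, simp)

lemma exact_forms_minus: "\<omega> \<in> exact_forms G \<Longrightarrow> \<omega>' \<in> exact_forms G \<Longrightarrow> (\<lambda>e. \<omega> e - \<omega>' e) \<in> exact_forms G"
  unfolding exact_forms_def one_forms_def
  by clarsimp (rule_tac x = "\<lambda>v. f v - fa v" in exI, simp)

lemma harmonic_forms_add: "\<omega> \<in> harmonic_forms G \<Longrightarrow> \<omega>' \<in> harmonic_forms G \<Longrightarrow> (\<lambda>e. \<omega> e + \<omega>' e) \<in> harmonic_forms G"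
  and harmonic_forms_minus: "\<omega> \<in> harmonic_forms G \<Longrightarrow> \<omega>' \<in> harmonic_forms G \<Longrightarrow> (\<lambda>e. \<omega> e - \<omega>' e) \<in> harmonic_forms G"
  by (auto simp: harmonic_forms_def one_forms_def sum.distrib sum_subtractf)

context fin_digraph
begin

lemma sum_verts_incidence:
  assumes "e \<in> arcs G"
  shows "(\<Sum>v\<in>verts G. f v * (of_bool (head G e = v) - of_bool (tail G e = v))) =
    (f (head G e) - f (tail G e) :: real)"
  using assms by (simp add: right_diff_distrib sum_subtractf sum_of_bool_mult)

text \<open>Summation by parts moves the differential of f to the boundary of \<alpha>.\<close>

lemma pairing_exact:
  assumes "\<psi> \<in> exact_forms G" "\<And>v. boundary G \<alpha> v = 0"
  shows "pairing G \<psi> \<alpha> = 0"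
proof -
  obtain f where f: "\<And>e. e \<in> arcs G \<Longrightarrow> \<psi> e = f (head G e) - f (tail G e)"
    using assms(1) by (auto simp: exact_forms_def)
  have "pairing G \<psi> \<alpha> = (\<Sum>e\<in>arcs G. \<Sum>v\<in>verts G. f v * (\<alpha> e * (of_bool (head G e = v) - of_bool (tail G e = v))))"
    unfolding pairing_def
    by (intro sum.cong) (simp_all add: f sum_verts_incidence[symmetric] sum_distrib_left mult_ac)
  also have "\<dots> = (\<Sum>v\<in>verts G. f v * boundary G \<alpha> v)"
    unfolding boundary_def sum_distrib_left by (rule sum.swap)
  finally show ?thesis by (simp add: assms(2))
qed

text \<open>Being harmonic means being orthogonal to the differentials \<open>b v\<close> of the
  indicator functions of vertices. A combination of these with coefficients f is the differential of
  f, so orthogonal projection splits off an exact form.\<close>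

lemma harmonic_decomposition:
  assumes "\<omega> \<in> one_forms G"
  shows "harmonic_part G \<omega> \<in> harmonic_forms G \<and> (\<lambda>e. \<omega> e - harmonic_part G \<omega> e) \<in> exact_forms G"
proof -
  define b where "b v e = (of_bool (head G e = v) - of_bool (tail G e = v) :: real)" for v e
  obtain f where f: "\<And>w. w \<in> verts G \<Longrightarrow>
      (\<Sum>e\<in>arcs G. (\<omega> e - (\<Sum>v\<in>verts G. f v * b v e)) * b w e) = 0"
    using orthogonal_projection_exists[of "arcs G" "verts G" \<omega> b] by auto
  define \<eta> where "\<eta> e = (if e \<in> arcs G then \<omega> e - (f (head G e) - f (tail G e)) else 0)" for e
  have "(\<Sum>e | e \<in> arcs G \<and> head G e = v. \<eta> e) = (\<Sum>e | e \<in> arcs G \<and> tail G e = v. \<eta> e)"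
    if "v \<in> verts G" for v
  proof -
    have "(\<Sum>e\<in>arcs G. \<eta> e * b v e) = 0"
      using f[OF that] by (simp add: \<eta>_def b_def sum_verts_incidence cong: sum.cong)
    then show ?thesis
      by (simp add: b_def right_diff_distrib sum_subtractf of_bool_def if_distrib[of "\<lambda>t. _ * t"]
          sum.inter_filter[symmetric] cong: if_cong)
  qed
  then have harm: "\<eta> \<in> harmonic_forms G" by (auto simp: harmonic_forms_def one_forms_def \<eta>_def)
  have ex: "(\<lambda>e. \<omega> e - \<eta> e) \<in> exact_forms G"
    using assms by (auto simp: exact_forms_def one_forms_def \<eta>_def intro!: exI[of _ f])
  have "\<exists>!\<eta>. \<eta> \<in> harmonic_forms G \<and> (\<lambda>e. \<omega> e - \<eta> e) \<in> exact_forms G"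
  proof (rule ex1I)
    show "\<eta> \<in> harmonic_forms G \<and> (\<lambda>e. \<omega> e - \<eta> e) \<in> exact_forms G" using harm ex by simp
    fix \<eta>' assume \<eta>': "\<eta>' \<in> harmonic_forms G \<and> (\<lambda>e. \<omega> e - \<eta>' e) \<in> exact_forms G"
    have "(\<lambda>e. \<eta>' e - \<eta> e) \<in> exact_forms G"
      using exact_forms_minus[OF ex conjunct2[OF \<eta>']] by simp
    then have "(\<lambda>e. \<eta>' e - \<eta> e) = (\<lambda>e. 0)"
      using harmonic_exact_zero[OF fin_digraph_axioms harmonic_forms_minus[OF conjunct1[OF \<eta>'] harm]] by simp
    then show "\<eta>' = \<eta>" by (simp add: fun_eq_iff)
  qed
  from theI'[OF this] show ?thesis unfolding harmonic_part_def .
qed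

lemma harmonic_part_eqI:
  assumes "\<omega> \<in> one_forms G" "\<eta> \<in> harmonic_forms G" "(\<lambda>e. \<omega> e - \<eta> e) \<in> exact_forms G"
  shows "harmonic_part G \<omega> = \<eta>"
proof -
  note h = harmonic_decomposition[OF assms(1)]
  have "(\<lambda>e. harmonic_part G \<omega> e - \<eta> e) \<in> exact_forms G"
    using exact_forms_minus[OF assms(3) conjunct2[OF h]] by simp
  then have "(\<lambda>e. harmonic_part G \<omega> e - \<eta> e) = (\<lambda>e. 0)"
    using harmonic_exact_zero[OF fin_digraph_axioms harmonic_forms_minus[OF conjunct1[OF h] assms(2)]] by simp
  then show ?thesis by (simp add: fun_eq_iff)
qed

lemma harmonic_part_harmonic: "\<eta> \<in> harmonic_forms G \<Longrightarrow> harmonic_part G \<eta> = \<eta>"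
  by (rule harmonic_part_eqI) (auto simp: harmonic_forms_def exact_forms_def one_forms_def intro!: exI[of _ "\<lambda>_. 0"])

lemma harmonic_part_add:
  assumes "\<omega> \<in> one_forms G" "\<omega>' \<in> one_forms G"
  shows "harmonic_part G (\<lambda>e. \<omega> e + \<omega>' e) = (\<lambda>e. harmonic_part G \<omega> e + harmonic_part G \<omega>' e)"
proof (rule harmonic_part_eqI)
  note h = harmonic_decomposition[OF assms(1)] harmonic_decomposition[OF assms(2)]
  show "(\<lambda>e. \<omega> e + \<omega>' e) \<in> one_forms G" using assms by (rule one_forms_add)
  show "(\<lambda>e. harmonic_part G \<omega> e + harmonic_part G \<omega>' e) \<in> harmonic_forms G"
    using h by (intro harmonic_forms_add) auto
  show "(\<lambda>e. \<omega> e + \<omega>' e - (harmonic_part G \<omega> e + harmonic_part G \<omega>' e)) \<in> exact_forms G"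
    using exact_forms_add[OF conjunct2[OF h(1)] conjunct2[OF h(2)]] by (simp add: algebra_simps)
qed

lemma pairing_harmonic_part:
  assumes "\<omega> \<in> one_forms G" "\<alpha> \<in> integral_homology G"
  shows "pairing G (harmonic_part G \<omega>) \<alpha> = pairing G \<omega> \<alpha>"
  using pairing_exact[OF conjunct2[OF harmonic_decomposition[OF assms(1)]], of \<alpha>] assms(2)
  by (simp add: pairing_minus integral_homology_def)

text \<open>The cosets agree iff the harmonic parts differ by an element of the dual lattice. Exact
  forms vanish on cycles, so this condition can be read off from the forms themselves.\<close>

lemma form_class_eq_iff:
  assumes "\<omega> \<in> one_forms G" "\<omega>' \<in> one_forms G"
  shows "form_class G \<omega> = form_class G \<omega>' \<longleftrightarrow> integral_on_cycles G (\<lambda>e. \<omega> e - \<omega>' e)"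
proof -
  interpret H: comm_group "harmonic_group G" by (rule comm_group_harmonic_group)
  have sub: "subgroup (dual_lattice G) (harmonic_group G)"
    by (rule normal_imp_subgroup[OF normal_dual_lattice])
  have car: "harmonic_part G \<omega> \<in> carrier (harmonic_group G)" "harmonic_part G \<omega>' \<in> carrier (harmonic_group G)"
    using harmonic_decomposition assms by (auto simp: harmonic_group_def)
  define d where "d = (\<lambda>e. harmonic_part G \<omega> e - harmonic_part G \<omega>' e)"
  have d: "d \<in> dual_lattice G \<longleftrightarrow> integral_on_cycles G (\<lambda>e. \<omega> e - \<omega>' e)"
    using harmonic_decomposition assms
    by (auto simp: d_def dual_lattice_def integral_on_cycles_def harmonic_forms_minus pairing_minus pairing_harmonic_part)
  have "form_class G \<omega> = form_class G \<omega>' \<longleftrightarrow> harmonic_part G \<omega> \<in> form_class G \<omega>'"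
    unfolding form_class_def using H.rcos_self[OF car(1) sub] H.repr_independence[OF _ car(2) sub] by metis
  also have "\<dots> \<longleftrightarrow> d \<in> dual_lattice G"
    by (auto simp: form_class_def r_coset_def harmonic_group_def d_def fun_eq_iff intro!: bexI[of _ d])
  finally show ?thesis using d by simp
qed

lemma form_class_add:
  assumes "\<omega> \<in> one_forms G" "\<omega>' \<in> one_forms G"
  shows "form_class G \<omega> \<otimes>\<^bsub>character_group G\<^esub> form_class G \<omega>' = form_class G (\<lambda>e. \<omega> e + \<omega>' e)"
proof -
  have "harmonic_part G \<omega> \<in> carrier (harmonic_group G)" "harmonic_part G \<omega>' \<in> carrier (harmonic_group G)"
    using harmonic_decomposition assms by (auto simp: harmonic_group_def)
  from normal.rcos_sum[OF normal_dual_lattice this] show ?thesis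
    by (simp add: form_class_def character_group_def FactGroup_def harmonic_part_add[OF assms])
      (simp add: harmonic_group_def)
qed

lemma form_class_zero: "form_class G (\<lambda>e. 0) = \<one>\<^bsub>character_group G\<^esub>"
proof -
  interpret H: comm_group "harmonic_group G" by (rule comm_group_harmonic_group)
  have sub: "subgroup (dual_lattice G) (harmonic_group G)"
    by (rule normal_imp_subgroup[OF normal_dual_lattice])
  have "harmonic_part G (\<lambda>e. 0) = \<one>\<^bsub>harmonic_group G\<^esub>"
    by (subst harmonic_part_harmonic) (auto simp: harmonic_forms_def one_forms_def harmonic_group_def)
  then show ?thesis
    using H.coset_mult_one[OF subgroup.subset[OF sub]]
    by (simp add: form_class_def character_group_def FactGroup_def)
qed

lemma form_class_in_carrier:
  assumes "\<omega> \<in> one_forms G"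
  shows "form_class G \<omega> \<in> carrier (character_group G)"
  using harmonic_decomposition[OF assms]
  by (auto simp: form_class_def character_group_def FactGroup_def RCOSETS_def harmonic_group_def)

lemma carrier_character_groupE:
  assumes "\<theta> \<in> carrier (character_group G)"
  obtains \<eta> where "\<eta> \<in> one_forms G" "\<theta> = form_class G \<eta>"
proof -
  obtain \<eta> where \<eta>: "\<eta> \<in> harmonic_forms G" "\<theta> = dual_lattice G #>\<^bsub>harmonic_group G\<^esub> \<eta>"
    using assms by (auto simp: character_group_def FactGroup_def RCOSETS_def harmonic_group_def)
  then have "\<theta> = form_class G \<eta>" by (simp add: form_class_def harmonic_part_harmonic)
  then show ?thesis using that \<eta>(1) by (auto simp: harmonic_forms_def)
qed

lemma form_class_eq_one_iff:
  "\<omega> \<in> one_forms G \<Longrightarrow> form_class G \<omega> = \<one>\<^bsub>character_group G\<^esub> \<longleftrightarrow> integral_on_cycles G \<omega>"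
  using form_class_eq_iff[OF _ one_forms_zero, of \<omega>] by (simp add: form_class_zero)

lemma integral_on_cycles_int_valued:
  "(\<And>e. e \<in> arcs G \<Longrightarrow> \<omega> e \<in> \<int>) \<Longrightarrow> integral_on_cycles G \<omega>"
  by (auto simp: integral_on_cycles_def pairing_def integral_homology_def intro!: Ints_sum Ints_mult)

end

section \<open>The relation of feeding into\<close>

lemma edge_inv_inv [simp]: "edge_inv (edge_inv a) = a"
  by (simp add: edge_inv_def)

lemma edge_inv_eq_iff [simp]: "edge_inv a = edge_inv b \<longleftrightarrow> a = b"
  by (metis edge_inv_inv)

lemma edge_inv_neq [simp]: "edge_inv a \<noteq> a" "a \<noteq> edge_inv a"
  by (auto simp: edge_inv_def prod_eq_iff)

lemma fst_edge_inv [simp]: "fst (edge_inv a) = fst a"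
  by (simp add: edge_inv_def)

lemma fst_eq_imp_edge: "fst a = fst b \<Longrightarrow> a = b \<or> a = edge_inv b"
  by (cases a; cases b) (auto simp: edge_inv_def)

lemma edge_init_inv [simp]: "edge_init G (edge_inv a) = edge_term G a"
  and edge_term_inv [simp]: "edge_term G (edge_inv a) = edge_init G a"
  by (auto simp: edge_init_def edge_term_def edge_inv_def)

lemma oriented_edges_inv [simp]: "edge_inv a \<in> oriented_edges G \<longleftrightarrow> a \<in> oriented_edges G"
  by (cases a) (auto simp: oriented_edges_def edge_inv_def)

lemma feeds_into_inv [simp]: "feeds_into G (edge_inv a) (edge_inv b) \<longleftrightarrow> feeds_into G b a"
  by (auto simp: feeds_into_def)

definition feeds_rel :: "('a, 'b) pre_digraph \<Rightarrow> (('b \<times> bool) \<times> ('b \<times> bool)) set" where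
  "feeds_rel G = {(a, b). a \<in> oriented_edges G \<and> b \<in> oriented_edges G \<and> feeds_into G a b}"

text \<open>The irreflexive closure demands a genuine closed walk through the edge; edges inside
  trees hanging off the graph are thereby left out.\<close>

definition recurrent_edges :: "('a, 'b) pre_digraph \<Rightarrow> ('b \<times> bool) set" where
  "recurrent_edges G = {a. (a, a) \<in> (feeds_rel G)\<^sup>+}"

lemma feeds_rel_inv: "(a, b) \<in> feeds_rel G \<Longrightarrow> (edge_inv b, edge_inv a) \<in> feeds_rel G"
  by (auto simp: feeds_rel_def)

lemma feeds_rtrancl_inv: "(a, b) \<in> (feeds_rel G)\<^sup>* \<Longrightarrow> (edge_inv b, edge_inv a) \<in> (feeds_rel G)\<^sup>*"
  by (induction rule: rtrancl_induct) (auto intro: converse_rtrancl_into_rtrancl feeds_rel_inv)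

lemma feeds_trancl_inv: "(a, b) \<in> (feeds_rel G)\<^sup>+ \<Longrightarrow> (edge_inv b, edge_inv a) \<in> (feeds_rel G)\<^sup>+"
  by (induction rule: trancl_induct) (auto intro: trancl_into_trancl2 feeds_rel_inv)

lemma recurrent_edges_inv: "a \<in> recurrent_edges G \<Longrightarrow> edge_inv a \<in> recurrent_edges G"
  by (auto simp: recurrent_edges_def intro: feeds_trancl_inv)

lemma recurrent_edges_oriented: "a \<in> recurrent_edges G \<Longrightarrow> a \<in> oriented_edges G"
  by (auto simp: recurrent_edges_def feeds_rel_def elim: tranclE)

text \<open>The closed walk through \<open>a\<close> gives even \<open>a\<close> itself a
  predecessor, so one can step back from every reachable edge.\<close>

lemma recurrent_pred:
  assumes "a \<in> recurrent_edges G" "(a, b) \<in> (feeds_rel G)\<^sup>*"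
  obtains c where "(a, c) \<in> (feeds_rel G)\<^sup>*" "(c, b) \<in> feeds_rel G"
proof -
  have "(a, b) \<in> (feeds_rel G)\<^sup>+"
    using assms by (auto simp: recurrent_edges_def)
  then show ?thesis using that by (metis tranclD2)
qed

context fin_digraph
begin

lemma finite_oriented_edges [simp]: "finite (oriented_edges G)"
  by (simp add: oriented_edges_def)

lemma edge_init_in_verts [simp]: "a \<in> oriented_edges G \<Longrightarrow> edge_init G a \<in> verts G"
  and edge_term_in_verts [simp]: "a \<in> oriented_edges G \<Longrightarrow> edge_term G a \<in> verts G"
  by (auto simp: oriented_edges_def edge_init_def edge_term_def)

lemma sum_oriented_edges:
  "(\<Sum>a\<in>oriented_edges G. f a) = (\<Sum>e\<in>arcs G. f (e, True) + f (e, False))"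
proof -
  have "(\<Sum>a\<in>oriented_edges G. f a) = (\<Sum>e\<in>arcs G. \<Sum>s\<in>UNIV. f (e, s))"
    unfolding oriented_edges_def sum.cartesian_product by simp
  then show ?thesis by (simp add: UNIV_bool add.commute)
qed

end

locale connected_digraph = fin_digraph +
  assumes connected: "Digraph_Component.connected G"
begin

text \<open>Connectivity as an induction principle for sets of vertices.\<close>

lemma adjacency_closed_imp_verts:
  assumes H: "H \<subseteq> verts G" "r \<in> H"
    and cl: "\<And>a. a \<in> oriented_edges G \<Longrightarrow> edge_init G a \<in> H \<Longrightarrow> edge_term G a \<in> H"
  shows "H = verts G"
proof
  show "verts G \<subseteq> H"
  proof
    fix v assume v: "v \<in> verts G"
    have "r \<rightarrow>\<^sup>*\<^bsub>mk_symmetric G\<^esub> v"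
      using connected v H by (auto simp: connected_def strongly_connected_def)
    then have "(r, v) \<in> rtrancl_on (verts G) (\<Union>e\<in>arcs G. {(tail G e, head G e), (head G e, tail G e)})"
      by (simp add: reachable_def arcs_ends_conv mk_symmetric_def)
    then show "v \<in> H"
    proof (induction rule: rtrancl_on_induct)
      case (step y z)
      then obtain e where e: "e \<in> arcs G" "(y, z) \<in> {(tail G e, head G e), (head G e, tail G e)}"
        by auto
      show ?case
        using e step.IH cl[of "(e, True)"] cl[of "(e, False)"]
        by (auto simp: oriented_edges_def edge_init_def edge_term_def)
    qed (use H in simp)
  qed
qed (rule H)

lemma verts_nonempty: "verts G \<noteq> {}"
  using connected by (auto simp: connected_def strongly_connected_def)

text \<open>In the case of failure, \<open>R\<close> contains each arc in exactly one orientation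
  and has exactly one edge ending at each vertex. Counting \<open>R\<close> in both ways gives as
  many arcs as vertices, which is genus 1.\<close>

lemma recurrent_reaches_inverse:
  assumes a: "a \<in> recurrent_edges G" and g: "genus G \<noteq> 1"
  shows "(a, edge_inv a) \<in> (feeds_rel G)\<^sup>*"
proof (rule ccontr)
  assume no: "(a, edge_inv a) \<notin> (feeds_rel G)\<^sup>*"
  define R where "R = {b. (a, b) \<in> (feeds_rel G)\<^sup>*}"
  have R_or: "b \<in> oriented_edges G" if "b \<in> R" for b
    using that recurrent_pred[OF a, of b] by (auto simp: R_def feeds_rel_def)
  have step: "c \<in> R" if "b \<in> R" "(b, c) \<in> feeds_rel G" for b c
    using that by (auto simp: R_def)
  \<comment> \<open>A walk from \<open>a\<close> to the inverse of \<open>b\<close>, inverted, leads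
    from \<open>b\<close> to the inverse of \<open>a\<close>; it would extend the walk from
    \<open>a\<close> to \<open>b\<close>.\<close>
  have not_both: "edge_inv b \<notin> R" if "b \<in> R" for b
    using that no feeds_rtrancl_inv[of a "edge_inv b" G] by (auto simp: R_def dest: rtrancl_trans)
  \<comment> \<open>Of two different edges with a common end, one feeds into the inverse of the
    other.\<close>
  have term_inj: "b = b'" if "b \<in> R" "b' \<in> R" "edge_term G b = edge_term G b'" for b b'
    using that step[of b' "edge_inv b"] not_both[of b] R_or
    by (auto simp: feeds_rel_def feeds_into_def)
  have "edge_term G ` R = verts G"
  proof (rule adjacency_closed_imp_verts)
    show "edge_term G ` R \<subseteq> verts G" using R_or by auto
    show "edge_term G a \<in> edge_term G ` R" by (auto simp: R_def)
    fix d assume d: "d \<in> oriented_edges G" "edge_init G d \<in> edge_term G ` R"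
    then obtain b where b: "b \<in> R" "edge_init G d = edge_term G b" by auto
    show "edge_term G d \<in> edge_term G ` R"
    proof (cases "d = edge_inv b")
      case True
      \<comment> \<open>Turning back along \<open>b\<close> leads to its start, where its
        predecessor ends.\<close>
      obtain c where "(a, c) \<in> (feeds_rel G)\<^sup>*" "(c, b) \<in> feeds_rel G"
        using recurrent_pred[OF a, of b] b by (auto simp: R_def)
      then have "c \<in> R" "edge_term G d = edge_term G c"
        using True by (auto simp: R_def feeds_rel_def feeds_into_def)
      then show ?thesis by (metis imageI)
    next
      case False
      then have "d \<in> R" using step[OF b(1), of d] b d R_or by (auto simp: feeds_rel_def feeds_into_def)
      then show ?thesis by blast
    qed
  qed
  then have "card R = card (verts G)"
    using card_image[of "edge_term G" R] term_inj by (auto simp: inj_on_def)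
  moreover have "fst ` R = arcs G"
  proof
    show "fst ` R \<subseteq> arcs G" using R_or by (auto simp: oriented_edges_def)
    show "arcs G \<subseteq> fst ` R"
    proof
      fix e assume e: "e \<in> arcs G"
      then have d: "(e, True) \<in> oriented_edges G" by (simp add: oriented_edges_def)
      then have "edge_init G (e, True) \<in> edge_term G ` R" using \<open>edge_term G ` R = verts G\<close> by simp
      then obtain b where b: "b \<in> R" "edge_init G (e, True) = edge_term G b" by auto
      show "e \<in> fst ` R"
      proof (cases "(e, True) = edge_inv b")
        case True
        then have "e = fst b" by (metis fst_conv fst_edge_inv)
        then show ?thesis using b by blast
      next
        case False
        then have "(e, True) \<in> R" using step[OF b(1), of "(e, True)"] b d R_or
          by (auto simp: feeds_rel_def feeds_into_def)
        then show ?thesis by force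
      qed
    qed
  qed
  moreover have "inj_on fst R"
    using not_both fst_eq_imp_edge by (metis inj_onI)
  ultimately have "card (arcs G) = card (verts G)" using card_image by metis
  then show False using g by (simp add: genus_def)
qed

text \<open>The edges reachable from \<open>a\<close> end at every vertex, in particular where
  \<open>b\<close> starts. From there \<open>b\<close> is entered directly unless this would
  backtrack; in that case the inverse of \<open>b\<close> has been reached, and it leads to
  \<open>b\<close>.\<close>

lemma recurrent_edges_connected:
  assumes a: "a \<in> recurrent_edges G" and b: "b \<in> recurrent_edges G" and g: "genus G \<noteq> 1"
  shows "(a, b) \<in> (feeds_rel G)\<^sup>*"
proof -
  define R where "R = {b. (a, b) \<in> (feeds_rel G)\<^sup>*}"
  have R_or: "b \<in> oriented_edges G" if "b \<in> R" for b
    using that recurrent_pred[OF a, of b] by (auto simp: R_def feeds_rel_def)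
  have step: "d \<in> R \<or> d = edge_inv c"
    if "c \<in> R" "edge_init G d = edge_term G c" "d \<in> oriented_edges G" for c d
  proof (cases "d = edge_inv c")
    case False
    then have "(c, d) \<in> feeds_rel G" using that R_or by (auto simp: feeds_rel_def feeds_into_def)
    then show ?thesis using that(1) by (simp add: R_def rtrancl.rtrancl_into_rtrancl)
  qed simp
  have H: "edge_term G ` R = verts G"
  proof (rule adjacency_closed_imp_verts)
    show "edge_term G ` R \<subseteq> verts G" using R_or by auto
    show "edge_term G a \<in> edge_term G ` R" by (auto simp: R_def)
    fix d assume d: "d \<in> oriented_edges G" "edge_init G d \<in> edge_term G ` R"
    then obtain c where c: "c \<in> R" "edge_init G d = edge_term G c" by auto
    consider "d \<in> R" | "d = edge_inv c" using step[OF c d(1)] by auto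
    then show "edge_term G d \<in> edge_term G ` R"
    proof cases
      case 2
      obtain c' where "(a, c') \<in> (feeds_rel G)\<^sup>*" "(c', c) \<in> feeds_rel G"
        using recurrent_pred[OF a, of c] c by (auto simp: R_def)
      then have "c' \<in> R" "edge_term G d = edge_term G c'"
        using 2 by (auto simp: R_def feeds_rel_def feeds_into_def)
      then show ?thesis by (metis imageI)
    qed auto
  qed
  have "edge_init G b \<in> edge_term G ` R" using H recurrent_edges_oriented[OF b] by simp
  then obtain c where "c \<in> R" "edge_init G b = edge_term G c" by auto
  from step[OF this recurrent_edges_oriented[OF b]] have "b \<in> R \<or> edge_inv b \<in> R"
    using \<open>c \<in> R\<close> by auto
  moreover have "(edge_inv b, b) \<in> (feeds_rel G)\<^sup>*"
    using recurrent_reaches_inverse[OF recurrent_edges_inv[OF b] g] by simp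
  ultimately show ?thesis by (auto simp: R_def)
qed

text \<open>The intermediate edges of a walk from \<open>a\<close> to \<open>b\<close> are recurrent
  too, because \<open>b\<close> leads back to \<open>a\<close>. So the block of recurrent edges is
  irreducible.\<close>

lemma recurrent_edges_connected_within:
  assumes a: "a \<in> recurrent_edges G" and b: "b \<in> recurrent_edges G" and g: "genus G \<noteq> 1"
  shows "(a, b) \<in> {(a, b). a \<in> recurrent_edges G \<and> b \<in> recurrent_edges G \<and> feeds_into G a b}\<^sup>*"
  using recurrent_edges_connected[OF a b g] a
proof (induction rule: converse_rtrancl_induct)
  case (step a c)
  have "(b, a) \<in> (feeds_rel G)\<^sup>*" using recurrent_edges_connected[OF b step.prems g] .
  then have "(c, c) \<in> (feeds_rel G)\<^sup>+"
    using step.hyps by (meson rtrancl_into_trancl1 rtrancl_trans)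
  then have "c \<in> recurrent_edges G" by (simp add: recurrent_edges_def)
  then show ?case
    using step by (intro converse_rtrancl_into_rtrancl[of a c]) (auto simp: feeds_rel_def)
qed simp

end

section \<open>Underdetermined linear systems and periodic points of finite maps\<close>

lemma nontrivial_kernel:
  fixes M :: "'v \<Rightarrow> 'e \<Rightarrow> real"
  assumes "finite V" "finite E" "card V < card E"
  shows "\<exists>\<alpha>. (\<exists>e\<in>E. \<alpha> e \<noteq> 0) \<and> (\<forall>v\<in>V. (\<Sum>e\<in>E. M v e * \<alpha> e) = 0)"
  using assms
proof (induction V arbitrary: E M rule: finite_induct)
  case empty
  then have "E \<noteq> {}" by auto
  then show ?case by (intro exI[of _ "\<lambda>_. 1"]) auto
next
  case (insert v V)
  show ?case
  proof (cases "\<forall>e\<in>E. M v e = 0")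
    case True
    have "card V < card E" using insert by simp
    then obtain \<alpha> where "\<exists>e\<in>E. \<alpha> e \<noteq> 0" "\<forall>v\<in>V. (\<Sum>e\<in>E. M v e * \<alpha> e) = 0"
      using insert.IH[OF insert.prems(1), of M] by blast
    then show ?thesis using True by (intro exI[of _ \<alpha>]) auto
  next
    case False
    \<comment> \<open>Gaussian elimination with pivot \<open>e0\<close>: the equation of
      \<open>v\<close> is solved for this unknown and substituted into the others.\<close>
    then obtain e0 where e0: "e0 \<in> E" "M v e0 \<noteq> 0" by auto
    define E' where "E' = E - {e0}"
    have E': "finite E'" "E = insert e0 E'" "e0 \<notin> E'" using e0 insert.prems by (auto simp: E'_def)
    have "card V < card E'" using insert E' by auto
    then obtain \<alpha> where \<alpha>: "\<exists>e\<in>E'. \<alpha> e \<noteq> 0"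
        "\<And>w. w \<in> V \<Longrightarrow> (\<Sum>e\<in>E'. (M w e - M w e0 * M v e / M v e0) * \<alpha> e) = 0"
      using insert.IH[of E' "\<lambda>w e. M w e - M w e0 * M v e / M v e0"] E' by metis
    define t where "t = - (\<Sum>e\<in>E'. M v e * \<alpha> e) / M v e0"
    have sum: "(\<Sum>e\<in>E. M w e * (\<alpha>(e0 := t)) e) = M w e0 * t + (\<Sum>e\<in>E'. M w e * \<alpha> e)" for w
    proof -
      have "(\<Sum>e\<in>E'. M w e * (\<alpha>(e0 := t)) e) = (\<Sum>e\<in>E'. M w e * \<alpha> e)"
        using E' by (intro sum.cong) auto
      then show ?thesis using E' by simp
    qed
    have "M w e0 * t + (\<Sum>e\<in>E'. M w e * \<alpha> e) = 0" if "w \<in> V" for w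
    proof -
      have "(\<Sum>e\<in>E'. (M w e - M w e0 * M v e / M v e0) * \<alpha> e) =
          (\<Sum>e\<in>E'. M w e * \<alpha> e - M w e0 / M v e0 * (M v e * \<alpha> e))"
        by (intro sum.cong) (auto simp: left_diff_distrib)
      also have "\<dots> = (\<Sum>e\<in>E'. M w e * \<alpha> e) - M w e0 / M v e0 * (\<Sum>e\<in>E'. M v e * \<alpha> e)"
        by (simp only: sum_subtractf sum_distrib_left)
      finally show ?thesis using \<alpha>(2)[OF that] by (simp add: t_def)
    qed
    moreover have "M v e0 * t + (\<Sum>e\<in>E'. M v e * \<alpha> e) = 0" using e0 by (simp add: t_def)
    moreover have "\<exists>e\<in>E. (\<alpha>(e0 := t)) e \<noteq> 0" using \<alpha>(1) E' by auto
    ultimately show ?thesis by (intro exI[of _ "\<alpha>(e0 := t)"]) (simp only: sum, auto)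
  qed
qed

text \<open>The least period makes the orbit injective. For a successor function on edges this means
  a closed walk without repeated edges.\<close>

lemma finite_periodic_point:
  assumes "finite P" "x0 \<in> P" "\<And>x. x \<in> P \<Longrightarrow> f x \<in> P"
  obtains i x k where "x = (f ^^ i) x0" "x \<in> P" "0 < k" "(f ^^ k) x = x"
    "inj_on (\<lambda>i. (f ^^ i) x) {..<k}"
proof -
  have P: "(f ^^ i) x0 \<in> P" for i by (induction i) (auto simp: assms)
  have "\<not> inj (\<lambda>i. (f ^^ i) x0)"
    using P assms(1) by (metis finite_subset finite_imageD image_subsetI infinite_UNIV_nat)
  then obtain i j where ij: "i < j" "(f ^^ i) x0 = (f ^^ j) x0"
    by (auto simp: inj_def) (metis linorder_neqE_nat)
  define x where "x = (f ^^ i) x0"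
  have "(f ^^ (j - i)) x = (f ^^ (j - i + i)) x0" by (simp only: x_def funpow_add comp_apply)
  then have "(f ^^ (j - i)) x = x" using ij by (simp add: x_def)
  then have ex: "\<exists>k>0. (f ^^ k) x = x" using ij(1) by (intro exI[of _ "j - i"]) auto
  define k where "k = (LEAST k. 0 < k \<and> (f ^^ k) x = x)"
  have k: "0 < k" "(f ^^ k) x = x" using LeastI_ex[OF ex] by (auto simp: k_def)
  have min: "k \<le> l" if "0 < l" "(f ^^ l) x = x" for l
    unfolding k_def using that by (intro Least_le) auto
  have "inj_on (\<lambda>i. (f ^^ i) x) {..<k}"
  proof (rule linorder_inj_onI')
    fix a b assume ab: "a \<in> {..<k}" "b \<in> {..<k}" "a < b"
    show "(f ^^ a) x \<noteq> (f ^^ b) x"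
    proof
      assume "(f ^^ a) x = (f ^^ b) x"
      then have "(f ^^ (k - b)) ((f ^^ a) x) = (f ^^ (k - b)) ((f ^^ b) x)" by simp
      then have "(f ^^ (k - b + a)) x = (f ^^ (k - b + b)) x" by (simp only: funpow_add comp_apply)
      then have "(f ^^ (k - b + a)) x = x" using ab k(2) by simp
      then show False using min[of "k - b + a"] ab by auto
    qed
  qed
  then show ?thesis using that[of x i k] k P x_def by auto
qed

section \<open>Closed walks and potentials\<close>

definition edge_coeff :: "('b \<Rightarrow> real) \<Rightarrow> 'b \<times> bool \<Rightarrow> real" where
  "edge_coeff \<alpha> a = (if snd a then \<alpha> (fst a) else - \<alpha> (fst a))"

definition weight :: "('a, 'b) pre_digraph \<Rightarrow> ('b \<Rightarrow> real) \<Rightarrow> 'b \<times> bool \<Rightarrow> complex" where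
  "weight G \<omega> a = chi G \<omega> (edge_chain a)"

text \<open>A periodic sequence instead of a list: the step from the last edge back to the first is
  a step like any other, so backtracking is excluded there as well.\<close>

definition closed_walk :: "('a, 'b) pre_digraph \<Rightarrow> (nat \<Rightarrow> 'b \<times> bool) \<Rightarrow> nat \<Rightarrow> bool" where
  "closed_walk G s k \<longleftrightarrow> 0 < k \<and>
    (\<forall>i. s i \<in> oriented_edges G \<and> feeds_into G (s i) (s (Suc i)) \<and> s (i + k) = s i)"

lemma edge_coeff_inv [simp]: "edge_coeff \<alpha> (edge_inv a) = - edge_coeff \<alpha> a"
  by (simp add: edge_coeff_def edge_inv_def)

lemma chi_cis: "chi G \<omega> \<alpha> = cis (2 * pi * pairing G \<omega> \<alpha>)"
  by (simp add: chi_def cis_conv_exp mult_ac)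

lemma cis_2pi_eq_1_iff: "cis (2 * pi * x) = 1 \<longleftrightarrow> x \<in> \<int>"
proof
  assume "cis (2 * pi * x) = 1"
  then have "cos (2 * pi * x) = 1" by (simp add: complex_eq_iff)
  then obtain n where "2 * pi * x = of_int n * 2 * pi" by (auto simp: cos_one_2pi_int)
  then have "x = of_int n" by simp
  then show "x \<in> \<int>" by simp
qed (rule cis_multiple_2pi)

lemma weight_norm [simp]: "cmod (weight G \<omega> a) = 1"
  by (simp add: weight_def chi_cis)

lemma weight_nonzero [simp]: "weight G \<omega> a \<noteq> 0"
  by (metis weight_norm norm_zero zero_neq_one)

lemma weight_zero [simp]: "weight G (\<lambda>e. 0) a = 1"
  by (simp add: weight_def chi_cis pairing_def)

lemma weight_add: "weight G (\<lambda>e. \<omega> e + \<omega>' e) a = weight G \<omega> a * weight G \<omega>' a"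
  by (simp add: weight_def chi_cis pairing_add cis_mult distrib_left)

lemma weight_minus: "weight G (\<lambda>e. \<omega> e - \<omega>' e) a = weight G \<omega> a / weight G \<omega>' a"
  by (simp add: weight_def chi_cis pairing_minus cis_divide right_diff_distrib)

lemma weight_uminus: "weight G (\<lambda>e. - \<omega> e) a = 1 / weight G \<omega> a"
  using weight_minus[of G "\<lambda>e. 0" \<omega> a] by simp

lemma boundary_add: "boundary G (\<lambda>e. \<alpha> e + \<beta> e) v = boundary G \<alpha> v + boundary G \<beta> v"
  by (simp add: boundary_def distrib_right sum.distrib)

lemma boundary_minus: "boundary G (\<lambda>e. \<alpha> e - \<beta> e) v = boundary G \<alpha> v - boundary G \<beta> v"
  by (simp add: boundary_def left_diff_distrib sum_subtractf)

lemma boundary_sum: "boundary G (\<lambda>e. \<Sum>i\<in>I. \<alpha> i e) v = (\<Sum>i\<in>I. boundary G (\<alpha> i) v)"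
  unfolding boundary_def sum_distrib_right by (rule sum.swap)

lemma chi_add_right: "chi G \<omega> (\<lambda>e. \<alpha> e + \<beta> e) = chi G \<omega> \<alpha> * chi G \<omega> \<beta>"
  by (simp add: chi_cis pairing_add_right distrib_left cis_mult)

lemma chi_sum: "finite I \<Longrightarrow> chi G \<omega> (\<lambda>e. \<Sum>i\<in>I. \<alpha> i e) = (\<Prod>i\<in>I. chi G \<omega> (\<alpha> i))"
  by (induction rule: finite_induct) (simp_all add: chi_add_right, simp add: chi_def pairing_def)

lemma edge_chain_Ints [simp]: "edge_chain a e \<in> \<int>"
  by (simp add: edge_chain_def)

lemma edge_chain_chains: "a \<in> oriented_edges G \<Longrightarrow> edge_chain a \<in> chains G"
  by (auto simp: chains_def edge_chain_def oriented_edges_def)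

context fin_digraph
begin

lemma weight_cis: "a \<in> oriented_edges G \<Longrightarrow> weight G \<omega> a = cis (2 * pi * edge_coeff \<omega> a)"
proof -
  assume a: "a \<in> oriented_edges G"
  have "pairing G \<omega> (edge_chain a) = (\<Sum>e\<in>arcs G. if e = fst a then edge_coeff \<omega> a else 0)"
    unfolding pairing_def by (intro sum.cong) (auto simp: edge_chain_def edge_coeff_def)
  then show ?thesis
    using a by (simp add: weight_def chi_cis oriented_edges_def mem_Times_iff)
qed

lemma weight_inv: "a \<in> oriented_edges G \<Longrightarrow> weight G \<omega> (edge_inv a) = 1 / weight G \<omega> a"
  using cis_divide[of 0 "2 * pi * edge_coeff \<omega> a"] by (simp add: weight_cis)

lemma weight_half: "a \<in> oriented_edges G \<Longrightarrow> weight G (half_form G) a = - 1"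
  by (auto simp: weight_cis edge_coeff_def half_form_def oriented_edges_def complex_eq_iff)

lemma boundary_edge_chain:
  assumes "a \<in> oriented_edges G"
  shows "boundary G (edge_chain a) v = of_bool (edge_term G a = v) - of_bool (edge_init G a = v)"
proof -
  have "boundary G (edge_chain a) v = (\<Sum>e\<in>arcs G. if e = fst a then
      (if snd a then 1 else - 1) * (of_bool (head G e = v) - of_bool (tail G e = v)) else 0)"
    unfolding boundary_def by (intro sum.cong) (auto simp: edge_chain_def)
  also have "\<dots> = of_bool (edge_term G a = v) - of_bool (edge_init G a = v)"
    using assms by (simp add: oriented_edges_def mem_Times_iff edge_term_def edge_init_def)
  finally show ?thesis .
qed

text \<open>The boundary is the negative net outflow. Each arc is counted in both orientations, at
  the start of each, so a loop cancels with itself.\<close>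

lemma boundary_conv_edges:
  "boundary G \<alpha> v = - (\<Sum>b | b \<in> oriented_edges G \<and> edge_init G b = v. edge_coeff \<alpha> b)"
proof -
  have "(\<Sum>b | b \<in> oriented_edges G \<and> edge_init G b = v. edge_coeff \<alpha> b) =
      (\<Sum>b\<in>oriented_edges G. if edge_init G b = v then edge_coeff \<alpha> b else 0)"
    by (simp add: sum.inter_filter[symmetric])
  also have "\<dots> = (\<Sum>e\<in>arcs G. - (\<alpha> e * (of_bool (head G e = v) - of_bool (tail G e = v))))"
    unfolding sum_oriented_edges by (intro sum.cong) (auto simp: edge_init_def edge_coeff_def)
  finally show ?thesis by (simp add: boundary_def sum_negf)
qed

text \<open>Conservation of flow at the end of \<open>a\<close>: the inverse of \<open>a\<close>
  leaves that vertex with a negative coefficient, so some edge leaves it with a positive one. By its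
  sign this edge is not the inverse of \<open>a\<close>.\<close>

lemma positive_edge_continues:
  assumes bd: "\<And>v. boundary G \<alpha> v = 0" and a: "a \<in> oriented_edges G" "0 < edge_coeff \<alpha> a"
  shows "\<exists>b\<in>oriented_edges G. 0 < edge_coeff \<alpha> b \<and> feeds_into G a b"
proof (rule ccontr)
  assume no: "\<not> ?thesis"
  define I where "I = {b. b \<in> oriented_edges G \<and> edge_init G b = edge_term G a}"
  have fin: "finite I" by (simp add: I_def)
  have le: "0 \<le> - edge_coeff \<alpha> b" if "b \<in> I" for b
  proof (cases "b = edge_inv a")
    case False
    then have "feeds_into G a b" using that by (auto simp: I_def feeds_into_def)
    then show ?thesis using no that by (force simp: I_def)
  qed (use a in simp)
  have "(\<Sum>b\<in>I. - edge_coeff \<alpha> b) = 0"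
    using bd[of "edge_term G a"] by (simp add: boundary_conv_edges I_def sum_negf)
  then have "\<forall>b\<in>I. - edge_coeff \<alpha> b = 0" using sum_nonneg_eq_0_iff[OF fin, of "\<lambda>b. - edge_coeff \<alpha> b"] le by blast
  moreover have "edge_inv a \<in> I" using a by (simp add: I_def)
  ultimately show False using a by fastforce
qed

text \<open>A fixed choice of positive successors is followed until it becomes periodic. The shift
  by one in the injectivity statement fits the later products, since a step of W carries the weight
  of the edge that it enters.\<close>

lemma positive_closed_walk:
  assumes bd: "\<And>v. boundary G \<alpha> v = 0" and a: "a \<in> oriented_edges G" "0 < edge_coeff \<alpha> a"
  obtains s k where "closed_walk G s k" "inj_on (\<lambda>i. s (Suc i)) {..<k}" "\<And>i. 0 < edge_coeff \<alpha> (s i)"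
proof -
  define P where "P = {a \<in> oriented_edges G. 0 < edge_coeff \<alpha> a}"
  obtain f where f: "\<And>a. a \<in> P \<Longrightarrow> f a \<in> P \<and> feeds_into G a (f a)"
    using positive_edge_continues[OF bd] unfolding P_def by (metis (mono_tags, lifting) mem_Collect_eq)
  have finP: "finite P" and aP: "a \<in> P" using a by (auto simp: P_def)
  have fP: "\<And>x. x \<in> P \<Longrightarrow> f x \<in> P" using f by blast
  obtain i x k where x: "x = (f ^^ i) a" "x \<in> P" "0 < k" "(f ^^ k) x = x" "inj_on (\<lambda>i. (f ^^ i) x) {..<k}"
    by (rule finite_periodic_point[where f = f, OF finP aP fP])
  define s where "s i = (f ^^ i) x" for i
  have s: "s i \<in> P" for i by (induction i) (use x(2) f in \<open>auto simp: s_def\<close>)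
  have per: "s (i + k) = s i" for i using x(4) by (simp add: s_def funpow_add)
  have "inj_on (\<lambda>i. s (Suc i)) {..<k}"
  proof (rule inj_onI)
    fix i j assume ij: "i \<in> {..<k}" "j \<in> {..<k}" "s (Suc i) = s (Suc j)"
    have red: "\<exists>i'<k. s (Suc i) = s i' \<and> i' = (if Suc i = k then 0 else Suc i)" if "i < k" for i
      using that per[of 0] by (intro exI[of _ "if Suc i = k then 0 else Suc i"]) auto
    obtain i' j' where "i' < k" "j' < k" "s i' = s j'"
        "i' = (if Suc i = k then 0 else Suc i)" "j' = (if Suc j = k then 0 else Suc j)"
      using red[of i] red[of j] ij by auto
    moreover from this have "i' = j'" using x(5) by (auto simp: s_def inj_on_def)
    ultimately show "i = j" by (auto split: if_splits)
  qed
  moreover have "closed_walk G s k"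
    unfolding closed_walk_def using s x(3) per f by (auto simp: P_def s_def)
  ultimately show ?thesis using that[of s k] s by (auto simp: P_def)
qed

text \<open>
  A cycle with integer coefficients is reduced by removing closed walks along edges on which it is
  positive; such a walk never backtracks.
\<close>

lemma integral_on_cyclesI:
  assumes w: "\<And>s k. closed_walk G s k \<Longrightarrow> (\<Prod>i<k. weight G \<omega> (s (Suc i))) = 1"
  shows "integral_on_cycles G \<omega>"
proof -
  have "pairing G \<omega> \<alpha> \<in> \<int>" if "\<alpha> \<in> integral_homology G" for \<alpha>
    using that
  \<comment> \<open>The sum of the absolute coefficients drops by at least 1 in each round; the
    floor turns this real number into a measure.\<close>
  proof (induction "nat \<lfloor>\<Sum>e\<in>arcs G. \<bar>\<alpha> e\<bar>\<rfloor>" arbitrary: \<alpha> rule: less_induct)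
    case (less \<alpha>)
    have int: "\<And>e. \<alpha> e \<in> \<int>" and ch: "\<alpha> \<in> chains G" and bd: "\<And>v. boundary G \<alpha> v = 0"
      using less.prems by (auto simp: integral_homology_def)
    show ?case
    proof (cases "\<forall>e\<in>arcs G. \<alpha> e = 0")
      case True
      then show ?thesis by (simp add: pairing_def)
    next
      case False
      then obtain e where e: "e \<in> arcs G" "\<alpha> e \<noteq> 0" by auto
      have "\<exists>a\<in>oriented_edges G. 0 < edge_coeff \<alpha> a"
        using e by (intro bexI[of _ "(e, 0 < \<alpha> e)"]) (auto simp: edge_coeff_def oriented_edges_def)
      then obtain s k where s: "closed_walk G s k" "inj_on (\<lambda>i. s (Suc i)) {..<k}"
          "\<And>i. 0 < edge_coeff \<alpha> (s i)"
        using positive_closed_walk[OF bd] by metis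
      have k: "0 < k" and so: "\<And>i. s i \<in> oriented_edges G" and sf: "\<And>i. feeds_into G (s i) (s (Suc i))"
        and sp: "\<And>i. s (i + k) = s i"
        using s(1) by (auto simp: closed_walk_def)
      define T where "T = (\<lambda>i. s (Suc i)) ` {..<k}"
      define \<gamma> where "\<gamma> e = (\<Sum>i<k. edge_chain (s (Suc i)) e)" for e
      \<comment> \<open>The walk repeats no edge, so each orientation of an arc is counted at most
        once.\<close>
      have \<gamma>T: "\<gamma> e = of_bool ((e, True) \<in> T) - of_bool ((e, False) \<in> T)" for e
      proof -
        have finT: "finite T" by (simp add: T_def)
        have "\<gamma> e = (\<Sum>a\<in>T. edge_chain a e)"
          unfolding T_def \<gamma>_def by (simp add: sum.reindex[OF s(2)])
        also have "\<dots> = (\<Sum>a\<in>T. of_bool (a = (e, True)) * 1 - of_bool (a = (e, False)) * 1)"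
          by (intro sum.cong) (auto simp: edge_chain_def)
        finally show ?thesis
          unfolding sum_subtractf sum_of_bool_mult(1)[OF finT] by simp
      qed
      have \<alpha>T: "1 \<le> edge_coeff \<alpha> a" if "a \<in> T" for a
      proof -
        have "0 < edge_coeff \<alpha> a" using that s(3) by (auto simp: T_def)
        moreover have "edge_coeff \<alpha> a \<in> \<int>" using int by (simp add: edge_coeff_def)
        ultimately show ?thesis by (auto elim!: Ints_cases)
      qed
      \<comment> \<open>Where \<gamma> is nonzero, \<alpha> has the same sign and absolute value at
        least 1, so subtracting \<gamma> does not overshoot.\<close>
      have abs: "\<bar>\<alpha> e - \<gamma> e\<bar> = \<bar>\<alpha> e\<bar> - \<bar>\<gamma> e\<bar>" for e
        using \<alpha>T[of "(e, True)"] \<alpha>T[of "(e, False)"] by (auto simp: \<gamma>T edge_coeff_def)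
      have "\<gamma> \<in> integral_homology G"
      proof -
        have "\<gamma> e = 0" if "e \<notin> arcs G" for e
        proof -
          have "edge_chain (s i) e = 0" for i
            using that so[of i] by (auto simp: edge_chain_def oriented_edges_def)
          then show ?thesis by (simp add: \<gamma>_def)
        qed
        moreover have "boundary G \<gamma> v = 0" for v
        proof -
          have "boundary G \<gamma> v = (\<Sum>i<k. of_bool (edge_term G (s (Suc i)) = v) - of_bool (edge_term G (s i) = v))"
            unfolding \<gamma>_def boundary_sum using so sf
            by (intro sum.cong) (auto simp: boundary_edge_chain feeds_into_def)
          also have "\<dots> = 0"
            using sp[of 0] by (subst sum_lessThan_telescope) simp
          finally show ?thesis .
        qed
        ultimately show ?thesis by (auto simp: integral_homology_def chains_def \<gamma>_def)
      qed
      then have diff: "(\<lambda>e. \<alpha> e - \<gamma> e) \<in> integral_homology G"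
        using less.prems by (auto simp: integral_homology_def chains_def boundary_minus)
      have "s (Suc 0) \<in> T" using k by (auto simp: T_def)
      define e1 where "e1 = fst (s (Suc 0))"
      have e1: "e1 \<in> arcs G" using so by (auto simp: e1_def oriented_edges_def mem_Times_iff)
      \<comment> \<open>The two orientations of \<open>e1\<close> cannot both be positive, so
        nothing cancels on this arc.\<close>
      have "1 \<le> \<bar>\<gamma> e1\<bar>"
        using \<open>s (Suc 0) \<in> T\<close> \<alpha>T[of "(e1, True)"] \<alpha>T[of "(e1, False)"]
        by (cases "s (Suc 0)"; cases "snd (s (Suc 0))") (auto simp: \<gamma>T e1_def edge_coeff_def)
      also have "\<dots> \<le> (\<Sum>e\<in>arcs G. \<bar>\<gamma> e\<bar>)" using e1 by (intro member_le_sum) auto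
      finally have "(\<Sum>e\<in>arcs G. \<bar>\<alpha> e - \<gamma> e\<bar>) \<le> (\<Sum>e\<in>arcs G. \<bar>\<alpha> e\<bar>) - 1"
        by (simp add: abs sum_subtractf)
      moreover have "0 \<le> (\<Sum>e\<in>arcs G. \<bar>\<alpha> e - \<gamma> e\<bar>)" by (simp add: sum_nonneg)
      ultimately have "nat \<lfloor>\<Sum>e\<in>arcs G. \<bar>\<alpha> e - \<gamma> e\<bar>\<rfloor> < nat \<lfloor>\<Sum>e\<in>arcs G. \<bar>\<alpha> e\<bar>\<rfloor>"
        by linarith
      from less.hyps[OF this diff] have "pairing G \<omega> \<alpha> - pairing G \<omega> \<gamma> \<in> \<int>"
        by (simp add: pairing_minus_right)
      moreover have "pairing G \<omega> \<gamma> \<in> \<int>"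
        using w[OF s(1)] chi_sum[of "{..<k}" G \<omega> "\<lambda>i. edge_chain (s (Suc i))"]
        by (simp add: weight_def \<gamma>_def[abs_def] chi_cis cis_2pi_eq_1_iff)
      ultimately show ?thesis by (metis Ints_add diff_add_cancel)
    qed
  qed
  then show ?thesis by (simp add: integral_on_cycles_def)
qed

text \<open>Write u as cis (2 pi f). On every arc \<omega> differs from the differential of f by an
  integer; differentials vanish on cycles, and integer coefficients give integer pairings.\<close>

lemma integral_on_cycles_of_potential:
  assumes u: "\<And>v. cmod (u v) = 1"
    and w: "\<And>a. a \<in> oriented_edges G \<Longrightarrow> weight G \<omega> a = u (edge_term G a) / u (edge_init G a)"
  shows "integral_on_cycles G \<omega>"
proof -
  define f where "f v = Arg (u v) / (2 * pi)" for v
  define \<psi> where "\<psi> e = (if e \<in> arcs G then f (head G e) - f (tail G e) else 0)" for e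
  have f: "cis (2 * pi * f v) = u v" for v
    using u[of v] cis_Arg[of "u v"] by (cases "u v = 0") (auto simp: f_def sgn_eq)
  have "\<omega> e - \<psi> e \<in> \<int>" if e: "e \<in> arcs G" for e
  proof -
    have a: "(e, True) \<in> oriented_edges G" using e by (simp add: oriented_edges_def)
    have "cis (2 * pi * \<omega> e) = u (head G e) / u (tail G e)"
      using w[OF a] weight_cis[OF a] by (simp add: edge_coeff_def edge_init_def edge_term_def)
    also have "\<dots> = cis (2 * pi * \<psi> e)"
      using e by (simp add: \<psi>_def f[symmetric] cis_divide right_diff_distrib)
    finally have "cis (2 * pi * (\<omega> e - \<psi> e)) = 1"
      by (simp add: right_diff_distrib cis_divide[symmetric])
    then show ?thesis by (simp add: cis_2pi_eq_1_iff)
  qed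
  then have int: "integral_on_cycles G (\<lambda>e. \<omega> e - \<psi> e)" by (rule integral_on_cycles_int_valued)
  have "\<psi> \<in> exact_forms G"
    by (auto simp: exact_forms_def one_forms_def \<psi>_def intro!: exI[of _ f])
  then have "pairing G \<psi> \<alpha> = 0" if "\<alpha> \<in> integral_homology G" for \<alpha>
    using that pairing_exact by (auto simp: integral_homology_def)
  then show ?thesis using int by (auto simp: integral_on_cycles_def pairing_minus)
qed

end

context connected_digraph
begin

lemma path_chain:
  assumes "r \<in> verts G" "v \<in> verts G"
  shows "\<exists>\<gamma>\<in>chains G. (\<forall>e. \<gamma> e \<in> \<int>) \<and> (\<forall>w. boundary G \<gamma> w = of_bool (v = w) - of_bool (r = w))"
proof -
  define H where "H = {v \<in> verts G. \<exists>\<gamma>\<in>chains G. (\<forall>e. \<gamma> e \<in> \<int>) \<and>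
    (\<forall>w. boundary G \<gamma> w = of_bool (v = w) - of_bool (r = w))}"
  have "H = verts G"
  proof (rule adjacency_closed_imp_verts)
    show "H \<subseteq> verts G" by (auto simp: H_def)
    show "r \<in> H" using assms by (auto simp: H_def chains_def boundary_def intro!: bexI[of _ "\<lambda>e. 0"])
    fix a assume a: "a \<in> oriented_edges G" "edge_init G a \<in> H"
    then obtain \<gamma> where \<gamma>: "\<gamma> \<in> chains G" "\<And>e. \<gamma> e \<in> \<int>"
        "\<And>w. boundary G \<gamma> w = of_bool (edge_init G a = w) - of_bool (r = w)"
      by (auto simp: H_def)
    have "(\<lambda>e. \<gamma> e + edge_chain a e) \<in> chains G"
      using \<gamma>(1) edge_chain_chains[OF a(1)] by (auto simp: chains_def)
    then show "edge_term G a \<in> H"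
      using a \<gamma> by (auto simp: H_def boundary_add boundary_edge_chain intro!: bexI[of _ "\<lambda>e. \<gamma> e + edge_chain a e"])
  qed
  then have "v \<in> H" using assms(2) by simp
  then show ?thesis unfolding H_def by blast
qed

text \<open>The value u v is the character of an integral chain from a base vertex to v. Going out
  to the start of \<open>a\<close>, along \<open>a\<close>, and back from its end is an integral
  cycle, which has character 1.\<close>

lemma integral_on_cycles_imp_potential:
  assumes int: "integral_on_cycles G \<omega>"
  shows "\<exists>u. (\<forall>v. cmod (u v) = 1) \<and>
    (\<forall>a\<in>oriented_edges G. weight G \<omega> a = u (edge_term G a) / u (edge_init G a))"
proof -
  obtain r where r: "r \<in> verts G" using verts_nonempty by blast
  obtain \<gamma> where \<gamma>: "\<And>v. v \<in> verts G \<Longrightarrow> \<gamma> v \<in> chains G \<and> (\<forall>e. \<gamma> v e \<in> \<int>) \<and>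
      (\<forall>w. boundary G (\<gamma> v) w = of_bool (v = w) - of_bool (r = w))"
    using path_chain[OF r] by metis
  define u where "u v = chi G \<omega> (\<gamma> v)" for v
  show ?thesis
  proof (intro exI[of _ u] conjI allI ballI)
    show "cmod (u v) = 1" for v by (simp add: u_def chi_cis)
    fix a assume a: "a \<in> oriented_edges G"
    let ?\<gamma> = "\<lambda>e. \<gamma> (edge_init G a) e + edge_chain a e - \<gamma> (edge_term G a) e"
    note \<gamma>' = \<gamma>[OF edge_init_in_verts[OF a]] \<gamma>[OF edge_term_in_verts[OF a]]
    have "?\<gamma> \<in> integral_homology G"
      using \<gamma>' edge_chain_chains[OF a]
      by (auto simp: integral_homology_def chains_def boundary_minus boundary_add boundary_edge_chain[OF a])
    then have "pairing G \<omega> ?\<gamma> \<in> \<int>" using int by (auto simp: integral_on_cycles_def)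
    then have "cis (2 * pi * pairing G \<omega> ?\<gamma>) = 1" by (simp add: cis_2pi_eq_1_iff)
    then have "u (edge_init G a) * weight G \<omega> a / u (edge_term G a) = 1"
      by (simp add: u_def weight_def chi_cis pairing_minus_right pairing_add_right right_diff_distrib
          distrib_left cis_divide cis_mult)
    then show "weight G \<omega> a = u (edge_term G a) / u (edge_init G a)"
      by (auto simp: field_simps u_def chi_cis split: if_splits)
  qed
qed

end

section \<open>Twisted matrices\<close>

definition adj_kernel :: "('a, 'b) pre_digraph \<Rightarrow> ('b \<Rightarrow> real) \<Rightarrow> 'a \<Rightarrow> 'a \<Rightarrow> complex" where
  "adj_kernel G \<omega> v w =
    (\<Sum>a | a \<in> oriented_edges G \<and> edge_init G a = v \<and> edge_term G a = w. weight G \<omega> a)"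

definition edge_kernel :: "('a, 'b) pre_digraph \<Rightarrow> ('b \<Rightarrow> real) \<Rightarrow> 'b \<times> bool \<Rightarrow> 'b \<times> bool \<Rightarrow> complex" where
  "edge_kernel G \<omega> a b = (if feeds_into G a b then weight G \<omega> b else 0)"

lemma twisted_adj_conv: "twisted_adj G vs \<omega> = kernel_mat vs (adj_kernel G \<omega>)"
  by (rule eq_matI) (auto simp: twisted_adj_def adj_kernel_def weight_def)

lemma twisted_edge_adj_conv: "twisted_edge_adj G es \<omega> = kernel_mat es (edge_kernel G \<omega>)"
  by (rule eq_matI) (auto simp: twisted_edge_adj_def edge_kernel_def weight_def)

lemma mat_trace_kernel_pow:
  "distinct xs \<Longrightarrow> mat_trace (kernel_mat xs K ^\<^sub>m k) = (\<Sum>a\<in>set xs. kernel_pow (set xs) K k a a)"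
  by (simp add: kernel_mat_pow mat_trace_def sum_nth[symmetric])

text \<open>An entry of a power is a sum over walks. Once the walk \<open>s\<close> is removed on
  both sides, the remaining walks still dominate each other; this sharpens the entrywise bound by
  the contribution of \<open>s\<close>.\<close>

lemma kernel_pow_walk_bound:
  fixes K :: "'c \<Rightarrow> 'c \<Rightarrow> complex" and B :: "'c \<Rightarrow> 'c \<Rightarrow> real"
  assumes S: "finite S" and K: "\<And>a b. a \<in> S \<Longrightarrow> b \<in> S \<Longrightarrow> cmod (K a b) \<le> B a b"
    and s: "\<And>i. s i \<in> S"
  shows "cmod (kernel_pow S K k (s 0) (s k) - (\<Prod>i<k. K (s i) (s (Suc i))))
    \<le> kernel_pow S B k (s 0) (s k) - (\<Prod>i<k. B (s i) (s (Suc i)))"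
proof (induction k)
  case (Suc k)
  let ?a = "s 0" and ?c = "s k" and ?b = "s (Suc k)"
  let ?PK = "\<Prod>i<k. K (s i) (s (Suc i))" and ?PB = "\<Prod>i<k. B (s i) (s (Suc i))"
  \<comment> \<open>The walks whose last label but one differs from \<open>s k\<close>; the others
    either are \<open>s\<close> or deviate from it earlier.\<close>
  let ?RK = "\<Sum>c\<in>S - {?c}. kernel_pow S K k ?a c * K c ?b"
  let ?RB = "\<Sum>c\<in>S - {?c}. kernel_pow S B k ?a c * B c ?b"
  have nle: "cmod (kernel_pow S K k ?a c) \<le> kernel_pow S B k ?a c" if "c \<in> S" for c
    by (rule kernel_pow_norm_le[OF S K that])
  have nB: "0 \<le> kernel_pow S B k ?a c" if "c \<in> S" for c
    using nle[OF that] norm_ge_zero order.trans by blast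
  have "cmod ?RK \<le> (\<Sum>c\<in>S - {?c}. cmod (kernel_pow S K k ?a c) * cmod (K c ?b))"
    by (auto intro!: order.trans[OF norm_sum] simp: norm_mult)
  also have "\<dots> \<le> ?RB"
    using nle K s nB by (intro sum_mono mult_mono) auto
  finally have R: "cmod ?RK \<le> ?RB" .
  have P: "cmod ((kernel_pow S K k ?a ?c - ?PK) * K ?c ?b) \<le> (kernel_pow S B k ?a ?c - ?PB) * B ?c ?b"
    unfolding norm_mult using Suc.IH K s order.trans[OF norm_ge_zero Suc.IH] by (intro mult_mono) auto
  have EK: "kernel_pow S K (Suc k) ?a ?b - (\<Prod>i<Suc k. K (s i) (s (Suc i))) =
      (kernel_pow S K k ?a ?c - ?PK) * K ?c ?b + ?RK"
    using sum.remove[OF S s[of k], of "\<lambda>c. kernel_pow S K k ?a c * K c ?b"]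
    by (simp add: left_diff_distrib)
  have EB: "kernel_pow S B (Suc k) ?a ?b - (\<Prod>i<Suc k. B (s i) (s (Suc i))) =
      (kernel_pow S B k ?a ?c - ?PB) * B ?c ?b + ?RB"
    using sum.remove[OF S s[of k], of "\<lambda>c. kernel_pow S B k ?a c * B c ?b"]
    by (simp add: left_diff_distrib)
  show ?case unfolding EK EB by (rule norm_triangle_mono[OF P R])
qed simp

context fin_digraph
begin

lemma edge_kernel_zero: "edge_kernel G (\<lambda>e. 0) a b = of_real (of_bool (feeds_into G a b))"
  by (simp add: edge_kernel_def)

lemma adj_kernel_zero: "adj_kernel G (\<lambda>e. 0) v w =
    of_real (real (card {a. a \<in> oriented_edges G \<and> edge_init G a = v \<and> edge_term G a = w}))"
  by (simp add: adj_kernel_def)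

lemma edge_kernel_norm: "cmod (edge_kernel G \<omega> a b) = of_bool (feeds_into G a b)"
  by (simp add: edge_kernel_def)

lemma adj_kernel_norm: "cmod (adj_kernel G \<omega> v w) \<le>
    real (card {a. a \<in> oriented_edges G \<and> edge_init G a = v \<and> edge_term G a = w})"
  unfolding adj_kernel_def by (rule order.trans[OF norm_sum]) simp

lemma spectral_radius_twisted_adj_le:
  "distinct vs \<Longrightarrow> spectral_radius (twisted_adj G vs \<omega>) \<le> spectral_radius (twisted_adj G vs (\<lambda>e. 0))"
  unfolding twisted_adj_conv adj_kernel_zero[abs_def]
  by (rule kernel_mat_spectral_radius_mono) (auto intro: adj_kernel_norm)

lemma spectral_radius_twisted_edge_adj_le:
  "distinct es \<Longrightarrow> spectral_radius (twisted_edge_adj G es \<omega>) \<le> spectral_radius (twisted_edge_adj G es (\<lambda>e. 0))"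
  unfolding twisted_edge_adj_conv edge_kernel_zero[abs_def]
  by (rule kernel_mat_spectral_radius_mono) (auto simp: edge_kernel_norm)

lemma similar_twisted_adj_gauge:
  assumes "distinct vs" and u: "\<And>v. u v \<noteq> 0"
    and w: "\<And>a. a \<in> oriented_edges G \<Longrightarrow> weight G \<omega>' a = - weight G \<omega> a * u (edge_term G a) / u (edge_init G a)"
  shows "similar_mat (twisted_adj G vs \<omega>') (- twisted_adj G vs \<omega>)"
  unfolding twisted_adj_conv kernel_mat_uminus
proof (rule similar_kernel_mat_scale[OF assms(1), of u])
  fix x y
  show "adj_kernel G \<omega>' x y = - adj_kernel G \<omega> x y * u y / u x"
    unfolding adj_kernel_def sum_negf[symmetric] sum_distrib_right sum_divide_distrib
    using w by (intro sum.cong) auto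
qed (rule u)

lemma similar_twisted_edge_adj_gauge:
  assumes "distinct es" "set es = oriented_edges G" and u: "\<And>v. u v \<noteq> 0"
    and w: "\<And>a. a \<in> oriented_edges G \<Longrightarrow> weight G \<omega>' a = - weight G \<omega> a * u (edge_term G a) / u (edge_init G a)"
  shows "similar_mat (twisted_edge_adj G es \<omega>') (- twisted_edge_adj G es \<omega>)"
  unfolding twisted_edge_adj_conv kernel_mat_uminus
\<comment> \<open>The scaling sits at the end of an edge. If \<open>a\<close> feeds into
  \<open>b\<close>, this end is the start of \<open>b\<close>, and the ratio of the two factors is
  the coboundary of u on \<open>b\<close>.\<close>
proof (rule similar_kernel_mat_scale[OF assms(1), of "\<lambda>a. u (edge_term G a)"])
  fix a b assume "a \<in> set es" "b \<in> set es"
  then show "edge_kernel G \<omega>' a b = - edge_kernel G \<omega> a b * u (edge_term G b) / u (edge_term G a)"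
    using w[of b] assms(2) by (auto simp: edge_kernel_def) (simp add: feeds_into_def)
qed (rule u)

lemma twisted_adj_uminus: "twisted_adj G vs (\<lambda>e. - \<omega> e) = transpose_mat (twisted_adj G vs \<omega>)"
proof -
  have "adj_kernel G (\<lambda>e. - \<omega> e) v w = adj_kernel G \<omega> w v" for v w
    unfolding adj_kernel_def
    by (rule sum.reindex_bij_witness[of _ edge_inv edge_inv]) (auto simp: weight_inv weight_uminus)
  then show ?thesis
    unfolding twisted_adj_conv kernel_mat_transpose by (intro kernel_mat_cong)
qed

text \<open>Inverting edges reverses the feeding relation and transposition restores it. This puts
  the weight on the edge that is left instead of the one that is entered; a diagonal rescaling by
  weights moves it across.\<close>

lemma similar_twisted_edge_adj_uminus:
  assumes es: "distinct es" "set es = oriented_edges G"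
  shows "similar_mat (twisted_edge_adj G es (\<lambda>e. - \<omega> e)) (twisted_edge_adj G es \<omega>)"
proof -
  let ?T = "\<lambda>a b. edge_kernel G \<omega> b a"
  have 1: "similar_mat (kernel_mat es (edge_kernel G (\<lambda>e. - \<omega> e))) (kernel_mat es (\<lambda>a b. ?T (edge_inv a) (edge_inv b)))"
  proof (rule similar_kernel_mat_scale[OF es(1), of "\<lambda>a. 1 / weight G \<omega> a"])
    fix a b assume "a \<in> set es" "b \<in> set es"
    then show "edge_kernel G (\<lambda>e. - \<omega> e) a b =
        ?T (edge_inv a) (edge_inv b) * (1 / weight G \<omega> b) / (1 / weight G \<omega> a)"
      using es(2) by (simp add: edge_kernel_def weight_inv weight_uminus)
  qed simp
  have 2: "similar_mat (kernel_mat es (\<lambda>a b. ?T (edge_inv a) (edge_inv b))) (kernel_mat es ?T)"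
    by (rule similar_kernel_mat_involution[OF es(1)]) (use es(2) in auto)
  have 3: "similar_mat (kernel_mat es ?T) (kernel_mat es (edge_kernel G \<omega>))"
    using similar_transpose[of "kernel_mat es (edge_kernel G \<omega>)" "length es"] by (simp add: kernel_mat_transpose)
  show ?thesis
    unfolding twisted_edge_adj_conv by (rule similar_mat_trans[OF similar_mat_trans[OF 1 2] 3])
qed

end

section \<open>Negated spectra and the class of the half form\<close>

context connected_digraph
begin

text \<open>By hypothesis \<omega>' has the weights of the half form minus \<omega>, up to a
  coboundary. Gauging therefore gives the negated matrix of -\<omega>, and a transposition leads
  from -\<omega> to \<omega>.\<close>

lemma negated_of_half_sum:
  assumes vs: "distinct vs" and es: "distinct es" "set es = oriented_edges G"
    and int: "integral_on_cycles G (\<lambda>e. \<omega> e + \<omega>' e - half_form G e)"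
  shows "similar_mat (twisted_adj G vs \<omega>') (- twisted_adj G vs \<omega>)"
    and "similar_mat (twisted_edge_adj G es \<omega>') (- twisted_edge_adj G es \<omega>)"
proof -
  obtain u where u: "\<And>v. cmod (u v) = 1"
    "\<And>a. a \<in> oriented_edges G \<Longrightarrow> weight G (\<lambda>e. \<omega> e + \<omega>' e - half_form G e) a = u (edge_term G a) / u (edge_init G a)"
    using integral_on_cycles_imp_potential[OF int] by blast
  have u0: "u v \<noteq> 0" for v using u(1)[of v] by auto
  have w: "weight G \<omega>' a = - weight G (\<lambda>e. - \<omega> e) a * u (edge_term G a) / u (edge_init G a)"
    if "a \<in> oriented_edges G" for a
  proof -
    have "weight G \<omega> a * weight G \<omega>' a / - 1 = u (edge_term G a) / u (edge_init G a)"
      using u(2)[OF that] by (simp only: weight_minus weight_add weight_half[OF that])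
    moreover have "weight G \<omega>' a = - (1 / weight G \<omega> a) * (weight G \<omega> a * weight G \<omega>' a / - 1)" by simp
    ultimately show ?thesis by (simp only: weight_uminus times_divide_eq_right)
  qed
  have "similar_mat (twisted_adj G vs \<omega>') (- transpose_mat (twisted_adj G vs \<omega>))"
    using similar_twisted_adj_gauge[OF vs u0 w] by (simp add: twisted_adj_uminus)
  moreover have "similar_mat (- transpose_mat (twisted_adj G vs \<omega>)) (- twisted_adj G vs \<omega>)"
    by (intro similar_uminus similar_transpose[of _ "length vs"]) (simp add: twisted_adj_conv)
  ultimately show "similar_mat (twisted_adj G vs \<omega>') (- twisted_adj G vs \<omega>)"
    by (rule similar_mat_trans)
  show "similar_mat (twisted_edge_adj G es \<omega>') (- twisted_edge_adj G es \<omega>)"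
    using similar_twisted_edge_adj_gauge[OF es u0 w] similar_uminus[OF similar_twisted_edge_adj_uminus[OF es]]
    by (rule similar_mat_trans)
qed

text \<open>With T closed walks of length k, counted with their starting edges, T weights of modulus
  1 add up to (-1)^k T. All walks except \<open>s\<close> contribute at most T - 1 in modulus, which
  determines the weight of \<open>s\<close>.\<close>

lemma spec_negated_closed_walk:
  assumes es: "distinct es" "set es = oriented_edges G"
    and neg: "spec_negated (twisted_edge_adj G es \<omega>) (twisted_edge_adj G es (\<lambda>e. 0))"
    and s: "closed_walk G s k"
  shows "(\<Prod>i<k. weight G \<omega> (s (Suc i))) = (- 1) ^ k"
proof -
  let ?S = "oriented_edges G" and ?B = "\<lambda>a b. of_bool (feeds_into G a b) :: real"
  define T where "T = (\<Sum>a\<in>?S. kernel_pow ?S ?B k a a)"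
  define p where "p = (\<Prod>i<k. weight G \<omega> (s (Suc i)))"
  have so: "s i \<in> ?S" and sf: "feeds_into G (s i) (s (Suc i))" for i using s by (auto simp: closed_walk_def)
  have "s k = s 0" using s by (auto simp: closed_walk_def dest: spec[of _ 0])
  have "(\<Prod>i<k. edge_kernel G \<omega> (s i) (s (Suc i))) = p" by (simp add: p_def edge_kernel_def sf)
  then have walk: "cmod (kernel_pow ?S (edge_kernel G \<omega>) k (s 0) (s 0) - p) \<le> kernel_pow ?S ?B k (s 0) (s 0) - 1"
    using kernel_pow_walk_bound[of ?S "edge_kernel G \<omega>" ?B s k] so \<open>s k = s 0\<close>
    by (simp add: edge_kernel_norm sf)
  let ?R = "\<Sum>a\<in>?S - {s 0}. kernel_pow ?S (edge_kernel G \<omega>) k a a"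
  have rest: "cmod ?R \<le> (\<Sum>a\<in>?S - {s 0}. kernel_pow ?S ?B k a a)"
    by (rule order.trans[OF norm_sum]) (auto intro!: sum_mono kernel_pow_norm_le simp: edge_kernel_norm)
  have "(\<Sum>a\<in>?S. kernel_pow ?S (edge_kernel G \<omega>) k a a) - p =
      (kernel_pow ?S (edge_kernel G \<omega>) k (s 0) (s 0) - p) + ?R"
    by (simp add: sum.remove[OF finite_oriented_edges so[of 0]])
  then have "cmod ((\<Sum>a\<in>?S. kernel_pow ?S (edge_kernel G \<omega>) k a a) - p) \<le>
      (kernel_pow ?S ?B k (s 0) (s 0) - 1) + (\<Sum>a\<in>?S - {s 0}. kernel_pow ?S ?B k a a)"
    by (simp only:) (rule norm_triangle_mono[OF walk rest])
  also have "\<dots> = T - 1" by (simp add: T_def sum.remove[OF finite_oriented_edges so[of 0]])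
  also have "(\<Sum>a\<in>?S. kernel_pow ?S (edge_kernel G \<omega>) k a a) = (- 1) ^ k * of_real T"
    using spec_negated_trace_pow[OF _ _ neg, of "length es" k]
    by (simp add: twisted_edge_adj_conv mat_trace_kernel_pow[OF es(1)] es(2) edge_kernel_zero[abs_def] kernel_pow_of_real T_def)
  finally have le: "cmod ((- 1) ^ k * of_real T - p) \<le> T - 1" .
  \<comment> \<open>With the sign divided out, |T - q| \<le> T - 1 forces Re q \<ge> 1, and |q| = 1
    leaves only q = 1.\<close>
  define q where "q = (- 1) ^ k * p"
  have q: "(- 1) ^ k * q = p" by (simp add: q_def)
  have "cmod p = 1" by (simp add: p_def prod_norm[symmetric])
  then have "cmod q = 1" by (simp add: q_def norm_mult norm_power)
  have "(- 1) ^ k * of_real T - p = (- 1) ^ k * (of_real T - q)" by (simp add: q right_diff_distrib)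
  then have "cmod (of_real T - q) \<le> T - 1" using le by (simp add: norm_mult norm_power)
  then have "1 \<le> Re q" using complex_Re_le_cmod[of "of_real T - q"] by simp
  then have "Re q = 1" using complex_Re_le_cmod[of q] \<open>cmod q = 1\<close> by simp
  moreover have "Im q = 0" using \<open>cmod q = 1\<close> \<open>Re q = 1\<close> cmod_power2[of q] by simp
  ultimately have "q = 1" by (simp add: complex_eq_iff)
  then show ?thesis using q by (simp add: p_def)
qed

lemma spec_negated_imp_half:
  assumes "distinct es" "set es = oriented_edges G"
    and "spec_negated (twisted_edge_adj G es \<omega>) (twisted_edge_adj G es (\<lambda>e. 0))"
  shows "integral_on_cycles G (\<lambda>e. \<omega> e - half_form G e)"
proof (rule integral_on_cyclesI)
  fix s k assume s: "closed_walk G s k"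
  then have so: "s i \<in> oriented_edges G" for i by (auto simp: closed_walk_def)
  have "(\<Prod>i<k. weight G (\<lambda>e. \<omega> e - half_form G e) (s (Suc i))) =
      (\<Prod>i<k. (- 1) * weight G \<omega> (s (Suc i)))"
    by (simp add: weight_minus weight_half so)
  also have "\<dots> = (- 1) ^ k * (\<Prod>i<k. weight G \<omega> (s (Suc i)))"
    by (simp only: prod.distrib prod_constant card_lessThan)
  finally show "(\<Prod>i<k. weight G (\<lambda>e. \<omega> e - half_form G e) (s (Suc i))) = 1"
    by (simp add: spec_negated_closed_walk[OF assms s])
qed

text \<open>A 2-colouring is a potential with ratio -1 along every edge. Conversely, such a
  potential has antipodal values at adjacent vertices, and \<open>pos\<close> selects one point from
  each antipodal pair of the unit circle.\<close>

lemma integral_half_iff_bipartite: "integral_on_cycles G (half_form G) \<longleftrightarrow> bipartite G"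
proof
  assume "bipartite G"
  then obtain X Y where XY: "X \<union> Y = verts G" "X \<inter> Y = {}"
    "\<And>e. e \<in> arcs G \<Longrightarrow> (tail G e \<in> X \<and> head G e \<in> Y) \<or> (tail G e \<in> Y \<and> head G e \<in> X)"
    by (auto simp: bipartite_def)
  define u :: "'a \<Rightarrow> complex" where "u v = (if v \<in> X then 1 else - 1)" for v
  show "integral_on_cycles G (half_form G)"
  proof (rule integral_on_cycles_of_potential[of u])
    fix a assume a: "a \<in> oriented_edges G"
    then show "weight G (half_form G) a = u (edge_term G a) / u (edge_init G a)"
      using XY(3)[of "fst a"] XY(2)
      by (auto simp: weight_half u_def oriented_edges_def mem_Times_iff edge_init_def edge_term_def)
  qed (simp add: u_def)
next
  assume "integral_on_cycles G (half_form G)"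
  then obtain u where u: "\<And>v. cmod (u v) = 1"
    "\<And>a. a \<in> oriented_edges G \<Longrightarrow> weight G (half_form G) a = u (edge_term G a) / u (edge_init G a)"
    using integral_on_cycles_imp_potential by blast
  define pos where "pos z \<longleftrightarrow> 0 < Re z \<or> (Re z = 0 \<and> 0 < Im z)" for z
  have pos: "pos (- z) \<longleftrightarrow> \<not> pos z" if "cmod z = 1" for z
  proof -
    have "z \<noteq> 0" using that by auto
    then show ?thesis by (auto simp: pos_def complex_eq_iff)
  qed
  have "u (head G e) = - u (tail G e)" if "e \<in> arcs G" for e
  proof -
    have "(e, True) \<in> oriented_edges G" using that by (simp add: oriented_edges_def)
    from u(2)[OF this] weight_half[OF this] have "u (head G e) / u (tail G e) = - 1"
      by (simp add: edge_init_def edge_term_def)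
    moreover have "u (tail G e) \<noteq> 0" using u(1)[of "tail G e"] by auto
    ultimately show ?thesis by (simp add: divide_eq_eq)
  qed
  then show "bipartite G"
    unfolding bipartite_def using pos[OF u(1)]
    by (intro exI[of _ "{v \<in> verts G. pos (u v)}"] exI[of _ "{v \<in> verts G. \<not> pos (u v)}"]) auto
qed

end

section \<open>Extremal spectral radius\<close>

text \<open>Here \<rho> belongs to the whole matrix and the invariance to the subset
  \<open>C\<close>: walks inside \<open>C\<close> are among all walks and grow no faster.\<close>

lemma irreducible_subinvariant_spectral:
  fixes B :: "'c \<Rightarrow> 'c \<Rightarrow> real"
  assumes xs: "distinct xs" and C: "C \<subseteq> set xs" and B: "\<And>a b. 0 \<le> B a b"
    and irr: "\<And>a b. a \<in> C \<Longrightarrow> b \<in> C \<Longrightarrow> (a, b) \<in> {(a, b). a \<in> C \<and> b \<in> C \<and> 0 < B a b}\<^sup>*"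
    and \<rho>: "\<rho> = spectral_radius (kernel_mat xs (\<lambda>a b. of_real (B a b)))"
    and z: "\<And>a. 0 \<le> z a" "a0 \<in> C" "0 < z a0"
    and sub: "\<And>a. a \<in> C \<Longrightarrow> \<rho> * z a \<le> (\<Sum>b\<in>C. B a b * z b)"
    and a: "a \<in> C"
  shows "0 < z a \<and> (\<Sum>b\<in>C. B a b * z b) = \<rho> * z a"
proof (rule irreducible_subinvariant[OF _ B irr _ _ z sub a])
  have ne: "xs \<noteq> []" using C a by auto
  show "finite C" using C finite_subset by blast
  show "0 \<le> \<rho>" unfolding \<rho> by (rule kernel_mat_spectral_radius_nonneg[OF xs ne])
  fix r assume "\<rho> < r"
  then obtain D where D: "\<And>k a b. a \<in> set xs \<Longrightarrow> b \<in> set xs \<Longrightarrow>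
      cmod (kernel_pow (set xs) (\<lambda>a b. of_real (B a b)) k a b) \<le> D * r ^ k"
    unfolding \<rho> using kernel_pow_growth[OF xs ne] by blast
  have "kernel_pow C B k a b \<le> D * r ^ k" if "a \<in> C" "b \<in> C" for k a b
  proof -
    have "kernel_pow C B k a b \<le> kernel_pow (set xs) B k a b"
      using kernel_pow_mono_set[of "set xs" C B] C B by auto
    also have "\<dots> \<le> D * r ^ k"
    proof -
      have "a \<in> set xs" "b \<in> set xs" using that C by auto
      from D[OF this, of k] show ?thesis by (simp add: kernel_pow_of_real)
    qed
    finally show ?thesis .
  qed
  then show "\<exists>D. \<forall>k. \<forall>a\<in>C. \<forall>b\<in>C. kernel_pow C B k a b \<le> D * r ^ k" by blast
qed

lemma aligned_phase:
  fixes l x y w :: complex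
  assumes "(w * y) * of_real (cmod (l * x)) = of_real (cmod (w * y)) * (l * x)"
    and "cmod w = 1" "x \<noteq> 0" "y \<noteq> 0" "l \<noteq> 0"
  shows "w * sgn y = sgn l * sgn x"
  using assms by (simp add: sgn_eq norm_mult field_simps)

context fin_digraph
begin

lemma sum_group_term:
  fixes f :: "_ \<Rightarrow> 'k::comm_ring_1"
  shows "(\<Sum>w\<in>verts G. (\<Sum>a | a \<in> oriented_edges G \<and> edge_init G a = v \<and> edge_term G a = w. f a) * g w) =
    (\<Sum>a | a \<in> oriented_edges G \<and> edge_init G a = v. f a * g (edge_term G a))"
proof -
  let ?I = "{a. a \<in> oriented_edges G \<and> edge_init G a = v}"
  have "(\<Sum>a\<in>?I. f a * g (edge_term G a)) =
      (\<Sum>w\<in>verts G. \<Sum>a\<in>{a \<in> ?I. edge_term G a = w}. f a * g (edge_term G a))"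
    by (rule sum.group[symmetric]) auto
  also have "\<dots> = (\<Sum>w\<in>verts G. (\<Sum>a | a \<in> oriented_edges G \<and> edge_init G a = v \<and> edge_term G a = w. f a) * g w)"
    unfolding sum_distrib_right by (intro sum.cong) auto
  finally show ?thesis by simp
qed

lemma closed_walk_recurrent:
  assumes s: "closed_walk G s k"
  shows "s i \<in> recurrent_edges G"
proof -
  have F: "(s j, s (Suc j)) \<in> feeds_rel G" for j using s by (auto simp: closed_walk_def feeds_rel_def)
  have path: "(s i, s (Suc (i + j))) \<in> (feeds_rel G)\<^sup>+" for j
    by (induction j) (use F in \<open>auto intro: trancl_into_trancl\<close>)
  have "0 < k" "s (i + k) = s i" using s by (auto simp: closed_walk_def)
  then show ?thesis using path[of "k - 1"] by (simp add: recurrent_edges_def)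
qed

lemma closed_walk_multiple:
  assumes "closed_walk G s k"
  shows "s (j * k) = s 0"
proof (induction j)
  case (Suc j)
  have "s (j * k + k) = s (j * k)" using assms by (auto simp: closed_walk_def)
  then show ?case using Suc by (simp add: add.commute)
qed simp

text \<open>Weights sit on the edges entered and eigenvector phases also on those left; around a
  closed walk both products agree.\<close>

lemma closed_walk_prod_shift:
  fixes f :: "_ \<Rightarrow> complex"
  assumes "closed_walk G s k"
  shows "(\<Prod>i<k. f (s (Suc i))) = (\<Prod>i<k. f (s i))"
proof -
  obtain m where m: "k = Suc m" using assms by (cases k) (auto simp: closed_walk_def)
  have "s k = s 0" using closed_walk_multiple[OF assms, of 1] by simp
  then have "(\<Prod>i<k. f (s (Suc i))) = f (s 0) * (\<Prod>i<m. f (s (Suc i)))" by (simp add: m mult.commute)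
  also have "\<dots> = (\<Prod>i<k. f (s i))" unfolding m by (rule prod.lessThan_Suc_shift[symmetric])
  finally show ?thesis .
qed

lemma closed_walk_spectral_radius_ge_1:
  assumes es: "distinct es" "set es = oriented_edges G" and s: "closed_walk G s k"
  shows "1 \<le> spectral_radius (twisted_edge_adj G es (\<lambda>e. 0))"
  unfolding twisted_edge_adj_conv edge_kernel_zero[abs_def]
proof (rule spectral_radius_ge_1[OF es(1), of "s 0" k])
  let ?B = "\<lambda>a b. of_bool (feeds_into G a b) :: real"
  have so: "s i \<in> oriented_edges G" and sf: "feeds_into G (s i) (s (Suc i))" for i
    using s by (auto simp: closed_walk_def)
  show "s 0 \<in> set es" "0 < k" using s es so by (auto simp: closed_walk_def)
  fix j
  \<comment> \<open>The walk bound against the zero kernel says that the count is at least the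
    contribution of \<open>s\<close> alone, which is 1.\<close>
  have "0 \<le> kernel_pow (set es) ?B (j * k) (s 0) (s (j * k)) - (\<Prod>i<j * k. ?B (s i) (s (Suc i)))"
    using kernel_pow_walk_bound[of "set es" "\<lambda>a b. 0" ?B s "j * k"] so es
    by (intro order.trans[OF norm_ge_zero]) auto
  then have "1 \<le> kernel_pow (set es) ?B (j * k) (s 0) (s 0)"
    by (simp add: sf closed_walk_multiple[OF s])
  then show "1 \<le> cmod (kernel_pow (set es) (\<lambda>a b. complex_of_real (?B a b)) (j * k) (s 0) (s 0))"
    unfolding kernel_pow_of_real norm_of_real by linarith
qed

end

section \<open>Equality of spectral radii\<close>

context connected_digraph
begin

text \<open>The moduli of an extremal eigenvector are subinvariant for the untwisted kernel, hence
  positive and invariant, so the triangle inequality is an equality at each vertex. The phases then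
  write the weight as c times a coboundary, where c is the phase of the eigenvalue.\<close>

lemma adj_extremal:
  assumes vs: "distinct vs" "set vs = verts G"
    and eq: "spectral_radius (twisted_adj G vs \<omega>) = spectral_radius (twisted_adj G vs (\<lambda>e. 0))"
  shows "integral_on_cycles G \<omega> \<or> integral_on_cycles G (\<lambda>e. \<omega> e - half_form G e)"
\<comment> \<open>Without arcs the eigenvalue is 0 and has no phase, but then every form is integral
  on cycles.\<close>
proof (cases "arcs G = {}")
  case True
  then show ?thesis using integral_on_cycles_int_valued[of \<omega>] by auto
next
  case False
  then obtain e where e: "e \<in> arcs G" by blast
  have ne: "vs \<noteq> []" using vs(2) verts_nonempty by auto
  define B where "B v w = real (card {a. a \<in> oriented_edges G \<and> edge_init G a = v \<and> edge_term G a = w})" for v w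
  define \<rho> where "\<rho> = spectral_radius (kernel_mat vs (\<lambda>a b. of_real (B a b)))"
  obtain l x where l: "cmod l = spectral_radius (kernel_mat vs (adj_kernel G \<omega>))"
    and x0: "\<exists>v\<in>set vs. x v \<noteq> 0"
    and x: "\<And>v. v \<in> set vs \<Longrightarrow> (\<Sum>w\<in>set vs. adj_kernel G \<omega> v w * x w) = l * x v"
    using kernel_mat_spectral_radius_attained[OF vs(1) ne] by blast
  have l\<rho>: "cmod l = \<rho>"
    using l eq by (simp add: \<rho>_def B_def twisted_adj_conv adj_kernel_zero[abs_def])
  have outB: "(\<Sum>w\<in>verts G. B v w * cmod (x w)) =
      (\<Sum>a | a \<in> oriented_edges G \<and> edge_init G a = v. cmod (x (edge_term G a)))" for v
    using sum_group_term[where v = v and f = "\<lambda>a. 1" and g = "\<lambda>w. cmod (x w)"] by (simp add: B_def)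
  have outK: "(\<Sum>a | a \<in> oriented_edges G \<and> edge_init G a = v. weight G \<omega> a * x (edge_term G a)) = l * x v"
    if "v \<in> verts G" for v
    using sum_group_term[where v = v and f = "weight G \<omega>" and g = x] x[of v] that vs by (simp add: adj_kernel_def)
  obtain v0 where v0: "v0 \<in> verts G" "x v0 \<noteq> 0" using x0 vs by auto
  have pf: "0 < cmod (x v) \<and> (\<Sum>w\<in>verts G. B v w * cmod (x w)) = \<rho> * cmod (x v)" if v: "v \<in> verts G" for v
  proof (rule irreducible_subinvariant_spectral[OF vs(1) _ _ _ \<rho>_def _ v0(1) _ _ v])
    fix v w assume vw: "v \<in> verts G" "w \<in> verts G"
    let ?E = "{(v, w). v \<in> verts G \<and> w \<in> verts G \<and> 0 < B v w}"
    have "{w \<in> verts G. (v, w) \<in> ?E\<^sup>*} = verts G"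
    proof (rule adjacency_closed_imp_verts[of _ v])
      fix a assume a: "a \<in> oriented_edges G" "edge_init G a \<in> {w \<in> verts G. (v, w) \<in> ?E\<^sup>*}"
      have "0 < B (edge_init G a) (edge_term G a)"
      proof -
        let ?A = "{b. b \<in> oriented_edges G \<and> edge_init G b = edge_init G a \<and> edge_term G b = edge_term G a}"
        have "a \<in> ?A" using a by simp
        then have "?A \<noteq> {}" by blast
        moreover have "finite ?A" by simp
        ultimately show ?thesis unfolding B_def by (simp only: of_nat_0_less_iff card_gt_0_iff) simp
      qed
      then have "(edge_init G a, edge_term G a) \<in> ?E" using a by simp
      then show "edge_term G a \<in> {w \<in> verts G. (v, w) \<in> ?E\<^sup>*}"
        using a by (simp add: rtrancl.rtrancl_into_rtrancl)
    qed (use vw in auto)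
    then show "(v, w) \<in> ?E\<^sup>*" using vw by blast
  next
    fix v assume v: "v \<in> verts G"
    have "\<rho> * cmod (x v) = cmod (l * x v)" by (simp add: norm_mult l\<rho>)
    also have "\<dots> \<le> (\<Sum>a | a \<in> oriented_edges G \<and> edge_init G a = v. cmod (x (edge_term G a)))"
      unfolding outK[OF v, symmetric] by (rule order.trans[OF norm_sum]) (simp add: norm_mult)
    finally show "\<rho> * cmod (x v) \<le> (\<Sum>w\<in>verts G. B v w * cmod (x w))" by (simp add: outB)
  qed (use vs v0 in \<open>auto simp: B_def\<close>)
  have xn: "x v \<noteq> 0" if "v \<in> verts G" for v using pf[OF that] by auto
  \<comment> \<open>Eigenvalue 0 would make x vanish at every neighbour of an end of
    \<open>e\<close>.\<close>
  have l0: "l \<noteq> 0"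
  proof
    assume "l = 0"
    then have "(\<Sum>a | a \<in> oriented_edges G \<and> edge_init G a = tail G e. cmod (x (edge_term G a))) = 0"
      using pf[of "tail G e"] e l\<rho> by (simp add: outB)
    moreover have "(e, True) \<in> oriented_edges G" "edge_init G (e, True) = tail G e"
      using e by (auto simp: oriented_edges_def edge_init_def)
    ultimately have "cmod (x (edge_term G (e, True))) = 0"
      by (subst (asm) sum_nonneg_eq_0_iff) auto
    then show False using xn[of "edge_term G (e, True)"] \<open>(e, True) \<in> oriented_edges G\<close> by simp
  qed
  define c where "c = sgn l"
  define u where "u v = (if v \<in> verts G then 1 / sgn (x v) else 1)" for v
  have u: "cmod (u v) = 1" for v using xn[of v] by (simp add: u_def norm_divide norm_sgn)
  have w: "weight G \<omega> a = c * (u (edge_term G a) / u (edge_init G a))" if a: "a \<in> oriented_edges G" for a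
  proof -
    let ?v = "edge_init G a" and ?w = "edge_term G a"
    let ?I = "{b. b \<in> oriented_edges G \<and> edge_init G b = ?v}"
    let ?t = "\<lambda>b. weight G \<omega> b * x (edge_term G b)"
    have vw: "?v \<in> verts G" "?w \<in> verts G" using a by auto
    have "cmod (sum ?t ?I) = (\<Sum>b\<in>?I. cmod (?t b))"
      using pf[OF vw(1)] by (simp add: outK[OF vw(1)] outB norm_mult l\<rho>)
    then have "?t a * of_real (cmod (sum ?t ?I)) = of_real (cmod (?t a)) * sum ?t ?I"
      using a by (intro norm_sum_eq_imp_aligned) auto
    then have "weight G \<omega> a * sgn (x ?w) = c * sgn (x ?v)"
      unfolding outK[OF vw(1)] c_def using xn vw l0 by (intro aligned_phase) auto
    moreover have "sgn (x ?w) \<noteq> 0" "sgn (x ?v) \<noteq> 0" using xn vw by (auto simp: sgn_zero_iff)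
    ultimately show ?thesis using vw by (simp add: u_def field_simps)
  qed
  have e': "(e, True) \<in> oriented_edges G" using e by (simp add: oriented_edges_def)
  have un: "u v \<noteq> 0" for v using u[of v] by auto
  \<comment> \<open>Inverting an edge inverts its weight and its coboundary value, but keeps the
    factor c.\<close>
  have "c * c = 1"
    using w[OF e'] w[of "edge_inv (e, True)"] weight_inv[OF e', of \<omega>] e' un[of "edge_init G (e, True)"] un[of "edge_term G (e, True)"] weight_nonzero[of G \<omega> "(e, True)"]
    by (simp add: field_simps)
  then have "c = 1 \<or> c = - 1" by (simp add: square_eq_1_iff)
  then show ?thesis
  proof
    assume "c = 1"
    then show ?thesis using integral_on_cycles_of_potential[of u \<omega>] u w by simp
  next
    assume "c = - 1"
    then have "weight G (\<lambda>e. \<omega> e - half_form G e) a = u (edge_term G a) / u (edge_init G a)"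
      if "a \<in> oriented_edges G" for a
      using w[OF that] by (simp add: weight_minus weight_half[OF that])
    then show ?thesis using integral_on_cycles_of_potential[of u] u by blast
  qed
qed

text \<open>An extremal eigenvector need not be supported on the recurrent edges, where W is
  irreducible. The closed walk \<open>s0\<close> ensures a nonzero eigenvalue; then the support
  leads to recurrent edges, and x restricts to an eigenvector on these.\<close>

lemma edge_adj_extremal:
  assumes es: "distinct es" "set es = oriented_edges G" and g: "genus G \<noteq> 1"
    and cw: "closed_walk G s0 k0"
    and eq: "spectral_radius (twisted_edge_adj G es \<omega>) = spectral_radius (twisted_edge_adj G es (\<lambda>e. 0))"
  shows "\<exists>c. \<forall>s k. closed_walk G s k \<longrightarrow>
    (\<Prod>i<k. weight G \<omega> (s (Suc i))) = c ^ k \<and> (\<Prod>i<k. weight G \<omega> (s (Suc i)))\<^sup>2 = 1"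
proof -
  let ?S = "oriented_edges G" and ?C = "recurrent_edges G"
  have CS: "?C \<subseteq> ?S" using recurrent_edges_oriented by auto
  have finC: "finite ?C" using CS finite_subset by fastforce
  define B where "B a b = (of_bool (feeds_into G a b) :: real)" for a b
  define \<rho> where "\<rho> = spectral_radius (kernel_mat es (\<lambda>a b. of_real (B a b)))"
  have \<rho>_eq: "\<rho> = spectral_radius (twisted_edge_adj G es (\<lambda>e. 0))"
    by (simp add: \<rho>_def B_def twisted_edge_adj_conv edge_kernel_zero[abs_def])
  have ne: "es \<noteq> []" using cw es(2) by (auto simp: closed_walk_def)
  obtain l x where l: "cmod l = spectral_radius (kernel_mat es (edge_kernel G \<omega>))"
    and x0: "\<exists>a\<in>set es. x a \<noteq> 0"
    and x: "\<And>a. a \<in> set es \<Longrightarrow> (\<Sum>b\<in>set es. edge_kernel G \<omega> a b * x b) = l * x a"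
    using kernel_mat_spectral_radius_attained[OF es(1) ne] by blast
  have l\<rho>: "cmod l = \<rho>" using l eq by (simp add: \<rho>_eq twisted_edge_adj_conv)
  then have l0: "l \<noteq> 0" using closed_walk_spectral_radius_ge_1[OF es cw] by (auto simp: \<rho>_eq)
  \<comment> \<open>Each edge of the support feeds into another one, as otherwise
    \<open>l * x a\<close> would be 0. Following such edges becomes periodic, and periodic edges are
    recurrent.\<close>
  have reach: "\<exists>c\<in>?C. (a, c) \<in> (feeds_rel G)\<^sup>* \<and> x c \<noteq> 0" if a: "a \<in> ?S" "x a \<noteq> 0" for a
  proof -
    define P where "P = {a \<in> ?S. x a \<noteq> 0}"
    have "\<exists>b\<in>P. (a, b) \<in> feeds_rel G" if "a \<in> P" for a
    proof -
      have "(\<Sum>b\<in>?S. edge_kernel G \<omega> a b * x b) \<noteq> 0" using x[of a] l0 that es by (auto simp: P_def)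
      then obtain b where "b \<in> ?S" "edge_kernel G \<omega> a b * x b \<noteq> 0" by (meson sum.neutral)
      then show ?thesis using that
        by (intro bexI[of _ b]) (auto simp: P_def feeds_rel_def edge_kernel_def split: if_splits)
    qed
    then obtain f where f: "\<And>a. a \<in> P \<Longrightarrow> f a \<in> P" "\<And>a. a \<in> P \<Longrightarrow> (a, f a) \<in> feeds_rel G" by metis
    have P: "finite P" "a \<in> P" using a by (auto simp: P_def)
    obtain i y k where y: "y = (f ^^ i) a" "y \<in> P" "0 < k" "(f ^^ k) y = y" "inj_on (\<lambda>i. (f ^^ i) y) {..<k}"
      by (rule finite_periodic_point[where f = f, OF P f(1)])
    have orb: "(f ^^ j) b \<in> P \<and> (b, (f ^^ j) b) \<in> (feeds_rel G)\<^sup>*" if "b \<in> P" for j b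
    proof (induction j)
      case (Suc j)
      then show ?case using f by (simp add: rtrancl.rtrancl_into_rtrancl[OF _ f(2)])
    qed (use that in simp)
    obtain m where m: "k = Suc m" using y(3) by (cases k) auto
    have "(y, (f ^^ m) y) \<in> (feeds_rel G)\<^sup>*" "((f ^^ m) y, y) \<in> feeds_rel G"
      using orb[OF y(2), of m] f(2)[of "(f ^^ m) y"] y(4) m by auto
    then have "y \<in> ?C" by (auto simp: recurrent_edges_def intro: rtrancl_into_trancl1)
    then show ?thesis using orb[OF P(2), of i] y(1,2) by (auto simp: P_def)
  qed
  obtain c0 where c0: "c0 \<in> ?C" "x c0 \<noteq> 0" using x0 reach es(2) by blast
  \<comment> \<open>From \<open>b\<close> the support leads to a recurrent edge, which leads to
    \<open>c\<close> by strong connectivity and so back to \<open>b\<close>.\<close>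
  have stay: "b \<in> ?C" if "c \<in> ?C" "b \<in> ?S" "feeds_into G c b" "x b \<noteq> 0" for c b
  proof -
    from reach[OF that(2,4)] obtain d where d: "d \<in> ?C" "(b, d) \<in> (feeds_rel G)\<^sup>*" by blast
    have "(c, b) \<in> feeds_rel G" using that CS by (auto simp: feeds_rel_def)
    moreover have "(d, c) \<in> (feeds_rel G)\<^sup>*" using recurrent_edges_connected[OF d(1) that(1) g] .
    ultimately have "(b, b) \<in> (feeds_rel G)\<^sup>+" using d(2) by (meson rtrancl_into_trancl1 rtrancl_trans)
    then show ?thesis by (simp add: recurrent_edges_def)
  qed
  have onC: "(\<Sum>b\<in>?C. edge_kernel G \<omega> c b * x b) = l * x c" if "c \<in> ?C" for c
  proof -
    have "(\<Sum>b\<in>?S. edge_kernel G \<omega> c b * x b) = (\<Sum>b\<in>?C. edge_kernel G \<omega> c b * x b)"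
      using stay[OF that] CS by (intro sum.mono_neutral_right) (auto simp: edge_kernel_def)
    then show ?thesis using x[of c] that CS es(2) by auto
  qed
  have pf: "0 < cmod (x c) \<and> (\<Sum>b\<in>?C. B c b * cmod (x b)) = \<rho> * cmod (x c)" if c: "c \<in> ?C" for c
  proof (rule irreducible_subinvariant_spectral[OF es(1) _ _ _ \<rho>_def _ c0(1) _ _ c])
    show "(a, b) \<in> {(a, b). a \<in> ?C \<and> b \<in> ?C \<and> 0 < B a b}\<^sup>*" if "a \<in> ?C" "b \<in> ?C" for a b
      using recurrent_edges_connected_within[OF that g] by (simp add: B_def)
    fix a assume a: "a \<in> ?C"
    have "\<rho> * cmod (x a) = cmod (l * x a)" by (simp add: norm_mult l\<rho>)
    also have "\<dots> \<le> (\<Sum>b\<in>?C. B a b * cmod (x b))"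
      unfolding onC[OF a, symmetric]
      by (rule order.trans[OF norm_sum]) (simp add: norm_mult edge_kernel_norm B_def)
    finally show "\<rho> * cmod (x a) \<le> (\<Sum>b\<in>?C. B a b * cmod (x b))" .
  qed (use CS c0 es in \<open>auto simp: B_def\<close>)
  define c where "c = sgn l"
  define u where "u a = sgn (x a)" for a
  have u0: "u a \<noteq> 0" if "a \<in> ?C" for a using pf[OF that] by (auto simp: u_def sgn_zero_iff)
  have step: "weight G \<omega> b * u b = c * u a" if a: "a \<in> ?C" and b: "b \<in> ?C" and ab: "feeds_into G a b" for a b
  proof -
    let ?t = "\<lambda>b. edge_kernel G \<omega> a b * x b"
    have "cmod (sum ?t ?C) = (\<Sum>b\<in>?C. cmod (?t b))"
      using pf[OF a] by (simp add: onC[OF a] norm_mult l\<rho> edge_kernel_norm B_def)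
    then have "?t b * of_real (cmod (sum ?t ?C)) = of_real (cmod (?t b)) * sum ?t ?C"
      using b finC by (intro norm_sum_eq_imp_aligned) auto
    then have "edge_kernel G \<omega> a b * sgn (x b) = c * sgn (x a)"
      unfolding onC[OF a] c_def using pf[OF a] pf[OF b] l0 ab
      by (intro aligned_phase) (auto simp: edge_kernel_def)
    then show ?thesis using ab by (simp add: edge_kernel_def u_def)
  qed
  have c0': "c \<noteq> 0" using l0 by (simp add: c_def sgn_zero_iff)
  show ?thesis
  proof (intro exI[of _ c] allI impI conjI)
    fix s k assume s: "closed_walk G s k"
    have sC: "s i \<in> ?C" for i using closed_walk_recurrent[OF s] .
    have sf: "feeds_into G (s i) (s (Suc i))" for i using s by (auto simp: closed_walk_def)
    let ?P = "\<Prod>i<k. weight G \<omega> (s (Suc i))"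
    have "(\<Prod>i<k. weight G \<omega> (s (Suc i)) * u (s (Suc i))) = (\<Prod>i<k. c * u (s i))"
      using step sC sf by (intro prod.cong) auto
    then have "?P * (\<Prod>i<k. u (s i)) = c ^ k * (\<Prod>i<k. u (s i))"
      by (simp only: prod.distrib closed_walk_prod_shift[OF s, of u] prod_constant card_lessThan)
    then show P: "?P = c ^ k" using u0 sC by simp
    \<comment> \<open>The phase relation along the inverted walk, which has the inverse weights but
      the same constant c; so c^k is also the inverse of the weight of \<open>s\<close>.\<close>
    have "weight G \<omega> (edge_inv (s i)) * u (edge_inv (s i)) = c * u (edge_inv (s (Suc i)))" for i
      using step[OF recurrent_edges_inv[OF sC[of "Suc i"]] recurrent_edges_inv[OF sC[of i]]] sf by simp
    moreover have "u (edge_inv (s i)) = weight G \<omega> (s i) * (weight G \<omega> (edge_inv (s i)) * u (edge_inv (s i)))" for i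
      by (simp add: weight_inv[OF recurrent_edges_oriented[OF sC]])
    ultimately have inv: "u (edge_inv (s i)) = c * weight G \<omega> (s i) * u (edge_inv (s (Suc i)))" for i
      by (metis mult.assoc mult.commute)
    have "(\<Prod>i<k. u (edge_inv (s i))) = (\<Prod>i<k. c * weight G \<omega> (s i) * u (edge_inv (s (Suc i))))"
      by (rule prod.cong[OF refl inv])
    also have "\<dots> = c ^ k * ?P * (\<Prod>i<k. u (edge_inv (s i)))"
      by (simp only: prod.distrib closed_walk_prod_shift[OF s, of "\<lambda>a. u (edge_inv a)"]
          closed_walk_prod_shift[OF s, of "weight G \<omega>"] prod_constant card_lessThan)
    finally have "c ^ k * ?P = 1" using u0[OF recurrent_edges_inv[OF sC]] by simp
    then show "?P\<^sup>2 = 1" using P by (simp add: power2_eq_square)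
  qed
qed

lemma edge_adj_extremal_two_torsion:
  assumes es: "distinct es" "set es = oriented_edges G" and g: "genus G \<noteq> 1"
    and eq: "spectral_radius (twisted_edge_adj G es \<omega>) = spectral_radius (twisted_edge_adj G es (\<lambda>e. 0))"
  shows "integral_on_cycles G (\<lambda>e. \<omega> e + \<omega> e)"
proof (rule integral_on_cyclesI)
  fix s k assume s: "closed_walk G s k"
  then have "(\<Prod>i<k. weight G \<omega> (s (Suc i)))\<^sup>2 = 1"
    using edge_adj_extremal[OF es g s eq] by blast
  then show "(\<Prod>i<k. weight G (\<lambda>e. \<omega> e + \<omega> e) (s (Suc i))) = 1"
    by (simp only: weight_add prod.distrib power2_eq_square)
qed

text \<open>The weight P = c^k of a closed walk is a sign, hence equal to its odd power P^k1. So c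
  may be replaced by Q = c^k1, which is itself a sign, being the weight of a closed walk of odd
  length k1.\<close>

lemma edge_adj_extremal_not_bipartite:
  assumes es: "distinct es" "set es = oriented_edges G" and g: "genus G \<noteq> 1" and nb: "\<not> bipartite G"
    and eq: "spectral_radius (twisted_edge_adj G es \<omega>) = spectral_radius (twisted_edge_adj G es (\<lambda>e. 0))"
  shows "integral_on_cycles G \<omega> \<or> integral_on_cycles G (\<lambda>e. \<omega> e - half_form G e)"
proof -
  have half: "(\<Prod>i<k. weight G (half_form G) (s (Suc i))) = (- 1) ^ k" if "closed_walk G s k" for s k
    using that by (simp add: closed_walk_def weight_half)
  \<comment> \<open>If all lengths were even, the half form would have weight 1 on every closed
    walk, and the graph would be bipartite.\<close>
  have "\<exists>s k. closed_walk G s k \<and> odd k"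
  proof (rule ccontr)
    assume "\<not> (\<exists>s k. closed_walk G s k \<and> odd k)"
    then have "(\<Prod>i<k. weight G (half_form G) (s (Suc i))) = 1" if "closed_walk G s k" for s k
      using half[OF that] that by auto
    then show False using integral_on_cyclesI nb integral_half_iff_bipartite by blast
  qed
  then obtain s1 k1 where s1: "closed_walk G s1 k1" "odd k1" by blast
  obtain c where c: "\<And>s k. closed_walk G s k \<Longrightarrow>
      (\<Prod>i<k. weight G \<omega> (s (Suc i))) = c ^ k \<and> (\<Prod>i<k. weight G \<omega> (s (Suc i)))\<^sup>2 = 1"
    using edge_adj_extremal[OF es g s1(1) eq] by blast
  define Q where "Q = c ^ k1"
  have P: "(\<Prod>i<k. weight G \<omega> (s (Suc i))) = Q ^ k" if s: "closed_walk G s k" for s k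
  proof -
    let ?P = "\<Prod>i<k. weight G \<omega> (s (Suc i))"
    have "?P ^ k1 = Q ^ k" using c[OF s] by (simp add: Q_def power_mult[symmetric] mult.commute)
    moreover have "?P ^ k1 = ?P"
    proof -
      obtain m where "k1 = Suc (2 * m)" using s1(2) by (auto elim: oddE)
      then have "?P ^ k1 = ?P * (?P\<^sup>2) ^ m" by (simp only: power_Suc power_mult)
      also have "?P\<^sup>2 = 1" using c[OF s] by blast
      finally show ?thesis by simp
    qed
    ultimately show ?thesis by simp
  qed
  have "Q\<^sup>2 = 1" using c[OF s1(1)] unfolding Q_def by metis
  then have "Q = 1 \<or> Q = - 1" by (simp add: power2_eq_1_iff)
  then show ?thesis
  proof
    assume "Q = 1"
    then show ?thesis using P integral_on_cyclesI[of \<omega>] by simp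
  next
    assume Q: "Q = - 1"
    have "integral_on_cycles G (\<lambda>e. \<omega> e - half_form G e)"
    proof (rule integral_on_cyclesI)
      fix s k assume s: "closed_walk G s k"
      have "(\<Prod>i<k. weight G (\<lambda>e. \<omega> e - half_form G e) (s (Suc i))) =
          (\<Prod>i<k. weight G \<omega> (s (Suc i))) / (\<Prod>i<k. weight G (half_form G) (s (Suc i)))"
        by (simp add: weight_minus prod_dividef)
      then show "(\<Prod>i<k. weight G (\<lambda>e. \<omega> e - half_form G e) (s (Suc i))) = 1"
        using P[OF s] half[OF s] Q by simp
    qed
    then show ?thesis by simp
  qed
qed

end

section \<open>Genus one and the main theorem\<close>

text \<open>For all vertices of a graph of genus 1 this is the orientation around its cycle and
  towards it: one outgoing edge per vertex, and no arc chosen twice.\<close>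

definition out_orientation_on :: "('a, 'b) pre_digraph \<Rightarrow> 'a set \<Rightarrow> ('a \<Rightarrow> 'b \<times> bool) \<Rightarrow> bool" where
  "out_orientation_on G U out \<longleftrightarrow> inj_on (\<lambda>v. fst (out v)) U \<and>
    (\<forall>v\<in>U. out v \<in> oriented_edges G \<and> edge_init G (out v) = v \<and> edge_term G (out v) \<in> U)"

context connected_digraph
begin

text \<open>A vertex outside \<open>U\<close> but adjacent to it receives an edge pointing into
  \<open>U\<close>. The arc is new, since the edges chosen so far run inside
  \<open>U\<close>.\<close>

lemma out_orientation_extend:
  assumes "out_orientation_on G U out" "U \<subseteq> verts G" "U \<noteq> {}"
  shows "\<exists>out. out_orientation_on G (verts G) out"
  using assms
proof (induction "card (verts G - U)" arbitrary: U out rule: less_induct)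
  case (less U out)
  show ?case
  proof (cases "U = verts G")
    case False
    obtain r where r: "r \<in> U" using less.prems by blast
    have "\<exists>a\<in>oriented_edges G. edge_init G a \<in> U \<and> edge_term G a \<notin> U"
      using adjacency_closed_imp_verts[OF less.prems(2) r] False by blast
    then obtain a where a: "edge_inv a \<in> oriented_edges G" "edge_init G a \<in> U" "edge_term G a \<notin> U" by auto
    let ?v = "edge_term G a"
    let ?out = "out(?v := edge_inv a)"
    have *: "inj_on (\<lambda>v. fst (out v)) U"
        "\<And>v. v \<in> U \<Longrightarrow> out v \<in> oriented_edges G \<and> edge_init G (out v) = v \<and> edge_term G (out v) \<in> U"
      using less.prems(1) by (auto simp: out_orientation_on_def)
    have new: "fst (out w) \<noteq> fst a" if "w \<in> U" for w
      using fst_eq_imp_edge[of "out w" a] *(2)[OF that] that a(3) by (metis edge_init_inv)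
    have "out_orientation_on G (insert ?v U) ?out"
      unfolding out_orientation_on_def
    proof (intro conjI ballI)
      show "inj_on (\<lambda>v. fst (?out v)) (insert ?v U)"
        using *(1) new a(3) by (auto simp: inj_on_def) (metis fst_eqD)+
    qed (use * a in auto)
    moreover have "insert ?v U \<subseteq> verts G"
      using less.prems(2) edge_init_in_verts[OF a(1)] by simp
    moreover have "card (verts G - insert ?v U) < card (verts G - U)"
    proof (rule psubset_card_mono)
      have "?v \<in> verts G - U" using a(3) edge_init_in_verts[OF a(1)] by simp
      then show "verts G - insert ?v U \<subset> verts G - U" by blast
    qed simp
    ultimately show ?thesis using less.hyps by blast
  qed (use less.prems in auto)
qed

text \<open>
  A real cycle of nonzero flow gives every vertex it visits an outgoing edge of positive flow; the
  remaining vertices are attached along trees directed towards these.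
\<close>

lemma out_orientation_exists:
  assumes g: "genus G = 1"
  obtains out where "out_orientation_on G (verts G) out"
proof -
  obtain r where r: "r \<in> verts G" using verts_nonempty by blast
  have "card (arcs G) = card (verts G)" using g by (simp add: genus_def)
  \<comment> \<open>With as many arcs as vertices, one equation is dropped to get more unknowns than
    equations. It is recovered below because all boundary values add up to 0.\<close>
  moreover have "card (verts G - {r}) < card (verts G)"
    using r by (intro psubset_card_mono) auto
  ultimately have "\<exists>\<alpha>. (\<exists>e\<in>arcs G. \<alpha> e \<noteq> 0) \<and> (\<forall>v\<in>verts G - {r}.
      (\<Sum>e\<in>arcs G. (of_bool (head G e = v) - of_bool (tail G e = v)) * \<alpha> e) = (0::real))"
    by (intro nontrivial_kernel) auto
  then obtain \<alpha> :: "'b \<Rightarrow> real" where \<alpha>: "\<exists>e\<in>arcs G. \<alpha> e \<noteq> 0"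
      "\<And>v. v \<in> verts G - {r} \<Longrightarrow> (\<Sum>e\<in>arcs G. (of_bool (head G e = v) - of_bool (tail G e = v)) * \<alpha> e) = 0"
    by blast
  have bd': "boundary G \<alpha> v = 0" if "v \<noteq> r" for v
  proof (cases "v \<in> verts G")
    case True
    then show ?thesis using \<alpha>(2)[of v] that by (simp add: boundary_def mult.commute)
  next
    case False
    then show ?thesis unfolding boundary_def by (intro sum.neutral) auto
  qed
  have "(\<Sum>v\<in>verts G. boundary G \<alpha> v) =
      (\<Sum>e\<in>arcs G. \<alpha> e * (\<Sum>v\<in>verts G. 1 * (of_bool (head G e = v) - of_bool (tail G e = v))))"
    unfolding boundary_def sum_distrib_left by (subst sum.swap) simp
  also have "\<dots> = 0"
    by (intro sum.neutral ballI) (simp only: sum_verts_incidence, simp)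
  finally have "boundary G \<alpha> r = 0"
    using bd' sum.remove[OF finite_verts r, of "boundary G \<alpha>"] by simp
  then have bd: "boundary G \<alpha> v = 0" for v using bd' by (cases "v = r") auto
  define U where "U = {v. \<exists>a\<in>oriented_edges G. edge_init G a = v \<and> 0 < edge_coeff \<alpha> a}"
  have "\<forall>v\<in>U. \<exists>a. a \<in> oriented_edges G \<and> edge_init G a = v \<and> 0 < edge_coeff \<alpha> a"
    unfolding U_def by blast
  then obtain out where out: "\<And>v. v \<in> U \<Longrightarrow> out v \<in> oriented_edges G \<and> edge_init G (out v) = v \<and> 0 < edge_coeff \<alpha> (out v)"
    unfolding bchoice_iff by blast
  have "out_orientation_on G U out"
    unfolding out_orientation_on_def
  proof (intro conjI ballI)
    show "inj_on (\<lambda>v. fst (out v)) U"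
    proof (rule inj_onI)
      fix v w assume vw: "v \<in> U" "w \<in> U" "fst (out v) = fst (out w)"
      from fst_eq_imp_edge[OF vw(3)] have "out v = out w"
        using out[OF vw(1)] out[OF vw(2)] by auto
      then show "v = w" using out[OF vw(1)] out[OF vw(2)] by metis
    qed
    fix v assume v: "v \<in> U"
    then show "out v \<in> oriented_edges G" "edge_init G (out v) = v" using out by auto
    show "edge_term G (out v) \<in> U"
      using positive_edge_continues[OF bd, of "out v"] out[OF v] by (auto simp: U_def feeds_into_def)
  qed
  moreover have "U \<subseteq> verts G" by (auto simp: U_def)
  moreover have "U \<noteq> {}"
  proof -
    obtain e where e: "e \<in> arcs G" "\<alpha> e \<noteq> 0" using \<alpha>(1) by blast
    then have "(e, 0 < \<alpha> e) \<in> oriented_edges G" "0 < edge_coeff \<alpha> (e, 0 < \<alpha> e)"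
      by (auto simp: edge_coeff_def oriented_edges_def)
    then show ?thesis unfolding U_def by blast
  qed
  ultimately show ?thesis using out_orientation_extend that by blast
qed

text \<open>
  Positively directed edges feed only one edge of their kind, and negatively directed edges feed only
  edges of their kind and are fed by only one of these. So the edge adjacency matrix is block
  triangular with unit-modulus functional blocks.
\<close>

lemma spectral_radius_genus_1:
  assumes es: "distinct es" "set es = oriented_edges G" and g: "genus G = 1"
  shows "spectral_radius (twisted_edge_adj G es \<omega>) = 1"
proof -
  let ?S = "oriented_edges G" and ?V = "verts G" and ?K = "edge_kernel G \<omega>"
  obtain out where oo: "out_orientation_on G ?V out" using out_orientation_exists[OF g] .
  then have inj: "inj_on (\<lambda>v. fst (out v)) ?V"
    and out: "\<And>v. v \<in> ?V \<Longrightarrow> out v \<in> ?S" "\<And>v. v \<in> ?V \<Longrightarrow> edge_init G (out v) = v"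
    by (auto simp: out_orientation_on_def)
  define n where "n v = edge_term G (out v)" for v
  have nV: "n v \<in> ?V" if "v \<in> ?V" for v using out(1)[OF that] by (simp add: n_def)
  \<comment> \<open>As there are as many arcs as vertices, every arc is chosen by some
    vertex.\<close>
  have "(\<lambda>v. fst (out v)) ` ?V = arcs G"
  proof (rule card_subset_eq)
    show "(\<lambda>v. fst (out v)) ` ?V \<subseteq> arcs G" using out(1) by (auto simp: oriented_edges_def mem_Times_iff)
    show "card ((\<lambda>v. fst (out v)) ` ?V) = card (arcs G)" using card_image[OF inj] g by (simp add: genus_def)
  qed simp
  then have cover: "\<exists>v\<in>?V. a = out v \<or> a = edge_inv (out v)" if "a \<in> ?S" for a
  proof -
    have "fst a \<in> (\<lambda>v. fst (out v)) ` ?V"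
      using that \<open>(\<lambda>v. fst (out v)) ` ?V = arcs G\<close> by (simp add: oriented_edges_def mem_Times_iff)
    then show ?thesis using fst_eq_imp_edge by blast
  qed
  have out_neq: "out v \<noteq> edge_inv (out w)" if "v \<in> ?V" "w \<in> ?V" for v w
  proof
    assume eq: "out v = edge_inv (out w)"
    then have "v = w" using inj that by (metis fst_edge_inv inj_onD)
    then show False using eq by simp
  qed
  have out_inj: "out v = out w \<longleftrightarrow> v = w" if "v \<in> ?V" "w \<in> ?V" for v w
    using out(2)[OF that(1)] out(2)[OF that(2)] by metis
  have out_out: "feeds_into G (out v) (out w) \<longleftrightarrow> n v = w" if "v \<in> ?V" "w \<in> ?V" for v w
    using out_neq[OF that(2,1)] out(2)[OF that(2)] by (simp add: feeds_into_def n_def)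
  have inv_out: "\<not> feeds_into G (edge_inv (out v)) (out w)" if "v \<in> ?V" "w \<in> ?V" for v w
    using that by (auto simp: feeds_into_def out(2))
  have inv_inv: "feeds_into G (edge_inv (out v)) (edge_inv (out w)) \<longleftrightarrow> n w = v" if "v \<in> ?V" "w \<in> ?V" for v w
    using out_out[OF that(2,1)] by simp
  have split: "(\<Sum>b\<in>?S. h b) = (\<Sum>v\<in>?V. h (out v)) + (\<Sum>v\<in>?V. h (edge_inv (out v)))" for h :: "_ \<Rightarrow> complex"
  proof -
    have S: "?S = out ` ?V \<union> (\<lambda>v. edge_inv (out v)) ` ?V" 
    proof
      show "?S \<subseteq> out ` ?V \<union> (\<lambda>v. edge_inv (out v)) ` ?V" using cover by blast
    qed (use out(1) in auto)
    have disj: "out ` ?V \<inter> (\<lambda>v. edge_inv (out v)) ` ?V = {}"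
    proof (rule equals0I)
      fix a assume "a \<in> out ` ?V \<inter> (\<lambda>v. edge_inv (out v)) ` ?V"
      then obtain v w where "v \<in> ?V" "w \<in> ?V" "a = out v" "a = edge_inv (out w)" by blast
      then show False using out_neq[of v w] by simp
    qed
    have "(\<Sum>b\<in>?S. h b) = sum h (out ` ?V) + sum h ((\<lambda>v. edge_inv (out v)) ` ?V)"
      unfolding S using disj by (intro sum.union_disjoint) auto
    then show ?thesis using out_inj by (simp add: sum.reindex inj_on_def)
  qed
  obtain r where r: "r \<in> ?V" using verts_nonempty by blast
  have ne: "es \<noteq> []" using out(1)[OF r] es by auto
  have "spectral_radius (twisted_edge_adj G es \<omega>) \<le> 1"
  proof (rule ccontr)
    assume gt: "\<not> spectral_radius (twisted_edge_adj G es \<omega>) \<le> 1"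
    obtain l x where l: "cmod l = spectral_radius (kernel_mat es ?K)"
      and x0: "\<exists>a\<in>set es. x a \<noteq> 0"
      and x: "\<And>a. a \<in> set es \<Longrightarrow> (\<Sum>b\<in>set es. ?K a b * x b) = l * x a"
      using kernel_mat_spectral_radius_attained[OF es(1) ne] by blast
    have l1: "1 < cmod l" using gt l by (simp add: twisted_edge_adj_conv)
    \<comment> \<open>On negative edges the value at w contributes only at \<open>n w\<close>.
      Summing over all vertices bounds |l| times the total of \<open>y\<close> by that total, so
      \<open>y\<close> vanishes if |l| > 1.\<close>
    define y where "y v = cmod (x (edge_inv (out v)))" for v
    have y_le: "cmod l * y v \<le> (\<Sum>w | w \<in> ?V \<and> n w = v. y w)" if v: "v \<in> ?V" for v
    proof -
      have "l * x (edge_inv (out v)) = (\<Sum>w\<in>?V. ?K (edge_inv (out v)) (edge_inv (out w)) * x (edge_inv (out w)))"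
        using x[of "edge_inv (out v)"] out(1)[OF v] es(2) inv_out[OF v] by (simp add: split edge_kernel_def)
      then have "cmod l * y v \<le> (\<Sum>w\<in>?V. cmod (?K (edge_inv (out v)) (edge_inv (out w))) * y w)"
        unfolding y_def norm_mult[symmetric] by (simp only: norm_sum)
      also have "\<dots> = (\<Sum>w\<in>?V. if n w = v then y w else 0)"
        using inv_inv[OF v] by (intro sum.cong) (auto simp: edge_kernel_norm)
      finally show ?thesis by (simp add: sum.inter_filter)
    qed
    have "cmod l * (\<Sum>v\<in>?V. y v) \<le> (\<Sum>v\<in>?V. \<Sum>w | w \<in> ?V \<and> n w = v. y w)"
      unfolding sum_distrib_left using y_le by (intro sum_mono)
    also have "\<dots> = (\<Sum>w\<in>?V. y w)" using nV by (intro sum.group) auto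
    finally have "(cmod l - 1) * (\<Sum>v\<in>?V. y v) \<le> 0" by (simp add: left_diff_distrib)
    then have "(\<Sum>v\<in>?V. y v) \<le> 0" using l1 by (simp add: mult_le_0_iff)
    then have "\<forall>v\<in>?V. y v = 0"
      using sum_nonneg_eq_0_iff[of ?V y] sum_nonneg[of ?V y] by (auto simp: y_def)
    then have inv0: "x (edge_inv (out v)) = 0" if "v \<in> ?V" for v using that by (simp add: y_def)
    \<comment> \<open>Once x vanishes on negative edges, its modulus at \<open>out (n v)\<close> is
      |l| times that at \<open>out v\<close>; hence a positive maximum is impossible.\<close>
    define m where "m = Max ((\<lambda>v. cmod (x (out v))) ` ?V)"
    have m: "cmod (x (out v)) \<le> m" if "v \<in> ?V" for v unfolding m_def using that by (intro Max_ge) auto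
    have "cmod l * cmod (x (out v)) \<le> m" if v: "v \<in> ?V" for v
    proof -
      have "l * x (out v) = (\<Sum>w\<in>?V. ?K (out v) (out w) * x (out w))"
        using x[of "out v"] out(1)[OF v] es(2) by (simp add: split inv0)
      also have "\<dots> = (\<Sum>w\<in>?V. of_bool (n v = w) * (weight G \<omega> (out w) * x (out w)))"
        using out_out[OF v] by (intro sum.cong) (auto simp: edge_kernel_def)
      also have "\<dots> = weight G \<omega> (out (n v)) * x (out (n v))"
        using nV[OF v] by (subst sum_of_bool_mult) auto
      finally have "cmod l * cmod (x (out v)) = cmod (x (out (n v)))"
        by (metis mult_1 norm_mult weight_norm)
      then show ?thesis using m[OF nV[OF v]] by simp
    qed
    moreover have "m \<in> (\<lambda>v. cmod (x (out v))) ` ?V" unfolding m_def using r by (intro Max_in) auto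
    ultimately have "cmod l * m \<le> m" "0 \<le> m" by auto
    then have "(cmod l - 1) * m \<le> 0" by (simp add: left_diff_distrib)
    then have m0: "m \<le> 0" using l1 by (simp add: mult_le_0_iff)
    have "x (out v) = 0" if "v \<in> ?V" for v using order.trans[OF m[OF that] m0] by simp
    then show False using x0 inv0 cover es(2) by metis
  qed
  moreover have "1 \<le> spectral_radius (twisted_edge_adj G es \<omega>)"
  proof -
    \<comment> \<open>Following outgoing edges from \<open>r\<close> ends in the cycle of the graph,
      and \<open>v\<close> lies on it.\<close>
    obtain i v k where v: "v = (n ^^ i) r" "v \<in> ?V" "0 < k" "(n ^^ k) v = v" "inj_on (\<lambda>i. (n ^^ i) v) {..<k}"
      by (rule finite_periodic_point[where f = n, OF finite_verts r nV])
    have nk: "(n ^^ j) v \<in> ?V" for j by (induction j) (use v(2) nV in auto)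
    \<comment> \<open>Negative edges never feed into positive ones, so from \<open>out v\<close> a
      single walk of each length ends at a positive edge, and nothing can cancel.\<close>
    have pow: "(\<forall>w\<in>?V. w \<noteq> (n ^^ j) v \<longrightarrow> kernel_pow ?S ?K j (out v) (out w) = 0) \<and>
        cmod (kernel_pow ?S ?K j (out v) (out ((n ^^ j) v))) = 1" for j
    proof (induction j)
      case 0
      then show ?case using out_inj v(2) by auto
    next
      case (Suc j)
      have eq: "kernel_pow ?S ?K (Suc j) (out v) (out w) =
          of_bool (n ((n ^^ j) v) = w) * (kernel_pow ?S ?K j (out v) (out ((n ^^ j) v)) * weight G \<omega> (out w))"
        if w: "w \<in> ?V" for w
      proof -
        have "kernel_pow ?S ?K (Suc j) (out v) (out w) =
            (\<Sum>z\<in>?V. kernel_pow ?S ?K j (out v) (out z) * ?K (out z) (out w))"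
          using inv_out w by (simp add: split edge_kernel_def)
        also have "\<dots> = (\<Sum>z\<in>?V. of_bool (z = (n ^^ j) v) * (kernel_pow ?S ?K j (out v) (out z) * ?K (out z) (out w)))"
          using Suc by (intro sum.cong) auto
        also have "\<dots> = kernel_pow ?S ?K j (out v) (out ((n ^^ j) v)) * ?K (out ((n ^^ j) v)) (out w)"
          using nk[of j] by (subst sum_of_bool_mult) auto
        finally show ?thesis using out_out[OF nk w] by (auto simp: edge_kernel_def)
      qed
      show ?case using eq nk[of "Suc j"] Suc by (auto simp: norm_mult simp del: kernel_pow.simps)
    qed
    have per: "(n ^^ (j * k)) v = v" for j by (induction j) (simp_all add: funpow_add v(4))
    show ?thesis
      unfolding twisted_edge_adj_conv
    proof (rule spectral_radius_ge_1[OF es(1), of "out v" k])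
      show "1 \<le> cmod (kernel_pow (set es) ?K (j * k) (out v) (out v))" for j
        using pow[of "j * k"] by (simp add: per es(2))
    qed (use v(2,3) out(1) es(2) in auto)
  qed
  ultimately show ?thesis by simp
qed

end

theorem theorem3p1:
  fixes G :: "('a, 'b) pre_digraph" and vs :: "'a list" and es :: "('b \<times> bool) list"
  assumes "fin_digraph G"
    and "Digraph_Component.connected G"
    and "distinct vs" and "set vs = verts G"
    and "distinct es" and "set es = oriented_edges G"
  shows
    "\<exists>\<theta> \<in> carrier (character_group G).
       (negating_class G vs es \<theta> \<and>
         (\<forall>\<theta>' \<in> carrier (character_group G). negating_class G vs es \<theta>' \<longrightarrow> \<theta>' = \<theta>) \<and>
         (\<forall>\<omega> \<in> one_forms G.
            spec_negated (twisted_edge_adj G es \<omega>) (twisted_edge_adj G es (\<lambda>e. 0)) \<longrightarrow> form_class G \<omega> = \<theta>)) \<and>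
       two_torsion (character_group G) \<theta> \<and>
       ((\<theta> = \<one>\<^bsub>character_group G\<^esub> \<longleftrightarrow> bipartite G) \<and>
         (bipartite G \<longrightarrow> (\<forall>\<omega> \<in> one_forms G.
            spec_negated (twisted_adj G vs \<omega>) (twisted_adj G vs \<omega>) \<and>
            spec_negated (twisted_edge_adj G es \<omega>) (twisted_edge_adj G es \<omega>)))) \<and>
       (\<forall>\<omega> \<in> one_forms G.
          spectral_radius (twisted_adj G vs \<omega>) \<le> spectral_radius (twisted_adj G vs (\<lambda>e. 0)) \<and>
          spectral_radius (twisted_edge_adj G es \<omega>) \<le> spectral_radius (twisted_edge_adj G es (\<lambda>e. 0))) \<and>
       (\<forall>\<omega> \<in> one_forms G. form_class G \<omega> \<notin> {\<one>\<^bsub>character_group G\<^esub>, \<theta>} \<longrightarrow>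
          spectral_radius (twisted_adj G vs \<omega>) < spectral_radius (twisted_adj G vs (\<lambda>e. 0))) \<and>
       (genus G = 1 \<longrightarrow> (\<forall>\<omega> \<in> one_forms G. spectral_radius (twisted_edge_adj G es \<omega>) = 1)) \<and>
       (\<not> bipartite G \<and> genus G \<ge> 2 \<longrightarrow>
          (\<forall>\<omega> \<in> one_forms G. form_class G \<omega> \<notin> {\<one>\<^bsub>character_group G\<^esub>, \<theta>} \<longrightarrow>
             spectral_radius (twisted_edge_adj G es \<omega>) < spectral_radius (twisted_edge_adj G es (\<lambda>e. 0)))) \<and>
       (bipartite G \<and> genus G \<ge> 2 \<longrightarrow>
          (\<forall>\<omega> \<in> one_forms G. \<not> two_torsion (character_group G) (form_class G \<omega>) \<longrightarrow>
             spectral_radius (twisted_edge_adj G es \<omega>) < spectral_radius (twisted_edge_adj G es (\<lambda>e. 0))))"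
proof -
  interpret connected_digraph G
    by (intro connected_digraph.intro connected_digraph_axioms.intro assms)
  note vs = assms(3,4) and es = assms(5,6)
  define \<theta> where "\<theta> = form_class G (half_form G)"
  note half = one_forms_half[of G]
  have \<theta>_iff: "form_class G \<omega> = \<theta> \<longleftrightarrow> integral_on_cycles G (\<lambda>e. \<omega> e - half_form G e)" if "\<omega> \<in> one_forms G" for \<omega>
    unfolding \<theta>_def by (rule form_class_eq_iff[OF that half])
  have spec: "spec_negated (twisted_adj G vs \<omega>') (twisted_adj G vs \<omega>) \<and>
      spec_negated (twisted_edge_adj G es \<omega>') (twisted_edge_adj G es \<omega>)"
    if "similar_mat (twisted_adj G vs \<omega>') (- twisted_adj G vs \<omega>)"
      "similar_mat (twisted_edge_adj G es \<omega>') (- twisted_edge_adj G es \<omega>)" for \<omega> \<omega>'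
    using spec_negatedI[OF _ _ char_poly_similar[OF that(1)], of "length vs"]
      spec_negatedI[OF _ _ char_poly_similar[OF that(2)], of "length es"]
    by (simp add: twisted_adj_conv twisted_edge_adj_conv)
  have neg: "negating_class G vs es \<theta>"
    unfolding negating_class_def
  proof (intro ballI impI)
    fix \<omega> \<omega>' assume w: "\<omega> \<in> one_forms G" "\<omega>' \<in> one_forms G"
      and "form_class G \<omega> \<otimes>\<^bsub>character_group G\<^esub> form_class G \<omega>' = \<theta>"
    then have "integral_on_cycles G (\<lambda>e. \<omega> e + \<omega>' e - half_form G e)"
      using \<theta>_iff[OF one_forms_add[OF w]] by (simp add: form_class_add)
    note sim = negated_of_half_sum[OF vs(1) es this]
    from sim(1) spec[OF sim] show "similar_mat (twisted_adj G vs \<omega>') (- twisted_adj G vs \<omega>) \<and>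
       spec_negated (twisted_adj G vs \<omega>') (twisted_adj G vs \<omega>) \<and>
       spec_negated (twisted_edge_adj G es \<omega>') (twisted_edge_adj G es \<omega>)"
      by blast
  qed
  have neg_half: "form_class G \<omega> = \<theta>"
    if "\<omega> \<in> one_forms G" "spec_negated (twisted_edge_adj G es \<omega>) (twisted_edge_adj G es (\<lambda>e. 0))" for \<omega>
    using \<theta>_iff[OF that(1)] spec_negated_imp_half[OF es that(2)] by simp
  have unique: "\<theta>' = \<theta>" if "\<theta>' \<in> carrier (character_group G)" "negating_class G vs es \<theta>'" for \<theta>'
  proof -
    from carrier_character_groupE[OF that(1)]
    obtain \<eta> where \<eta>: "\<eta> \<in> one_forms G" "\<theta>' = form_class G \<eta>" by blast
    \<comment> \<open>Testing the property of \<theta>' on the zero form and a representative of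
      \<theta>' relates the representative to the untwisted matrix, which determines its
      class.\<close>
    have "form_class G (\<lambda>e. 0) \<otimes>\<^bsub>character_group G\<^esub> form_class G \<eta> = \<theta>'"
      by (simp add: form_class_add one_forms_zero \<eta>)
    then have "spec_negated (twisted_edge_adj G es \<eta>) (twisted_edge_adj G es (\<lambda>e. 0))"
      using that(2) \<eta>(1) one_forms_zero unfolding negating_class_def by blast
    then show ?thesis using neg_half[OF \<eta>(1)] \<eta>(2) by simp
  qed
  have torsion: "two_torsion (character_group G) (form_class G \<omega>)"
    if "\<omega> \<in> one_forms G" "integral_on_cycles G (\<lambda>e. \<omega> e + \<omega> e)" for \<omega>
    using that form_class_eq_one_iff[OF one_forms_add[OF that(1) that(1)]]
    by (simp add: two_torsion_def form_class_add form_class_in_carrier)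
  \<comment> \<open>Twice the half form has integer coefficients.\<close>
  have tors: "two_torsion (character_group G) \<theta>"
    unfolding \<theta>_def by (rule torsion[OF half integral_on_cycles_int_valued]) (simp add: half_form_def)
  have bip: "\<theta> = \<one>\<^bsub>character_group G\<^esub> \<longleftrightarrow> bipartite G"
    unfolding \<theta>_def form_class_eq_one_iff[OF half] by (rule integral_half_iff_bipartite)
  have bip_spec: "spec_negated (twisted_adj G vs \<omega>) (twisted_adj G vs \<omega>) \<and>
      spec_negated (twisted_edge_adj G es \<omega>) (twisted_edge_adj G es \<omega>)" if b: "bipartite G" for \<omega>
  proof -
    obtain u where u: "\<And>v. cmod (u v) = 1"
      "\<And>a. a \<in> oriented_edges G \<Longrightarrow> weight G (half_form G) a = u (edge_term G a) / u (edge_init G a)"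
      using integral_on_cycles_imp_potential b integral_half_iff_bipartite by blast
    have u0: "u v \<noteq> 0" for v using u(1)[of v] by auto
    \<comment> \<open>In the bipartite case -1 is itself a coboundary, so the gauge transformation
      relates the matrices of \<omega> directly to their own negatives.\<close>
    have w: "weight G \<omega> a = - weight G \<omega> a * u (edge_term G a) / u (edge_init G a)"
      if "a \<in> oriented_edges G" for a
    proof -
      have "u (edge_term G a) / u (edge_init G a) = - 1" using u(2)[OF that] weight_half[OF that] by simp
      then show ?thesis by (simp only: times_divide_eq_right[symmetric]) simp
    qed
    show ?thesis
      by (rule spec[OF similar_twisted_adj_gauge[where u = u, OF vs(1) u0 w]
            similar_twisted_edge_adj_gauge[where u = u, OF es u0 w]])
  qed
  have le: "spectral_radius (twisted_adj G vs \<omega>) \<le> spectral_radius (twisted_adj G vs (\<lambda>e. 0))"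
    "spectral_radius (twisted_edge_adj G es \<omega>) \<le> spectral_radius (twisted_edge_adj G es (\<lambda>e. 0))" for \<omega>
    using spectral_radius_twisted_adj_le[OF vs(1)] spectral_radius_twisted_edge_adj_le[OF es(1)] by auto
  show ?thesis
  proof (intro bexI[of _ \<theta>] conjI ballI impI)
    show "\<theta> \<in> carrier (character_group G)" unfolding \<theta>_def by (rule form_class_in_carrier[OF half])
  next
    fix \<theta>' assume "\<theta>' \<in> carrier (character_group G)" "negating_class G vs es \<theta>'"
    then show "\<theta>' = \<theta>" by (rule unique)
  next
    fix \<omega> assume "\<omega> \<in> one_forms G"
      "spec_negated (twisted_edge_adj G es \<omega>) (twisted_edge_adj G es (\<lambda>e. 0))"
    then show "form_class G \<omega> = \<theta>" by (rule neg_half)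
  next
    fix \<omega> assume "bipartite G"
    then show "spec_negated (twisted_adj G vs \<omega>) (twisted_adj G vs \<omega>)"
      "spec_negated (twisted_edge_adj G es \<omega>) (twisted_edge_adj G es \<omega>)"
      using bip_spec by auto
  next
    fix \<omega> assume w: "\<omega> \<in> one_forms G" "form_class G \<omega> \<notin> {\<one>\<^bsub>character_group G\<^esub>, \<theta>}"
    then have "spectral_radius (twisted_adj G vs \<omega>) \<noteq> spectral_radius (twisted_adj G vs (\<lambda>e. 0))"
      using adj_extremal[OF vs, of \<omega>] \<theta>_iff[OF w(1)] form_class_eq_one_iff[OF w(1)] by blast
    then show "spectral_radius (twisted_adj G vs \<omega>) < spectral_radius (twisted_adj G vs (\<lambda>e. 0))"
      using le(1)[of \<omega>] by linarith
  next
    fix \<omega> assume "genus G = 1"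
    then show "spectral_radius (twisted_edge_adj G es \<omega>) = 1" by (rule spectral_radius_genus_1[OF es])
  next
    fix \<omega> assume g: "\<not> bipartite G \<and> 2 \<le> genus G"
      and w: "\<omega> \<in> one_forms G" "form_class G \<omega> \<notin> {\<one>\<^bsub>character_group G\<^esub>, \<theta>}"
    then have "genus G \<noteq> 1" "\<not> bipartite G" by auto
    then have "spectral_radius (twisted_edge_adj G es \<omega>) \<noteq> spectral_radius (twisted_edge_adj G es (\<lambda>e. 0))"
      using edge_adj_extremal_not_bipartite[OF es, of \<omega>] w \<theta>_iff[OF w(1)] form_class_eq_one_iff[OF w(1)] by blast
    then show "spectral_radius (twisted_edge_adj G es \<omega>) < spectral_radius (twisted_edge_adj G es (\<lambda>e. 0))"
      using le(2)[of \<omega>] by linarith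
  next
    fix \<omega> assume g: "bipartite G \<and> 2 \<le> genus G"
      and w: "\<omega> \<in> one_forms G" "\<not> two_torsion (character_group G) (form_class G \<omega>)"
    then have "genus G \<noteq> 1" by auto
    then have "spectral_radius (twisted_edge_adj G es \<omega>) \<noteq> spectral_radius (twisted_edge_adj G es (\<lambda>e. 0))"
      using edge_adj_extremal_two_torsion[OF es, of \<omega>] w torsion by blast
    then show "spectral_radius (twisted_edge_adj G es \<omega>) < spectral_radius (twisted_edge_adj G es (\<lambda>e. 0))"
      using le(2)[of \<omega>] by linarith
  qed (rule neg tors bip le)+
qed

end
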